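(* Let $G$ be a weakly connected oriented graph on $n\ge 2$ vertices $1,\dots,n$ with $m\ge 1$ edges $e_1,\dots,e_m$, with non-zero edge weights in $\mathbb{C}\setminus\mathbb{R}^-$ and complex signless incidence matrix $N$. Suppose that $G$ contains cycles and that there exists an odd cycle $C$ with $wt(C)\in\mathbb{C}\setminus\mathbb{R}^-$ or an even cycle $C$ with $wt(C)\in\mathbb{C}\setminus\mathbb{R}^+$. Let $\mathcal{U}(G)$ be the set of all spanning subgraphs $H$ of $G$ with $n$ edges all of whose connected components $U_1,\dots,U_{c(H)}$ are unicyclic, such that the cycle $C_t$ of $U_t$ satisfies $wt(C_t)\in\mathbb{C}\setminus\mathbb{R}^+$ whenever it is even and $wt(C_t)\in\mathbb{C}\setminus\mathbb{R}^-$ whenever it is odd. Then $\operatorname{rank}(N)=n$ and the Moore--Penrose inverse $N^+$ of $N$ has entries $$(N^+)_{ij}=\frac{1}{\operatorname{vol}^2(N)}\sum_{H\in\mathcal{U}(G),\ e_i\in H}(N_H^+)_{ij}\prod_{t=1}^{c(H)}2|W_{U_t\setminus C_t}|\,\alpha(C_t),\qquad \operatorname{vol}^2(N)=\sum_{H\in\mathcal{U}(G)}\prod_{t=1}^{c(H)}2|W_{U_t\setminus C_t}|\,\alpha(C_t),$$ where $\alpha(C_t)=|wt(C_t)|-\operatorname{Re}(wt(C_t))$ if $C_t$ is even and $\alpha(C_t)=|wt(C_t)|+\operatorname{Re}(wt(C_t))$ if $C_t$ is odd, and where, for $e_i=(u,v)$ in the component $U_r$ of $H$ with cycle $C_r$,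 $$(N_H^+)_{ij}=\begin{cases}(-1)^{d^*(j,u)}\dfrac{\frac{wt(\gamma_{u\to j})}{|wt(\gamma_{u\to j})|}}{\sqrt{\overline{w_{uv}}}\left(\frac{w_{uv}}{|w_{uv}|}-\varepsilon\,\frac{wt(\gamma_{u\to v})}{|wt(\gamma_{u\to v})|}\right)} & \text{if } e_i\in C_r,\ j\in U_r,\\[3mm] 0 & \text{if } e_i\notin C_r,\ j\in U_r\setminus e_i[C_r],\\[1mm] (-1)^{d^*(j,u)}\dfrac{1}{\sqrt{w_{uv}}}\dfrac{|wt(\gamma_{j\to u})|}{wt(\gamma_{j\to u})} & \text{if } e_i\notin C_r,\ j\in U_r\setminus(e_i,u](C_r),\\[3mm] (-1)^{d^*(j,v)}\dfrac{1}{\sqrt{\overline{w_{uv}}}}\dfrac{|wt(\gamma_{j\to v})|}{wt(\gamma_{j\to v})} & \text{if } e_i\notin C_r,\ j\in U_r\setminus(e_i,v](C_r),\\[2mm] 0 & \text{if } j\notin U_r,\end{cases}$$ with $\varepsilon=1$ if $C_r$ is even and $\varepsilon=-1$ if $C_r$ is odd.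
   Context: An oriented graph $G$ is obtained from a finite simple undirected graph $G_u$ (its underlying graph) by giving each edge exactly one direction; it is weakly connected if $G_u$ is connected. Write $V(G)=\{1,\dots,n\}$ and $E(G)=\{e_1,\dots,e_m\}$. Each directed edge $(u,v)$ (from $u$ to $v$) has a non-zero complex weight $w_{uv}$. $\mathbb{R}^+$ and $\mathbb{R}^-$ denote the positive and the negative real numbers, and $\sqrt{\cdot}$ is the principal square root. The complex signless incidence matrix of $G$ is the $n\times m$ matrix $N=(n_{ij})$ where, for $e_j=(u,v)$, $n_{ij}=\sqrt{w_{uv}}$ if $i=u$, $n_{ij}=\sqrt{\overline{w_{uv}}}$ if $i=v$, and $n_{ij}=0$ otherwise. For a complex matrix $A$ of rank $r>0$, $\operatorname{vol}^2(A)$ is the sum of $|\det B|^2$ over all $r\times r$ submatrices $B$ of $A$. Put $a_{ij}=w_{ij}$ if $(i,j)\in E(G)$, $a_{ij}=\overline{w_{ji}}$ if $(j,i)\in E(G)$, and $a_{ij}=0$ otherwise. The weight of a walk $\gamma=(i_1,\dots,i_k)$ in $G_u$ is $wt(\gamma)=\prod_{s=1}^{k-1}a_{i_si_{s+1}}$ (so a trivial one-vertex walk has weight $1$). A cycle of $G$ means a cycle of $G_u$; $wt(C)$ is the weight of the closed walk going once around $C$ in either direction (the two directions give complex conjugate values, so conditions such as $wt(C)\in\mathbb{R}^\pm$ and the value $\operatorname{Re}(wt(C))$ do not depend on the choice). A unicyclic graph is a connected graph (weakly connected, for oriented graphs) with exactly one cycle; a spanning subgraph of $G$ has vertex set $V(G)$.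 $U_t\setminus C_t$ is obtained from $U_t$ by removing the edges of $C_t$, and $W_F$ is the product of all edge weights of an oriented graph $F$ (equal to $1$ if $F$ has no edges). $N_H$ is the complex signless incidence matrix of $H$; rows of $N_H^+$ are labelled by the edges of $H$ (keeping the labels from $G$) and columns by the vertices. If $e_i=(u,v)$ is an edge of $U_r$ not in $C_r$, then removing $e_i$ from $U_r$ leaves two components: a unicyclic one, denoted $U_r\setminus e_i[C_r]$, and a tree; the tree is denoted $U_r\setminus(e_i,u](C_r)$ if it contains $u$ and $U_r\setminus(e_i,v](C_r)$ if it contains $v$. For vertices $s,t$, $d^*(s,t)$ and $\gamma_{s\to t}$ denote the distance and the unique walk without repeated vertices from $s$ to $t$ in the underlying graph of $U_r$ with $e_i$ removed (if $e_i\in C_r$ this is a tree; if $e_i\notin C_r$ they are only used inside its tree component). *)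

theory Defs
  imports
    "Graph_Theory.Digraph_Component_Vwalk"
    "Jordan_Normal_Form.Schur_Decomposition"
    "Jordan_Normal_Form.DL_Rank"
    "Jordan_Normal_Form.DL_Submatrix"
begin

section \<open>Matrices\<close>

definition is_moore_penrose :: "complex mat \<Rightarrow> complex mat \<Rightarrow> bool" where
  "is_moore_penrose A X \<longleftrightarrow>
     X \<in> carrier_mat (dim_col A) (dim_row A) \<and>
     A * X * A = A \<and> X * A * X = X \<and>
     mat_adjoint (A * X) = A * X \<and> mat_adjoint (X * A) = X * A"

definition mp_inverse :: "complex mat \<Rightarrow> complex mat" where
  "mp_inverse A = (THE X. is_moore_penrose A X)"

definition vol2 :: "complex mat \<Rightarrow> real" where
  "vol2 A =
     (let r = vec_space.rank (dim_row A) A in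
      \<Sum>(I, J) \<in> {I. I \<subseteq> {..<dim_row A} \<and> card I = r} \<times> {J. J \<subseteq> {..<dim_col A} \<and> card J = r}.
        (cmod (det (submatrix A I J)))\<^sup>2)"

lemma mat_adjoint_dim:
  "dim_row (mat_adjoint A) = dim_col A" "dim_col (mat_adjoint A) = dim_row A"
  by (auto simp: mat_adjoint_def)

lemma mat_adjoint_index:
  assumes "i < dim_col A" "j < dim_row A"
  shows "mat_adjoint A $$ (i, j) = conjugate (A $$ (j, i))"
  using assms by (simp add: mat_adjoint_def mat_of_rows_index)

lemma mat_adjoint_mult:
  fixes A B :: "complex mat"
  assumes "dim_col A = dim_row B"
  shows "mat_adjoint (A * B) = mat_adjoint B * mat_adjoint A"
  using assms
  by (intro eq_matI)
     (auto simp: mat_adjoint_dim mat_adjoint_index scalar_prod_def mult.commute intro!: sum.cong)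

lemma is_moore_penrose_unique:
  assumes X: "is_moore_penrose A X" and Y: "is_moore_penrose A Y"
  shows "X = Y"
proof -
  define p q where "p = dim_row A" and "q = dim_col A"
  have cA: "A \<in> carrier_mat p q" and cX: "X \<in> carrier_mat q p" and cY: "Y \<in> carrier_mat q p"
    using X Y by (auto simp: is_moore_penrose_def p_def q_def)
  note c = cA cX cY
  have AXY: "A * X = A * Y"
  proof -
    have "A * X = mat_adjoint (A * Y * A * X)"
      using X Y by (simp add: is_moore_penrose_def)
    also have "A * Y * A * X = (A * Y) * (A * X)"
      using c by (meson assoc_mult_mat mult_carrier_mat)
    also have "mat_adjoint \<dots> = (A * X) * (A * Y)"
      using X Y c by (subst mat_adjoint_mult) (auto simp: is_moore_penrose_def)
    also have "\<dots> = A * X * A * Y"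
      using c by (metis assoc_mult_mat mult_carrier_mat)
    finally show ?thesis using X by (simp add: is_moore_penrose_def)
  qed
  have XYA: "X * A = Y * A"
  proof -
    have "X * A = mat_adjoint (X * (A * Y * A))"
      using X Y by (simp add: is_moore_penrose_def)
    also have "X * (A * Y * A) = (X * A) * (Y * A)"
      using c by (metis assoc_mult_mat mult_carrier_mat)
    also have "mat_adjoint \<dots> = (Y * A) * (X * A)"
      using X Y c by (subst mat_adjoint_mult) (auto simp: is_moore_penrose_def)
    also have "\<dots> = Y * (A * X * A)"
      using c by (metis assoc_mult_mat mult_carrier_mat)
    finally show ?thesis using X by (simp add: is_moore_penrose_def)
  qed
  have "X = X * A * X" using X by (simp add: is_moore_penrose_def)
  also have "\<dots> = Y * A * X" by (simp add: XYA)
  also have "\<dots> = Y * (A * X)" using c by (metis assoc_mult_mat)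
  also have "\<dots> = Y * A * Y" unfolding AXY using c by (metis assoc_mult_mat)
  finally show ?thesis using Y by (simp add: is_moore_penrose_def)
qed

lemma mp_inverse_eqI:
  "is_moore_penrose A X \<Longrightarrow> mp_inverse A = X"
  unfolding mp_inverse_def by (rule the_equality) (auto intro: is_moore_penrose_unique)

section \<open>Oriented graphs\<close>

text \<open>The underlying undirected graph of a digraph \<open>U\<close> is \<open>mk_symmetric U\<close>.\<close>

definition oriented_graph :: "'a pair_pre_digraph \<Rightarrow> bool" where
  "oriented_graph G \<longleftrightarrow> pair_digraph G \<and> (\<forall>x y. (x, y) \<in> parcs G \<longrightarrow> (y, x) \<notin> parcs G)"

text \<open>Connected components, as subgraphs; the analogue of \<open>pre_digraph.sccs\<close> for weak connectedness.\<close>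

definition wccs :: "'a pair_pre_digraph \<Rightarrow> 'a pair_pre_digraph set" where
  "wccs H = {U. induced_subgraph (with_proj U) (with_proj H) \<and> Digraph_Component.connected (with_proj U) \<and>
     \<not> (\<exists>U'. induced_subgraph (with_proj U') (with_proj H) \<and> Digraph_Component.connected (with_proj U') \<and>
             pverts U \<subset> pverts U')}"

text \<open>
  \<open>ucycle_walk U c\<close>: the vertex list \<open>c\<close> goes once around a cycle of the underlying graph
  (first vertex repeated at the end). The cycle itself is a subgraph without isolated vertices
  and is represented by its set of arcs, in the orientation they have in \<open>U\<close>, so that
  all starting points and both directions give the same cycle, and its length is its cardinality.
\<close>

definition ucycle_walk :: "'a pair_pre_digraph \<Rightarrow> 'a list \<Rightarrow> bool" where
  "ucycle_walk U c \<longleftrightarrow> vwalk c (with_proj (mk_symmetric (with_proj U))) \<and> hd c = last c \<and>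
     distinct (tl c) \<and> vwalk_length c \<ge> 3"

definition walk_arc_set :: "'a pair_pre_digraph \<Rightarrow> 'a list \<Rightarrow> ('a \<times> 'a) set" where
  "walk_arc_set U c =
     {(x, y) \<in> parcs U. (x, y) \<in> set (vwalk_arcs c) \<or> (y, x) \<in> set (vwalk_arcs c)}"

definition ucycles :: "'a pair_pre_digraph \<Rightarrow> ('a \<times> 'a) set set" where
  "ucycles U = {walk_arc_set U c | c. ucycle_walk U c}"

definition unicyclic :: "'a pair_pre_digraph \<Rightarrow> bool" where
  "unicyclic U \<longleftrightarrow> Digraph_Component.connected (with_proj U) \<and> (\<exists>!C. C \<in> ucycles U)"

definition the_cycle :: "'a pair_pre_digraph \<Rightarrow> ('a \<times> 'a) set" where
  "the_cycle U = (THE C. C \<in> ucycles U)"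

definition remove_arc :: "'a pair_pre_digraph \<Rightarrow> 'a \<times> 'a \<Rightarrow> 'a pair_pre_digraph" where
  "remove_arc U e = \<lparr> pverts = pverts U, parcs = parcs U - {e} \<rparr>"

definition component_of :: "'a pair_pre_digraph \<Rightarrow> 'a \<Rightarrow> 'a pair_pre_digraph" where
  "component_of T x = (THE K. K \<in> wccs T \<and> x \<in> pverts K)"

definition udist :: "'a pair_pre_digraph \<Rightarrow> 'a \<Rightarrow> 'a \<Rightarrow> nat" where
  "udist T x y = (LEAST k. \<exists>p. vwalk p (with_proj (mk_symmetric (with_proj T))) \<and>
     hd p = x \<and> last p = y \<and> vwalk_length p = k)"

definition the_path :: "'a pair_pre_digraph \<Rightarrow> 'a \<Rightarrow> 'a \<Rightarrow> 'a list" where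
  "the_path T x y = (THE p. vpath p (with_proj (mk_symmetric (with_proj T))) \<and> hd p = x \<and> last p = y)"

section \<open>Weights\<close>

abbreviation pos_reals :: "complex set" (\<open>\<real>\<^sup>+\<close>) where
  "pos_reals \<equiv> complex_of_real ` {0<..}"

abbreviation neg_reals :: "complex set" (\<open>\<real>\<^sup>-\<close>) where
  "neg_reals \<equiv> complex_of_real ` {..<0}"

definition adj_entry :: "'a pair_pre_digraph \<Rightarrow> ('a \<times> 'a \<Rightarrow> complex) \<Rightarrow> 'a \<times> 'a \<Rightarrow> complex" where
  "adj_entry G w = (\<lambda>(x, y). if (x, y) \<in> parcs G then w (x, y)
     else if (y, x) \<in> parcs G then cnj (w (y, x)) else 0)"

definition walk_wt :: "'a pair_pre_digraph \<Rightarrow> ('a \<times> 'a \<Rightarrow> complex) \<Rightarrow> 'a list \<Rightarrow> complex" where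
  "walk_wt G w p = prod_list (map (adj_entry G w) (vwalk_arcs p))"

text \<open>
  The weight of a cycle is determined only up to complex conjugation (direction of traversal);
  \<open>cycle_wt\<close> fixes an arbitrary traversal. Every use below is invariant under conjugation.
\<close>

definition cycle_wt :: "'a pair_pre_digraph \<Rightarrow> ('a \<times> 'a \<Rightarrow> complex) \<Rightarrow> ('a \<times> 'a) set \<Rightarrow> complex" where
  "cycle_wt G w C = walk_wt G w (SOME c. ucycle_walk G c \<and> walk_arc_set G c = C)"

definition alpha :: "'a pair_pre_digraph \<Rightarrow> ('a \<times> 'a \<Rightarrow> complex) \<Rightarrow> ('a \<times> 'a) set \<Rightarrow> real" where
  "alpha G w C =
     (if even (card C) then cmod (cycle_wt G w C) - Re (cycle_wt G w C)
      else cmod (cycle_wt G w C) + Re (cycle_wt G w C))"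

definition unicyclic_family ::
  "'a pair_pre_digraph \<Rightarrow> ('a \<times> 'a \<Rightarrow> complex) \<Rightarrow> 'a pair_pre_digraph set" where
  "unicyclic_family G w =
     {H. spanning (with_proj H) (with_proj G) \<and> card (parcs H) = card (pverts G) \<and>
         (\<forall>U \<in> wccs H. unicyclic U \<and>
            (even (card (the_cycle U)) \<longrightarrow> cycle_wt G w (the_cycle U) \<notin> \<real>\<^sup>+) \<and>
            (odd (card (the_cycle U)) \<longrightarrow> cycle_wt G w (the_cycle U) \<notin> \<real>\<^sup>-))}"

section \<open>The complex signless incidence matrix\<close>

text \<open>
  The vertices are \<open>0, \<dots>, n - 1\<close>, and the list \<open>es\<close> enumerates the arcs, so that
  column \<open>j\<close> belongs to the arc \<open>es ! j\<close> (rows and columns are numbered from 0).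
\<close>

definition signless_incidence ::
  "nat \<Rightarrow> (nat \<times> nat) list \<Rightarrow> (nat \<times> nat \<Rightarrow> complex) \<Rightarrow> complex mat" where
  "signless_incidence n es w = mat n (length es) (\<lambda>(i, j).
     if i = fst (es ! j) then csqrt (w (es ! j))
     else if i = snd (es ! j) then csqrt (cnj (w (es ! j)))
     else 0)"

text \<open>
  For a subgraph \<open>H\<close>, the arcs of \<open>H\<close> are enumerated in the order inherited from \<open>es\<close>.
  The matrix entry labelled by the arc \<open>es ! i\<close> of \<open>H\<close> and the vertex \<open>j\<close> is therefore found in
  the row whose number is the position of \<open>es ! i\<close> among the arcs of \<open>H\<close>.
\<close>

definition sub_arcs :: "(nat \<times> nat) list \<Rightarrow> nat pair_pre_digraph \<Rightarrow> (nat \<times> nat) list" where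
  "sub_arcs es H = filter (\<lambda>e. e \<in> parcs H) es"

definition sub_mp_entry ::
  "nat \<Rightarrow> (nat \<times> nat) list \<Rightarrow> (nat \<times> nat \<Rightarrow> complex) \<Rightarrow> nat pair_pre_digraph \<Rightarrow> nat \<Rightarrow> nat \<Rightarrow> complex" where
  "sub_mp_entry n es w H i j =
     mp_inverse (signless_incidence n (sub_arcs es H) w) $$ (length (sub_arcs (take i es) H), j)"

text \<open>
  The closed expression for that entry, where \<open>U\<close> is the (unicyclic) component of \<open>H\<close> containing
  the arc \<open>e = (u, v)\<close>. If \<open>e\<close> is not on the cycle, \<open>K\<close> is the one of the two components of
  \<open>U\<close> without \<open>e\<close> which contains \<open>j\<close>: either the unicyclic one, or the tree, which contains
  exactly one of \<open>u\<close> and \<open>v\<close>.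
\<close>

definition explicit_entry ::
  "'a pair_pre_digraph \<Rightarrow> ('a \<times> 'a \<Rightarrow> complex) \<Rightarrow> 'a pair_pre_digraph \<Rightarrow> 'a \<times> 'a \<Rightarrow> 'a \<Rightarrow> complex" where
  "explicit_entry G w U e j =
     (let u = fst e; v = snd e;
          C = the_cycle U;
          T = remove_arc U e;
          \<epsilon> = (if even (card C) then 1 else - 1);
          wt = (\<lambda>x y. walk_wt G w (the_path T x y));
          absval = (\<lambda>z. complex_of_real (cmod z));
          K = component_of T j
      in
      if j \<notin> pverts U then 0
      else if e \<in> C then
        (- 1) ^ udist T j u *
        ((wt u j / absval (wt u j)) /
         (csqrt (cnj (w e)) * (w e / absval (w e) - \<epsilon> * (wt u v / absval (wt u v)))))
      else if unicyclic K then 0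
      else if u \<in> pverts K then
        (- 1) ^ udist T j u * (1 / csqrt (w e)) * (absval (wt j u) / wt j u)
      else
        (- 1) ^ udist T j v * (1 / csqrt (cnj (w e))) * (absval (wt j v) / wt j v))"

end

(*
  For an arc {a, b} the column of the incidence matrix has entries s and cnj s with s^2 = a_{ab}, so
  a row vector y with y N = 0 satisfies y_b = - y_a a_{ab} / |a_{ab}| along every edge. Hence y is
  determined on a connected graph by one value, and going once around a cycle C forces y = 0 exactly
  when the weight of C is not (-1)^|C| |wt C|. This gives the rank of N and the rows of the inverses
  N_H^{-1}.

  For full row rank, N^+ M = N' with N' the adjoint and M = N N'. Cramer's rule and the
  Cauchy-Binet formula express N^+ and vol^2 N = det M through the square submatrices N_H with n
  columns, weighted by |det N_H|^2.
  The determinant of N_H vanishes by the pigeonhole principle unless every component has as many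
  arcs as vertices, i.e. is unicyclic. For a unicyclic component, sorting the vertices by their
  distance to the cycle makes N_H block triangular; the cycle block is cyclically bidiagonal with
  determinant P +- cnj P, where P^2 is the weight of the cycle.
*)
theory Submission
  imports Defs "Jordan_Normal_Form.DL_Rank_Submatrix"
begin

section \<open>Determinants and Moore--Penrose inverses\<close>

text \<open>Only |det|^2 enters, so the determinant may be treated as a function of a vertex set and
  an arc set (\<open>absdet\<close>), and each step lists rows and columns in the order that suits
  it. The family of subgraphs needs no separate characterisation: for a spanning subgraph with n
  arcs the squared modulus is zero exactly outside the family, because |wt C| - (-1)^|C| Re(wt C)
  vanishes exactly when wt C lies on the excluded half-axis. This factor is |P - (-1)^k cnj P|^2 up
  to a factor 2, namely 4 (Im P)^2 or 4 (Re P)^2; hence the 2 in front of \<alpha>. Excluding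
  negative weights is what makes the principal roots at the two ends of an arc conjugate to each
  other. The closed entries are found by solving for one row of the inverse: row e satisfies the
  homogeneous equation at every arc of H except e. So it vanishes on each component of H without e
  that still contains a cycle, and on the remaining tree its values spread along the unique paths
  from an end of e; the equation at e fixes the scale.\<close>

text \<open>An injection amounts to its image \<open>J\<close> together with the order in which it
  runs through \<open>J\<close>. As \<open>pick J\<close> enumerates \<open>J\<close> increasingly,
  that order is a permutation of the indices.\<close>

lemma sum_inj_PiE_by_image:
  fixes g :: "(nat \<Rightarrow> nat) \<Rightarrow> 'b::comm_monoid_add"
  shows "(\<Sum>f\<in>{f \<in> {0..<n} \<rightarrow>\<^sub>E {0..<m}. inj_on f {0..<n}}. g f) =
    (\<Sum>J\<in>{J. J \<subseteq> {..<m} \<and> card J = n}. \<Sum>q\<in>{q. q permutes {0..<n}}. g (restrict (pick J \<circ> q) {0..<n}))"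
proof -
  let ?F = "{f \<in> {0..<n} \<rightarrow>\<^sub>E {0..<m}. inj_on f {0..<n}}"
  let ?JJ = "{J. J \<subseteq> {..<m} \<and> card J = n}"
  have "(\<Sum>J\<in>?JJ. \<Sum>f\<in>{f\<in>?F. f ` {0..<n} = J}. g f) = (\<Sum>f\<in>?F. g f)"
  proof (rule sum.group)
    show "finite ?F" by (rule finite_subset[of _ "{0..<n} \<rightarrow>\<^sub>E {0..<m}"]) (auto intro: finite_PiE)
    show "finite ?JJ" by (rule finite_subset[of _ "Pow {..<m}"]) auto
    show "(\<lambda>f. f ` {0..<n}) ` ?F \<subseteq> ?JJ"
      by (auto simp: card_image PiE_def Pi_def)
  qed
  moreover have "(\<Sum>f\<in>{f\<in>?F. f ` {0..<n} = J}. g f) =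
      (\<Sum>q\<in>{q. q permutes {0..<n}}. g (restrict (pick J \<circ> q) {0..<n}))" if J: "J \<in> ?JJ" for J
  proof -
    have fJ: "finite J" using J by (auto intro: finite_subset)
    have bij: "bij_betw (pick J) {0..<n} J"
    proof (rule bij_betw_imageI)
      show inj: "inj_on (pick J) {0..<n}"
        using J pick_mono_le[of _ J] by (auto simp: inj_on_def) (metis nat_neq_iff)
      have "pick J ` {0..<n} \<subseteq> J" using J pick_in_set_le by auto
      then show "pick J ` {0..<n} = J"
        using J fJ inj by (intro card_subset_eq) (auto simp: card_image)
    qed
    have inv: "bij_betw (inv_into {0..<n} (pick J)) J {0..<n}" using bij by (rule bij_betw_inv_into)
    \<comment> \<open>The permutation is \<open>f\<close> followed by the inverse of
      \<open>pick J\<close>. It is extended by the identity because \<open>permutes\<close> speaks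
      about all of \<open>nat\<close>, while \<open>restrict\<close> makes the composition
      extensional, as \<open>PiE\<close> demands.\<close>
    show ?thesis
    proof (rule sum.reindex_bij_witness[where
        i = "\<lambda>q. restrict (pick J \<circ> q) {0..<n}" and
        j = "\<lambda>f i. if i < n then inv_into {0..<n} (pick J) (f i) else i"])
      fix f assume f: "f \<in> {f\<in>?F. f ` {0..<n} = J}"
      let ?q = "\<lambda>i. if i < n then inv_into {0..<n} (pick J) (f i) else i"
      have q: "pick J (inv_into {0..<n} (pick J) (f i)) = f i" if "i < n" for i
        using f that bij by (intro bij_betw_inv_into_right[OF bij]) auto
      show r: "restrict (pick J \<circ> ?q) {0..<n} = f"
        using f by (auto simp: fun_eq_iff restrict_def q PiE_def extensional_def)
      then show "g (restrict (pick J \<circ> ?q) {0..<n}) = g f" by simp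
      have "bij_betw f {0..<n} J" using f by (auto simp: bij_betw_def)
      from bij_betw_trans[OF this inv] have "bij_betw ?q {0..<n} {0..<n}"
        by (rule bij_betw_cong[THEN iffD1, rotated]) auto
      then show "?q \<in> {q. q permutes {0..<n}}"
        by (auto intro!: bij_imp_permutes)
    next
      fix q assume "q \<in> {q. q permutes {0..<n}}"
      then have q: "q permutes {0..<n}" by simp
      have lt: "q i < n \<longleftrightarrow> i < n" for i using permutes_in_image[OF q, of i] by auto
      have bq: "bij_betw (pick J \<circ> q) {0..<n} J"
        using bij_betw_trans[OF permutes_imp_bij[OF q] bij] .
      show "(\<lambda>i. if i < n then inv_into {0..<n} (pick J) (restrict (pick J \<circ> q) {0..<n} i) else i) = q"
        using lt bij_betw_inv_into_left[OF bij] permutes_not_in[OF q]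
        by (auto simp: fun_eq_iff)
      have "pick J (q i) < m" if "i < n" for i
        using that J bij_betwE[OF bq] by auto
      then show "restrict (pick J \<circ> q) {0..<n} \<in> {f\<in>?F. f ` {0..<n} = J}"
        using bq J lt unfolding bij_betw_def
        by (auto simp: inj_on_restrict_eq image_restrict_eq subset_eq)
    qed
  qed
  ultimately show ?thesis by simp
qed

text \<open>Expanding the row sums gives one term per map \<open>f\<close> from rows to middle
  indices. A non-injective \<open>f\<close> repeats a row of \<open>B\<close>. For the others,
  sorting the rows of \<open>B\<close> costs the sign that turns the sum over \<open>q\<close> into
  the determinant of the selected columns of \<open>A\<close>.\<close>

theorem Cauchy_Binet:
  fixes A B :: "'a::comm_ring_1 mat"
  assumes A: "A \<in> carrier_mat n m" and B: "B \<in> carrier_mat m n"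
  shows "det (A * B) = (\<Sum>J\<in>{J. J \<subseteq> {..<m} \<and> card J = n}.
    det (mat n n (\<lambda>(i, j). A $$ (i, pick J j))) * det (mat n n (\<lambda>(i, j). B $$ (pick J i, j))))"
proof -
  let ?P = "{p. p permutes {0..<n}}"
  let ?F = "{0..<n} \<rightarrow>\<^sub>E {0..<m}"
  let ?F' = "{f \<in> ?F. inj_on f {0..<n}}"
  let ?B = "\<lambda>f. mat n n (\<lambda>(i, j). B $$ (f i, j))"
  have finF: "finite ?F" by (auto intro: finite_PiE)
  have AB: "(A * B) $$ (i, p i) = (\<Sum>k\<in>{0..<m}. A $$ (i, k) * B $$ (k, p i))"
    if "p permutes {0..<n}" "i \<in> {0..<n}" for p i
    using that A B permutes_in_image[OF that(1), of i] by (simp add: scalar_prod_def)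
  have "det (A * B) = (\<Sum>p\<in>?P. signof p * (\<Prod>i = 0..<n. (A * B) $$ (i, p i)))"
    using A B by (subst det_def'[of _ n]) auto
  also have "\<dots> = (\<Sum>p\<in>?P. signof p * (\<Prod>i = 0..<n. \<Sum>k\<in>{0..<m}. A $$ (i, k) * B $$ (k, p i)))"
    by (intro sum.cong refl arg_cong2[where f = "(*)"] prod.cong AB) auto
  also have "\<dots> = (\<Sum>p\<in>?P. signof p * (\<Sum>f\<in>?F. \<Prod>i = 0..<n. A $$ (i, f i) * B $$ (f i, p i)))"
    by (subst prod_sum_PiE) auto
  also have "\<dots> = (\<Sum>p\<in>?P. \<Sum>f\<in>?F. (\<Prod>i = 0..<n. A $$ (i, f i)) * (signof p * (\<Prod>i = 0..<n. B $$ (f i, p i))))"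
    by (simp add: sum_distrib_left prod.distrib ac_simps)
  also have "\<dots> = (\<Sum>f\<in>?F. (\<Prod>i = 0..<n. A $$ (i, f i)) * (\<Sum>p\<in>?P. signof p * (\<Prod>i = 0..<n. B $$ (f i, p i))))"
    by (subst sum.swap) (simp add: sum_distrib_left)
  also have "\<dots> = (\<Sum>f\<in>?F. (\<Prod>i = 0..<n. A $$ (i, f i)) * det (?B f))"
  proof -
    have "(\<Sum>p\<in>?P. signof p * (\<Prod>i = 0..<n. B $$ (f i, p i))) = det (?B f)" for f
      by (subst det_def'[of _ n]) (auto intro!: sum.cong arg_cong2[where f = "(*)"] prod.cong)
    then show ?thesis by simp
  qed
  also have "\<dots> = (\<Sum>f\<in>?F'. (\<Prod>i = 0..<n. A $$ (i, f i)) * det (?B f))"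
  proof (rule sum.mono_neutral_right[OF finF])
    show "\<forall>f\<in>?F - ?F'. (\<Prod>i = 0..<n. A $$ (i, f i)) * det (?B f) = 0"
    proof
      fix f assume "f \<in> ?F - ?F'"
      then obtain i j where ij: "i < n" "j < n" "i \<noteq> j" "f i = f j" by (auto simp: inj_on_def)
      have "det (?B f) = 0"
        by (rule det_identical_rows[of _ n i j]) (use ij in auto)
      then show "(\<Prod>i = 0..<n. A $$ (i, f i)) * det (?B f) = 0" by simp
    qed
  qed auto
  also have "\<dots> = (\<Sum>J\<in>{J. J \<subseteq> {..<m} \<and> card J = n}. \<Sum>q\<in>?P.
      (\<Prod>i = 0..<n. A $$ (i, restrict (pick J \<circ> q) {0..<n} i)) * det (?B (restrict (pick J \<circ> q) {0..<n})))"
    by (rule sum_inj_PiE_by_image)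
  also have "\<dots> = (\<Sum>J\<in>{J. J \<subseteq> {..<m} \<and> card J = n}.
    det (mat n n (\<lambda>(i, j). A $$ (i, pick J j))) * det (?B (pick J)))"
  proof (rule sum.cong[OF refl])
    fix J
    have "(\<Prod>i = 0..<n. A $$ (i, restrict (pick J \<circ> q) {0..<n} i)) * det (?B (restrict (pick J \<circ> q) {0..<n}))
       = (signof q * (\<Prod>i = 0..<n. A $$ (i, pick J (q i)))) * det (?B (pick J))" if "q \<in> ?P" for q
    proof -
      have q: "q permutes {0..<n}" using that by simp
      have lt: "q i < n \<longleftrightarrow> i < n" for i using permutes_in_image[OF q, of i] by auto
      have "?B (restrict (pick J \<circ> q) {0..<n}) = mat n n (\<lambda>(i, j). ?B (pick J) $$ (q i, j))"
        by (rule eq_matI) (auto simp: lt)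
      then have "det (?B (restrict (pick J \<circ> q) {0..<n})) = signof q * det (?B (pick J))"
        using det_permute_rows[OF _ q, of "?B (pick J)"] by simp
      then show ?thesis by (simp add: ac_simps)
    qed
    then have "(\<Sum>q\<in>?P. (\<Prod>i = 0..<n. A $$ (i, restrict (pick J \<circ> q) {0..<n} i)) * det (?B (restrict (pick J \<circ> q) {0..<n})))
      = (\<Sum>q\<in>?P. signof q * (\<Prod>i = 0..<n. A $$ (i, pick J (q i)))) * det (?B (pick J))"
      unfolding sum_distrib_right by (intro sum.cong refl)
    also have "(\<Sum>q\<in>?P. signof q * (\<Prod>i = 0..<n. A $$ (i, pick J (q i)))) = det (mat n n (\<lambda>(i, j). A $$ (i, pick J j)))"
      by (subst det_def'[of _ n])
        (auto intro!: sum.cong arg_cong2[where f = "(*)"] prod.cong dest: permutes_in_image)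
    finally show "(\<Sum>q\<in>?P. (\<Prod>i = 0..<n. A $$ (i, restrict (pick J \<circ> q) {0..<n} i)) * det (?B (restrict (pick J \<circ> q) {0..<n})))
      = det (mat n n (\<lambda>(i, j). A $$ (i, pick J j))) * det (?B (pick J))" .
  qed
  finally show ?thesis .
qed

section \<open>Determinants of matrices with labelled rows and columns\<close>

text \<open>Vertices and arcs index the entries directly; the lists only choose an order, which can
  then be adapted to blocks and triangles.\<close>

definition det_on :: "('v \<Rightarrow> 'e \<Rightarrow> 'a::comm_ring_1) \<Rightarrow> 'v list \<Rightarrow> 'e list \<Rightarrow> 'a" where
  "det_on A vs es = det (mat (length vs) (length vs) (\<lambda>(i, j). A (vs ! i) (es ! j)))"

lemma distinct_set_eq_permutes:
  assumes "distinct xs" "distinct ys" "set xs = set ys"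
  obtains p where "p permutes {0..<length xs}" "ys = map (\<lambda>i. xs ! p i) [0..<length xs]"
proof -
  have "mset ys = mset xs" using assms by (metis set_eq_iff_mset_eq_distinct)
  then obtain p where p: "p permutes {..<length xs}" "permute_list p xs = ys"
    by (rule mset_eq_permutation)
  show thesis
    by (rule that[of p]) (use p in \<open>auto simp: permute_list_def atLeast0LessThan\<close>)
qed

lemma det_on_permute_rows:
  assumes "distinct vs" "distinct vs'" "set vs = set vs'"
  shows "cmod (det_on A vs es) = cmod (det_on A vs' es)"
proof -
  obtain p where p: "p permutes {0..<length vs}" "vs' = map (\<lambda>i. vs ! p i) [0..<length vs]"
    using distinct_set_eq_permutes[OF assms] .
  have lt: "p i < length vs \<longleftrightarrow> i < length vs" for i using permutes_in_image[OF p(1), of i] by auto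
  let ?n = "length vs"
  let ?M = "mat ?n ?n (\<lambda>(i, j). A (vs ! i) (es ! j))"
  have "mat ?n ?n (\<lambda>(i, j). A (vs' ! i) (es ! j)) = mat ?n ?n (\<lambda>(i, j). ?M $$ (p i, j))"
    by (rule eq_matI) (auto simp: p(2) lt)
  then have "det_on A vs' es = signof p * det_on A vs es"
    using det_permute_rows[OF _ p(1), of ?M] p(2) by (simp add: det_on_def)
  then show ?thesis by (simp add: norm_mult sign_def)
qed

lemma det_on_transpose:
  assumes "length vs = length es"
  shows "det_on (\<lambda>e v. A v e) es vs = det_on A vs es"
proof -
  let ?M = "mat (length vs) (length vs) (\<lambda>(i, j). A (vs ! i) (es ! j))"
  have "mat (length es) (length es) (\<lambda>(i, j). A (vs ! j) (es ! i)) = transpose_mat ?M"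
    using assms by (intro eq_matI) auto
  then show ?thesis unfolding det_on_def using det_transpose[of ?M "length vs"] by simp
qed

text \<open>The signs of both reorderings disappear in the modulus. Columns are reduced to rows by
  transposing.\<close>

lemma det_on_permute:
  assumes "distinct vs" "distinct vs'" "set vs = set vs'"
    and "distinct es" "distinct es'" "set es = set es'" and "length vs = length es"
  shows "cmod (det_on A vs es) = cmod (det_on A vs' es')"
proof -
  have l: "length vs' = length vs" "length es' = length es"
    using assms by (metis distinct_card)+
  have "cmod (det_on A vs es) = cmod (det_on A vs' es)" by (rule det_on_permute_rows) fact+
  also have "\<dots> = cmod (det_on (\<lambda>e v. A v e) es vs')" by (subst det_on_transpose) (use l assms in auto)
  also have "\<dots> = cmod (det_on (\<lambda>e v. A v e) es' vs')" by (rule det_on_permute_rows) fact+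
  also have "\<dots> = cmod (det_on A vs' es')" by (subst det_on_transpose) (use l assms in auto)
  finally show ?thesis .
qed

lemma det_on_append:
  fixes A :: "'v \<Rightarrow> 'e \<Rightarrow> 'a::idom"
  assumes "length vs1 = length es1" "length vs2 = length es2"
    and zero: "\<And>x e. x \<in> set vs2 \<Longrightarrow> e \<in> set es1 \<Longrightarrow> A x e = 0"
  shows "det_on A (vs1 @ vs2) (es1 @ es2) = det_on A vs1 es1 * det_on A vs2 es2"
proof -
  let ?m = "\<lambda>vs es. mat (length vs) (length es) (\<lambda>(i, j). A (vs ! i) (es ! j))"
  have "?m (vs1 @ vs2) (es1 @ es2) =
      four_block_mat (?m vs1 es1) (?m vs1 es2) (0\<^sub>m (length vs2) (length es1)) (?m vs2 es2)"
    by (rule eq_matI) (auto simp: nth_append zero assms(1,2))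
  then show ?thesis
    using det_four_block_mat_lower_left_zero[of "?m vs1 es1" "length vs1" "?m vs1 es2" "length vs2"
        "0\<^sub>m (length vs2) (length es1)" "?m vs2 es2"] assms(1,2)
    by (simp add: det_on_def)
qed

lemma det_on_triangular:
  assumes "length vs = length es"
    and zero: "\<And>i j. j < i \<Longrightarrow> i < length vs \<Longrightarrow> A (vs ! i) (es ! j) = 0"
  shows "det_on A vs es = (\<Prod>i<length vs. A (vs ! i) (es ! i))"
proof -
  let ?M = "mat (length vs) (length vs) (\<lambda>(i, j). A (vs ! i) (es ! j))"
  have "upper_triangular ?M" using zero by (auto simp: upper_triangular_def)
  then have "det ?M = prod_list (diag_mat ?M)" by (rule det_upper_triangular[of _ "length vs"]) simp
  then show ?thesis by (simp add: det_on_def prod_list_diag_prod lessThan_atLeast0)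
qed

text \<open>A permutation sends the rows in \<open>X\<close> injectively to columns, and
  \<open>Y\<close> has too few columns to receive them all. So every Leibniz term contains an entry
  outside \<open>Y\<close>, which is zero.\<close>

lemma det_on_pigeonhole:
  fixes A :: "'v \<Rightarrow> 'e \<Rightarrow> 'a::comm_ring_1"
  assumes "length vs = length es" "distinct vs" "distinct es"
    and X: "X \<subseteq> set vs" and card: "card (Y \<inter> set es) < card X"
    and zero: "\<And>x e. x \<in> X \<Longrightarrow> e \<in> set es \<Longrightarrow> e \<notin> Y \<Longrightarrow> A x e = 0"
  shows "det_on A vs es = 0"
proof -
  let ?n = "length vs"
  have "(\<Prod>i = 0..<?n. A (vs ! i) (es ! p i)) = 0" if p: "p permutes {0..<?n}" for p
  proof -
    have lt: "p i < ?n \<longleftrightarrow> i < ?n" for i using permutes_in_image[OF p, of i] by auto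
    define I where "I = {i. i < ?n \<and> vs ! i \<in> X}"
    have "X \<subseteq> (\<lambda>i. vs ! i) ` I"
    proof
      fix x assume x: "x \<in> X"
      then obtain i where "i < ?n" "x = vs ! i" using X by (metis in_set_conv_nth subsetD)
      then show "x \<in> (\<lambda>i. vs ! i) ` I" using x by (auto simp: I_def)
    qed
    then have "card X \<le> card I" by (intro surj_card_le) (auto simp: I_def)
    also have "card I = card ((\<lambda>i. es ! p i) ` I)"
    proof (rule card_image[symmetric], rule inj_onI)
      fix i j assume "i \<in> I" "j \<in> I" "es ! p i = es ! p j"
      then have "p i = p j" using lt assms(1,3) by (simp add: I_def nth_eq_iff_index_eq)
      then show "i = j" using permutes_inj[OF p] by (simp add: inj_eq)
    qed
    finally have "\<not> (\<lambda>i. es ! p i) ` I \<subseteq> Y \<inter> set es"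
      using card card_mono[of "Y \<inter> set es" "(\<lambda>i. es ! p i) ` I"] by auto
    then obtain i where i: "i \<in> I" "es ! p i \<notin> Y \<inter> set es" by blast
    then have "i < ?n" "vs ! i \<in> X" by (auto simp: I_def)
    moreover have "es ! p i \<in> set es" using \<open>i < ?n\<close> lt[of i] assms(1) by simp
    moreover have "es ! p i \<notin> Y" using i calculation by blast
    ultimately show ?thesis using zero by (intro prod_zero bexI[of _ i]) auto
  qed
  moreover have "(\<Prod>i = 0..<?n. mat ?n ?n (\<lambda>(i, j). A (vs ! i) (es ! j)) $$ (i, p i)) =
      (\<Prod>i = 0..<?n. A (vs ! i) (es ! p i))" if p: "p permutes {0..<?n}" for p
    by (rule prod.cong) (use permutes_in_image[OF p] in auto)
  ultimately show ?thesis unfolding det_on_def by (subst det_def'[of _ ?n]) (auto intro!: sum.neutral)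
qed

text \<open>A cyclically bidiagonal matrix is triangular after deleting row \<open>0\<close> and one of its two
  non-zero columns.\<close>
lemma det_cyclic_bidiagonal:
  fixes p q :: "nat \<Rightarrow> 'a::comm_ring_1"
  assumes k: "k \<ge> 2"
  shows "det (mat k k (\<lambda>(i, j). if i = j then p j else if i = Suc j mod k then q j else 0)) =
    (\<Prod>i<k. p i) + (- 1) ^ (k - 1) * (\<Prod>i<k. q i)"
proof -
  let ?A = "mat k k (\<lambda>(i, j). if i = j then p j else if i = Suc j mod k then q j else 0)"
  obtain n where n: "k = Suc n" "n \<ge> 1" using k by (cases k) auto
  have md: "Suc j mod k = (if j = n then 0 else Suc j)" if "j < k" for j
    using that n by auto
  have md': "Suc (Suc j) mod Suc n = (if Suc j = n then 0 else Suc (Suc j))" if "j < n" for j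
    using that by auto
  have A: "?A \<in> carrier_mat k k" by simp
  have "det ?A = (\<Sum>j<k. ?A $$ (0, j) * cofactor ?A 0 j)"
    by (rule laplace_expansion_row[OF A]) (use n in auto)
  also have "\<dots> = (\<Sum>j\<in>{0, n}. ?A $$ (0, j) * cofactor ?A 0 j)"
    by (rule sum.mono_neutral_right) (use n in \<open>auto simp: md\<close>)
  also have "\<dots> = p 0 * cofactor ?A 0 0 + q n * cofactor ?A 0 n"
    using n by (auto simp: md)
  also have "cofactor ?A 0 0 = (\<Prod>i<n. p (Suc i))"
  proof -
    have "mat_delete ?A 0 0 = mat n n (\<lambda>(i, j). if i = j then p (Suc j) else if i = Suc j then q (Suc j) else 0)"
      using n by (intro eq_matI) (auto simp: mat_delete_def md md')
    moreover have "det (mat n n (\<lambda>(i, j). if i = j then p (Suc j) else if i = Suc j then q (Suc j) else 0)) = (\<Prod>i<n. p (Suc i))"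
      by (subst det_lower_triangular[of n]) (auto simp: prod_list_diag_prod lessThan_atLeast0)
    ultimately show ?thesis by (simp add: cofactor_def)
  qed
  also have "cofactor ?A 0 n = (- 1) ^ n * (\<Prod>i<n. q i)"
  proof -
    have "mat_delete ?A 0 n = mat n n (\<lambda>(i, j). if j = i then q j else if j = Suc i then p j else 0)"
      using n by (intro eq_matI) (auto simp: mat_delete_def md)
    moreover have "det (mat n n (\<lambda>(i, j). if j = i then q j else if j = Suc i then p j else 0)) = (\<Prod>i<n. q i)"
      by (subst det_upper_triangular[of _ n])
        (auto simp: prod_list_diag_prod lessThan_atLeast0 upper_triangular_def)
    ultimately show ?thesis by (simp add: cofactor_def)
  qed
  also have "p 0 * (\<Prod>i<n. p (Suc i)) = (\<Prod>i<k. p i)"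
    unfolding n(1) by (rule prod.lessThan_Suc_shift[symmetric])
  finally show ?thesis by (simp add: n(1) ac_simps)
qed

text \<open>The choice of orders is immaterial as soon as both sets have the same size
  (\<open>absdet_eq\<close>), so this is a function of sets.\<close>

definition absdet :: "('v \<Rightarrow> 'e \<Rightarrow> complex) \<Rightarrow> 'v set \<Rightarrow> 'e set \<Rightarrow> real" where
  "absdet A V E = cmod (det_on A (SOME vs. distinct vs \<and> set vs = V) (SOME es. distinct es \<and> set es = E))"

lemma absdet_eq:
  assumes "distinct vs" "distinct es" "length vs = length es"
  shows "absdet A (set vs) (set es) = cmod (det_on A vs es)"
proof -
  let ?vs = "SOME xs. distinct xs \<and> set xs = set vs"
  let ?es = "SOME xs. distinct xs \<and> set xs = set es"
  have "distinct ?vs \<and> set ?vs = set vs" by (rule someI[of _ vs]) (use assms in simp)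
  moreover have "distinct ?es \<and> set ?es = set es" by (rule someI[of _ es]) (use assms in simp)
  ultimately show ?thesis unfolding absdet_def
    by (intro det_on_permute[symmetric]) (use assms in auto)
qed

lemma absdet_empty [simp]: "absdet A {} {} = 1"
  using absdet_eq[of "[]" "[]" A] by (simp add: det_on_def)

lemma absdet_Un:
  assumes "finite V1" "finite V2" "finite E1" "finite E2" "V1 \<inter> V2 = {}" "E1 \<inter> E2 = {}"
    and "card V1 = card E1" "card V2 = card E2"
    and zero: "\<And>x e. x \<in> V2 \<Longrightarrow> e \<in> E1 \<Longrightarrow> A x e = 0"
  shows "absdet A (V1 \<union> V2) (E1 \<union> E2) = absdet A V1 E1 * absdet A V2 E2"
proof -
  obtain vs1 vs2 es1 es2 where l: "distinct vs1" "set vs1 = V1" "distinct vs2" "set vs2 = V2"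
    "distinct es1" "set es1 = E1" "distinct es2" "set es2 = E2"
    using assms(1-4) by (meson finite_distinct_list)
  have len: "length vs1 = length es1" "length vs2 = length es2"
    using l assms by (metis distinct_card)+
  have "absdet A (set (vs1 @ vs2)) (set (es1 @ es2)) = cmod (det_on A (vs1 @ vs2) (es1 @ es2))"
    by (rule absdet_eq) (use l len assms in auto)
  also have "\<dots> = cmod (det_on A vs1 es1) * cmod (det_on A vs2 es2)"
    using det_on_append[OF len, of A] zero l by (simp add: norm_mult)
  finally show ?thesis using absdet_eq[of vs1 es1] absdet_eq[of vs2 es2] l len by simp
qed

lemma absdet_UN:
  assumes "finite W" and "\<And>U. U \<in> W \<Longrightarrow> finite (V U) \<and> finite (E U) \<and> card (V U) = card (E U)"
    and "\<And>U U'. U \<in> W \<Longrightarrow> U' \<in> W \<Longrightarrow> U \<noteq> U' \<Longrightarrow> V U \<inter> V U' = {} \<and> E U \<inter> E U' = {}"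
    and "\<And>U U' x e. U \<in> W \<Longrightarrow> U' \<in> W \<Longrightarrow> U \<noteq> U' \<Longrightarrow> x \<in> V U \<Longrightarrow> e \<in> E U' \<Longrightarrow> A x e = 0"
  shows "absdet A (\<Union>U\<in>W. V U) (\<Union>U\<in>W. E U) = (\<Prod>U\<in>W. absdet A (V U) (E U))"
  using assms
proof (induction W)
  case (insert U W)
  have IH: "absdet A (\<Union>U\<in>W. V U) (\<Union>U\<in>W. E U) = (\<Prod>U\<in>W. absdet A (V U) (E U))"
  proof (rule insert.IH, goal_cases)
    case 1 then show ?case using insert.prems(1) by blast
  next
    case 2 then show ?case using insert.prems(2) by blast
  next
    case 3 then show ?case using insert.prems(3) by blast
  qed
  have disj: "V U \<inter> V U' = {} \<and> E U \<inter> E U' = {}" if "U' \<in> W" for U'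
    using insert.prems(2)[of U U'] insert.hyps that by auto
  have "absdet A (V U \<union> (\<Union>U\<in>W. V U)) (E U \<union> (\<Union>U\<in>W. E U)) =
      absdet A (V U) (E U) * absdet A (\<Union>U\<in>W. V U) (\<Union>U\<in>W. E U)"
  proof (rule absdet_Un)
    show "card (\<Union>U\<in>W. V U) = card (\<Union>U\<in>W. E U)"
      using insert.prems(1,2) insert.hyps(1)
      by (subst (1 2) card_UN_disjoint) auto
    show "A x e = 0" if "x \<in> (\<Union>U\<in>W. V U)" "e \<in> E U" for x e
      using that insert.prems(3)[of _ U] insert.hyps by blast
  qed (use insert.prems(1) insert.hyps(1) disj in auto)
  then show ?case using IH insert.hyps by simp
qed simp

section \<open>Cramer's rule and Moore-Penrose inverses at full row rank\<close>

lemma index_mult_mat_sum: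
  assumes "A \<in> carrier_mat n m" "B \<in> carrier_mat m p" "i < n" "j < p"
  shows "(A * B) $$ (i, j) = (\<Sum>a<m. A $$ (i, a) * B $$ (a, j))"
  using assms by (simp add: scalar_prod_def lessThan_atLeast0)

text \<open>The new row \<open>j\<close> is a combination of the rows of \<open>M\<close>, of which
  only the \<open>j\<close>th itself contributes. Since \<open>cramer_lemma_mat\<close> replaces a
  column, the proof passes to transposes.\<close>

lemma cramer_row:
  fixes M :: "'a::idom mat"
  assumes M: "M \<in> carrier_mat n n" and j: "j < n"
    and r: "\<And>c. c < n \<Longrightarrow> r c = (\<Sum>a<n. x a * M $$ (a, c))"
  shows "det (mat n n (\<lambda>(a, c). if a = j then r c else M $$ (a, c))) = x j * det M"
proof -
  let ?R = "mat n n (\<lambda>(a, c). if a = j then r c else M $$ (a, c))"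
  let ?v = "transpose_mat M *\<^sub>v vec n x"
  have "transpose_mat ?R = replace_col (transpose_mat M) ?v j"
    using M by (intro eq_matI)
      (auto simp: replace_col_def r scalar_prod_def lessThan_atLeast0 mult.commute intro!: sum.cong)
  then have "det ?R = det (replace_col (transpose_mat M) ?v j)"
    using det_transpose[of ?R n] by simp
  also have "\<dots> = vec n x $ j * det (transpose_mat M)"
    by (rule cramer_lemma_mat) (use M j in auto)
  finally show ?thesis using j det_transpose[OF M] by simp
qed

lemma det_adjoint:
  fixes M :: "complex mat"
  assumes "M \<in> carrier_mat n n"
  shows "det (mat_adjoint M) = cnj (det M)"
proof -
  have "mat_adjoint M = transpose_mat (map_mat cnj M)"
    using assms by (intro eq_matI) (auto simp: mat_adjoint_dim mat_adjoint_index)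
  then have "det (mat_adjoint M) = det (map_mat cnj M)"
    using det_transpose[of "map_mat cnj M" n] assms by simp
  also have "\<dots> = cnj (det M)"
  proof -
    have "cnj (of_int (sign p)) = of_int (sign p)" for p :: "nat \<Rightarrow> nat" by (simp add: sign_def)
    then show ?thesis using assms permutes_in_image
      by (auto simp: det_def'[of _ n] cnj_sum cnj_prod intro!: sum.cong prod.cong)
  qed
  finally show ?thesis .
qed

text \<open>The witness is \<open>X = mat_adjoint A * B\<close> with \<open>B\<close> the inverse of
  the Gram matrix. It is a right inverse of \<open>A\<close>, so three Penrose equations are
  immediate; the fourth needs \<open>B\<close> to be hermitian.\<close>

lemma mp_inverse_full_row_rank:
  fixes A :: "complex mat"
  assumes A: "A \<in> carrier_mat n m" and det: "det (A * mat_adjoint A) \<noteq> 0"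
  shows "mp_inverse A \<in> carrier_mat m n" "mp_inverse A * (A * mat_adjoint A) = mat_adjoint A"
proof -
  let ?M = "A * mat_adjoint A"
  have A': "mat_adjoint A \<in> carrier_mat m n" using A by (auto simp: mat_adjoint_dim intro: carrier_matI)
  have M: "?M \<in> carrier_mat n n" using A A' by auto
  obtain B where B: "B \<in> carrier_mat n n" "B * ?M = 1\<^sub>m n" "?M * B = 1\<^sub>m n"
    using det_non_zero_imp_unit[OF M det, of undefined] by (auto simp: Units_def ring_mat_simps)
  have adj_adj: "mat_adjoint (mat_adjoint A) = A"
    by (rule eq_matI) (auto simp: mat_adjoint_dim mat_adjoint_index)
  have adj_M: "mat_adjoint ?M = ?M"
    using A A' by (subst mat_adjoint_mult) (auto simp: adj_adj)
  have adj_1: "mat_adjoint (1\<^sub>m n) = (1\<^sub>m n :: complex mat)"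
    by (rule eq_matI) (auto simp: mat_adjoint_dim mat_adjoint_index)
  have adj_B: "mat_adjoint B \<in> carrier_mat n n" using B by (auto simp: mat_adjoint_dim intro: carrier_matI)
  have "mat_adjoint B * ?M = 1\<^sub>m n"
  proof -
    have "mat_adjoint (?M * B) = mat_adjoint B * mat_adjoint ?M" using B M by (intro mat_adjoint_mult) auto
    then show ?thesis using B adj_M adj_1 by simp
  qed
  \<comment> \<open>The adjoint of \<open>B\<close> is a left inverse of the hermitian
    \<open>?M\<close>, and a left inverse coincides with the right inverse \<open>B\<close>.\<close>
  then have BB: "mat_adjoint B = B"
  proof -
    have "mat_adjoint B = mat_adjoint B * (?M * B)" using B adj_B by simp
    also have "\<dots> = mat_adjoint B * ?M * B" using B M adj_B by (intro assoc_mult_mat[symmetric]) auto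
    finally show ?thesis using B \<open>mat_adjoint B * ?M = 1\<^sub>m n\<close> by simp
  qed
  define X where "X = mat_adjoint A * B"
  have X: "X \<in> carrier_mat m n" using A' B by (auto simp: X_def)
  have "A * X = ?M * B" unfolding X_def using A A' B by (intro assoc_mult_mat[symmetric]) auto
  then have AX: "A * X = 1\<^sub>m n" using B by simp
  have "is_moore_penrose A X" unfolding is_moore_penrose_def
  proof (intro conjI)
    show "X \<in> carrier_mat (dim_col A) (dim_row A)" using X A by simp
    show "A * X * A = A" using AX A by simp
    have "X * A * X = X * (A * X)" using X A by (intro assoc_mult_mat) auto
    then show "X * A * X = X" using X AX by simp
    show "mat_adjoint (A * X) = A * X" using AX adj_1 by simp
    have "mat_adjoint (X * A) = mat_adjoint A * mat_adjoint X" using X A by (intro mat_adjoint_mult) auto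
    also have "mat_adjoint X = B * A"
      unfolding X_def using A' B A BB adj_adj by (subst mat_adjoint_mult) auto
    also have "mat_adjoint A * (B * A) = X * A"
      unfolding X_def using A' B A by (intro assoc_mult_mat[symmetric]) auto
    finally show "mat_adjoint (X * A) = X * A" .
  qed
  then have mp: "mp_inverse A = X" by (rule mp_inverse_eqI)
  show "mp_inverse A \<in> carrier_mat m n" using mp X by simp
  have "X * ?M = mat_adjoint A * (B * ?M)" unfolding X_def using A' B M by (intro assoc_mult_mat) auto
  then show "mp_inverse A * ?M = mat_adjoint A" using mp B A' by simp
qed

lemma mp_inverse_square:
  fixes A :: "complex mat"
  assumes A: "A \<in> carrier_mat n n" and det: "det A \<noteq> 0"
  shows "mp_inverse A \<in> carrier_mat n n" "mp_inverse A * A = 1\<^sub>m n"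
proof -
  obtain B where B: "B \<in> carrier_mat n n" "B * A = 1\<^sub>m n" "A * B = 1\<^sub>m n"
    using det_non_zero_imp_unit[OF A det, of undefined] by (auto simp: Units_def ring_mat_simps)
  have "mat_adjoint (1\<^sub>m n) = (1\<^sub>m n :: complex mat)"
    by (rule eq_matI) (auto simp: mat_adjoint_dim mat_adjoint_index)
  then have "mp_inverse A = B"
    using A B by (intro mp_inverse_eqI) (auto simp: is_moore_penrose_def)
  then show "mp_inverse A \<in> carrier_mat n n" "mp_inverse A * A = 1\<^sub>m n" using B by auto
qed

definition pick_cols :: "'a mat \<Rightarrow> nat set \<Rightarrow> 'a mat" where
  "pick_cols A J = mat (dim_row A) (dim_row A) (\<lambda>(i, j). A $$ (i, pick J j))"

text \<open>Selecting the rows \<open>J\<close> of the adjoint gives the adjoint of the selected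
  columns, so each term is a determinant times its conjugate.\<close>

lemma det_gram_Cauchy_Binet:
  fixes A :: "complex mat"
  assumes A: "A \<in> carrier_mat n m"
  shows "det (A * mat_adjoint A) =
    of_real (\<Sum>J\<in>{J. J \<subseteq> {..<m} \<and> card J = n}. (cmod (det (pick_cols A J)))\<^sup>2)"
proof -
  have A': "mat_adjoint A \<in> carrier_mat m n" using A by (auto simp: mat_adjoint_dim intro: carrier_matI)
  have *: "det (mat n n (\<lambda>(i, j). mat_adjoint A $$ (pick J i, j))) = cnj (det (pick_cols A J))"
    if J: "J \<subseteq> {..<m}" "card J = n" for J
  proof -
    have "pick J i < m" if "i < n" for i using J that pick_in_set_le[of i J] by auto
    then have "mat n n (\<lambda>(i, j). mat_adjoint A $$ (pick J i, j)) = mat_adjoint (pick_cols A J)"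
      using A by (intro eq_matI) (auto simp: mat_adjoint_dim mat_adjoint_index pick_cols_def)
    then show ?thesis using det_adjoint[of "pick_cols A J" n] A by (simp add: pick_cols_def)
  qed
  show ?thesis
    unfolding Cauchy_Binet[OF A A'] of_real_sum
    by (intro sum.cong refl) (use A in \<open>auto simp: * pick_cols_def complex_norm_square simp del: of_real_power\<close>)
qed

text \<open>Cramer's rule applied to \<open>A\<^sup>+ (A A\<^sup>*) = A\<^sup>*\<close>: replacing row \<open>j\<close> of \<open>A A\<^sup>*\<close> by row \<open>i\<close> of \<open>A\<^sup>*\<close>
  gives \<open>A' A\<^sup>*\<close>, where \<open>A'\<close> is \<open>A\<close> with row \<open>j\<close> replaced by the \<open>i\<close>th unit row.\<close>
theorem mp_inverse_Cauchy_Binet: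
  fixes A :: "complex mat"
  assumes A: "A \<in> carrier_mat n m" and det: "det (A * mat_adjoint A) \<noteq> 0" and i: "i < m" and j: "j < n"
  shows "mp_inverse A $$ (i, j) = 1 / det (A * mat_adjoint A) *
    (\<Sum>J\<in>{J. J \<subseteq> {..<m} \<and> card J = n \<and> i \<in> J \<and> det (pick_cols A J) \<noteq> 0}.
      mp_inverse (pick_cols A J) $$ (card {a\<in>J. a < i}, j) * of_real ((cmod (det (pick_cols A J)))\<^sup>2))"
proof -
  let ?M = "A * mat_adjoint A" and ?X = "mp_inverse A"
  let ?A' = "mat n m (\<lambda>(a, c). if a = j then (if c = i then 1 else 0) else A $$ (a, c))"
  let ?JJ = "{J. J \<subseteq> {..<m} \<and> card J = n}"
  have adj: "mat_adjoint A \<in> carrier_mat m n" using A by (auto simp: mat_adjoint_dim intro: carrier_matI)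
  have M: "?M \<in> carrier_mat n n" using A adj by auto
  note X = mp_inverse_full_row_rank[OF A det]
  have "mat_adjoint A $$ (i, c) = (\<Sum>a<n. ?X $$ (i, a) * ?M $$ (a, c))" if "c < n" for c
  proof -
    have "mat_adjoint A $$ (i, c) = (?X * ?M) $$ (i, c)" using X by simp
    also have "\<dots> = (\<Sum>a<n. ?X $$ (i, a) * ?M $$ (a, c))"
      by (rule index_mult_mat_sum[OF X(1) M i that])
    finally show ?thesis .
  qed
  from cramer_row[OF M j this]
  have "?X $$ (i, j) * det ?M = det (mat n n (\<lambda>(a, c). if a = j then mat_adjoint A $$ (i, c) else ?M $$ (a, c)))"
    by simp
  also have "mat n n (\<lambda>(a, c). if a = j then mat_adjoint A $$ (i, c) else ?M $$ (a, c)) = ?A' * mat_adjoint A"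
  proof (rule eq_matI)
    fix a c assume "a < dim_row (?A' * mat_adjoint A)" "c < dim_col (?A' * mat_adjoint A)"
    then have ac: "a < n" "c < n" using adj by auto
    have "(?A' * mat_adjoint A) $$ (a, c) = (\<Sum>b<m. ?A' $$ (a, b) * mat_adjoint A $$ (b, c))"
      using adj ac by (simp add: scalar_prod_def lessThan_atLeast0)
    also have "\<dots> = (if a = j then \<Sum>b<m. (if b = i then mat_adjoint A $$ (b, c) else 0)
        else \<Sum>b<m. A $$ (a, b) * mat_adjoint A $$ (b, c))"
    proof (cases "a = j")
      case True
      show ?thesis unfolding if_P[OF True] by (rule sum.cong) (use ac True in auto)
    next
      case False
      show ?thesis unfolding if_not_P[OF False] by (rule sum.cong) (use ac False in auto)
    qed
    also have "\<dots> = (if a = j then mat_adjoint A $$ (i, c) else ?M $$ (a, c))"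
    proof -
      have "(\<Sum>b<m. if b = i then mat_adjoint A $$ (b, c) else 0) = mat_adjoint A $$ (i, c)"
        using i by (subst sum.delta) auto
      then show ?thesis using index_mult_mat_sum[OF A adj ac] by simp
    qed
    finally show "mat n n (\<lambda>(a, c). if a = j then mat_adjoint A $$ (i, c) else ?M $$ (a, c)) $$ (a, c) =
      (?A' * mat_adjoint A) $$ (a, c)" using ac by simp
  qed (use adj in auto)
  also have "det \<dots> = (\<Sum>J\<in>?JJ. det (mat n n (\<lambda>(a, c). ?A' $$ (a, pick J c))) *
      det (mat n n (\<lambda>(a, c). mat_adjoint A $$ (pick J a, c))))"
    by (rule Cauchy_Binet[OF _ adj]) simp
  also have "\<dots> = (\<Sum>J\<in>{J. J \<subseteq> {..<m} \<and> card J = n \<and> i \<in> J \<and> det (pick_cols A J) \<noteq> 0}.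
      mp_inverse (pick_cols A J) $$ (card {a\<in>J. a < i}, j) * of_real ((cmod (det (pick_cols A J)))\<^sup>2))"
  proof (rule sum.mono_neutral_cong_right)
    show "finite ?JJ" by (rule finite_subset[of _ "Pow {..<m}"]) auto
    have B: "pick_cols A J \<in> carrier_mat n n" for J using A by (simp add: pick_cols_def)
    have lt: "pick J a < m" if "J \<in> ?JJ" "a < n" for J a using that pick_in_set_le[of a J] by auto
    have adj_J: "det (mat n n (\<lambda>(a, c). mat_adjoint A $$ (pick J a, c))) = cnj (det (pick_cols A J))"
      if J: "J \<in> ?JJ" for J
    proof -
      have "mat n n (\<lambda>(a, c). mat_adjoint A $$ (pick J a, c)) = mat_adjoint (pick_cols A J)"
        using A lt[OF J] by (intro eq_matI) (auto simp: mat_adjoint_dim mat_adjoint_index pick_cols_def)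
      then show ?thesis using det_adjoint[OF B] by simp
    qed
    show "\<forall>J\<in>?JJ - {J. J \<subseteq> {..<m} \<and> card J = n \<and> i \<in> J \<and> det (pick_cols A J) \<noteq> 0}.
      det (mat n n (\<lambda>(a, c). ?A' $$ (a, pick J c))) * det (mat n n (\<lambda>(a, c). mat_adjoint A $$ (pick J a, c))) = 0"
    proof
      fix J assume J: "J \<in> ?JJ - {J. J \<subseteq> {..<m} \<and> card J = n \<and> i \<in> J \<and> det (pick_cols A J) \<noteq> 0}"
      show "det (mat n n (\<lambda>(a, c). ?A' $$ (a, pick J c))) * det (mat n n (\<lambda>(a, c). mat_adjoint A $$ (pick J a, c))) = 0"
      proof (cases "i \<in> J")
        case False
        \<comment> \<open>The only 1 of the new row \<open>j\<close> stands in column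
          \<open>i\<close>, which \<open>J\<close> does not select. The row is then zero, and
          Cramer's rule with all coefficients 0 makes the determinant vanish.\<close>
        have "pick J c \<noteq> i" if "c < n" for c using False J that pick_in_set_le[of c J] by auto
        then have "mat n n (\<lambda>(a, c). ?A' $$ (a, pick J c)) =
            mat n n (\<lambda>(a, c). if a = j then 0 else mat n n (\<lambda>(a, c). ?A' $$ (a, pick J c)) $$ (a, c))"
          using j J lt by (intro eq_matI) auto
        then have "det (mat n n (\<lambda>(a, c). ?A' $$ (a, pick J c))) = 0"
          using cramer_row[of "mat n n (\<lambda>(a, c). ?A' $$ (a, pick J c))" n j "\<lambda>_. 0" "\<lambda>_. 0"] j
          by simp
        then show ?thesis by simp
      next
        case True
        then show ?thesis using J adj_J[of J] by auto
      qed
    qed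
    fix J assume J': "J \<in> {J. J \<subseteq> {..<m} \<and> card J = n \<and> i \<in> J \<and> det (pick_cols A J) \<noteq> 0}"
    then have J: "J \<in> ?JJ" and iJ: "i \<in> J" and detJ: "det (pick_cols A J) \<noteq> 0" by auto
    \<comment> \<open>The position, counted from 0, of column \<open>i\<close> among the columns
      selected by \<open>J\<close>.\<close>
    let ?k = "card {a\<in>J. a < i}" and ?B = "pick_cols A J"
    have fJ: "finite J" using J by (auto intro: finite_subset)
    have k: "?k < n" using J iJ fJ by (auto intro!: psubset_card_mono)
    have pk: "pick J ?k = i" using pick_card_in_set[OF iJ] .
    have pick_eq: "pick J c = i \<longleftrightarrow> c = ?k" if "c < n" for c
    proof -
      have "c < ?k \<Longrightarrow> pick J c < i" using pick_mono_le[of ?k J c] k J pk by simp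
      moreover have "?k < c \<Longrightarrow> i < pick J c" using pick_mono_le[of c J ?k] that J pk by simp
      ultimately show ?thesis using pk by (metis less_irrefl linorder_neqE_nat)
    qed
    note Y = mp_inverse_square[OF B detJ]
    \<comment> \<open>The unit row at \<open>?k\<close> is row \<open>?k\<close> of the inverse
      times \<open>?B\<close>. Cramer's rule therefore yields the entry \<open>(?k, j)\<close> of
      the inverse of \<open>?B\<close>.\<close>
    have r: "(if c = ?k then 1 else 0) = (\<Sum>a<n. mp_inverse ?B $$ (?k, a) * ?B $$ (a, c))" if "c < n" for c
    proof -
      have "(\<Sum>a<n. mp_inverse ?B $$ (?k, a) * ?B $$ (a, c)) = (mp_inverse ?B * ?B) $$ (?k, c)"
        using Y(1) B[of J] k that by (simp add: scalar_prod_def lessThan_atLeast0)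
      then show ?thesis using Y(2) k that by simp
    qed
    have "mat n n (\<lambda>(a, c). ?A' $$ (a, pick J c)) = mat n n (\<lambda>(a, c). if a = j then if c = ?k then 1 else 0 else ?B $$ (a, c))"
      using lt[OF J] A by (intro eq_matI) (auto simp: pick_eq pick_cols_def)
    then have "det (mat n n (\<lambda>(a, c). ?A' $$ (a, pick J c))) = mp_inverse ?B $$ (?k, j) * det ?B"
      using cramer_row[OF B j r] by simp
    then show "det (mat n n (\<lambda>(a, c). ?A' $$ (a, pick J c))) * det (mat n n (\<lambda>(a, c). mat_adjoint A $$ (pick J a, c))) =
       mp_inverse ?B $$ (?k, j) * of_real ((cmod (det ?B))\<^sup>2)"
      using adj_J[OF J] by (simp add: complex_norm_square del: of_real_power)
  qed auto
  finally show ?thesis using det by (simp add: field_simps)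
qed

lemma rank_le_nr: 
  fixes A :: "'a::field mat"
  assumes "A \<in> carrier_mat n m" shows "vec_space.rank n A \<le> n"
proof -
  interpret vec_space "TYPE('a)" n .
  have c: "set (cols A) \<subseteq> carrier_vec n" using assms cols_dim by blast
  have "rank A = vectorspace.dim class_ring (span_vs (set (cols A)))" by (simp add: rank_def)
  also have "\<dots> \<le> dim" by (rule subspace_dim(1)) (use c span_is_subspace fin_dim_span_cols[OF assms] in auto)
  finally show ?thesis by (simp add: dim_is_n)
qed

text \<open>By \<open>det_gram_Cauchy_Binet\<close> some minor with all \<open>n\<close> rows is
  non-zero, so the rank is \<open>n\<close>. The only row set of that size is the full one, which
  leaves a sum over column sets.\<close>

lemma full_row_rank:
  fixes A :: "complex mat"
  assumes A: "A \<in> carrier_mat n m" and det: "det (A * mat_adjoint A) \<noteq> 0"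
  shows "vec_space.rank n A = n"
    and "vol2 A = (\<Sum>J\<in>{J. J \<subseteq> {..<m} \<and> card J = n}. (cmod (det (pick_cols A J)))\<^sup>2)"
proof -
  have sub: "submatrix A {..<n} J = pick_cols A J" if "J \<subseteq> {..<m}" "card J = n" for J
  proof -
    have "{i. i < n \<and> i \<in> {..<n}} = {..<n}" "{j. j < m \<and> j \<in> J} = J" using that by auto
    moreover have "pick {..<n} i = i" if "i < n" for i
    proof -
      have "{a \<in> {..<n}. a < i} = {..<i}" using that by auto
      then show ?thesis using pick_card_in_set[of i "{..<n}"] that by simp
    qed
    ultimately show ?thesis using A that
      by (intro eq_matI) (auto simp: submatrix_def pick_cols_def)
  qed
  have "\<exists>J. J \<subseteq> {..<m} \<and> card J = n \<and> det (pick_cols A J) \<noteq> 0"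
  proof (rule ccontr)
    assume "\<not> ?thesis"
    then have "(\<Sum>J\<in>{J. J \<subseteq> {..<m} \<and> card J = n}. (cmod (det (pick_cols A J)))\<^sup>2) = 0"
      by (intro sum.neutral) auto
    then show False using det unfolding det_gram_Cauchy_Binet[OF A] by simp
  qed
  then obtain J where J: "J \<subseteq> {..<m}" "card J = n" "det (pick_cols A J) \<noteq> 0" by auto
  have "card {j. j < m \<and> j \<in> J} \<le> vec_space.rank n A"
    using vec_space.rank_gt_minor[OF A, of "{..<n}" J] sub[of J] J by simp
  moreover have "{j. j < m \<and> j \<in> J} = J" using J by auto
  ultimately show rank: "vec_space.rank n A = n" using rank_le_nr[OF A] J by simp
  have rows: "{I. I \<subseteq> {..<n} \<and> card I = n} = {{..<n}}"
    using card_subset_eq[of "{..<n}"] by auto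
  have "vol2 A = (\<Sum>(I, J)\<in>{{..<n}} \<times> {J. J \<subseteq> {..<m} \<and> card J = n}. (cmod (det (submatrix A I J)))\<^sup>2)"
    using A unfolding vol2_def Let_def by (simp add: rank rows)
  also have "\<dots> = (\<Sum>J\<in>{J. J \<subseteq> {..<m} \<and> card J = n}. (cmod (det (submatrix A {..<n} J)))\<^sup>2)"
    by (subst sum.cartesian_product[symmetric]) simp
  also have "\<dots> = (\<Sum>J\<in>{J. J \<subseteq> {..<m} \<and> card J = n}. (cmod (det (pick_cols A J)))\<^sup>2)"
    by (intro sum.cong refl) (use sub in auto)
  finally show "vol2 A = (\<Sum>J\<in>{J. J \<subseteq> {..<m} \<and> card J = n}. (cmod (det (pick_cols A J)))\<^sup>2)" .
qed

section \<open>Walks, components and cycles of oriented graphs\<close>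

abbreviation uadj :: "'a pair_pre_digraph \<Rightarrow> ('a \<times> 'a) set" where
  "uadj U \<equiv> parcs U \<union> (parcs U)\<inverse>"

abbreviation uwalk :: "'a pair_pre_digraph \<Rightarrow> 'a list \<Rightarrow> bool" where
  "uwalk U p \<equiv> vwalk p (with_proj (mk_symmetric (with_proj U)))"

lemma uadj_sym: "(x, y) \<in> (uadj U)\<^sup>* \<Longrightarrow> (y, x) \<in> (uadj U)\<^sup>*"
  by (rule symD[OF sym_rtrancl[OF sym_Un_converse]])

lemma parcs_mk_symmetric_uadj: "parcs (mk_symmetric (with_proj U)) = uadj U"
  by (auto simp: mk_symmetric_def)

lemma uwalk_iff: "uwalk U p \<longleftrightarrow> p \<noteq> [] \<and> set p \<subseteq> pverts U \<and> set (vwalk_arcs p) \<subseteq> uadj U"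
  by (auto simp: vwalk_def parcs_mk_symmetric_uadj)

lemma vwalk_arcs_conv_zip: "vwalk_arcs p = zip p (tl p)"
  by (induction p rule: vwalk_arcs.induct) auto

lemma set_vwalk_arcs: "set (vwalk_arcs p) = {(p ! i, p ! Suc i) | i. Suc i < length p}"
  by (force simp: vwalk_arcs_conv_zip set_zip nth_tl)

lemma vwalk_arcs_rev: "vwalk_arcs (rev p) = rev (map prod.swap (vwalk_arcs p))"
proof (induction p)
  case (Cons x p)
  then show ?case
    using vwalk_arcs_append[of "rev p" "[x]"] by (cases "p = []") (auto simp: last_rev)
qed simp

lemma uwalk_rev: "uwalk U (rev p) \<longleftrightarrow> uwalk U p"
  by (auto simp: uwalk_iff vwalk_arcs_rev)

lemma uwalk_mono:
  "uwalk U p \<Longrightarrow> pverts U \<subseteq> pverts U' \<Longrightarrow> parcs U \<subseteq> parcs U' \<Longrightarrow> uwalk U' p"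
  unfolding uwalk_iff by blast

lemma uwalk_hd_last: "uwalk U p \<Longrightarrow> hd p \<in> pverts U \<and> last p \<in> pverts U"
  by (auto simp: uwalk_iff)

lemma uwalk_reach: "uwalk U p \<Longrightarrow> y \<in> set p \<Longrightarrow> (hd p, y) \<in> (uadj U)\<^sup>*"
proof (induction p)
  case (Cons x p)
  show ?case
  proof (cases "p = [] \<or> y = x")
    case True then show ?thesis using Cons.prems by (cases p) (auto simp: uwalk_iff)
  next
    case False
    then have "uwalk U p" "(x, hd p) \<in> uadj U" using Cons.prems(1) by (auto simp: uwalk_iff)
    with Cons.IH Cons.prems(2) False show ?thesis by (auto intro: converse_rtrancl_into_rtrancl)
  qed
qed simp

lemma oriented_graphD:
  assumes "oriented_graph U"
  shows "finite (pverts U)" "finite (parcs U)" "pair_wf_digraph U"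
    "\<And>a b. (a, b) \<in> parcs U \<Longrightarrow> a \<in> pverts U \<and> b \<in> pverts U \<and> a \<noteq> b \<and> (b, a) \<notin> parcs U"
proof -
  interpret pair_digraph U using assms by (simp add: oriented_graph_def)
  show "finite (pverts U)" "finite (parcs U)" "pair_wf_digraph U"
    by (simp_all add: pair_finite_verts pair_finite_arcs pair_wf_digraph)
  show "a \<in> pverts U \<and> b \<in> pverts U \<and> a \<noteq> b \<and> (b, a) \<notin> parcs U" if "(a, b) \<in> parcs U" for a b
    using that assms in_arcsD1 in_arcsD2 no_loops' by (auto simp: oriented_graph_def)
qed

lemma oriented_graphI:
  assumes "finite (pverts U)" "parcs U \<subseteq> pverts U \<times> pverts U"
    "\<And>a b. (a, b) \<in> parcs U \<Longrightarrow> (b, a) \<notin> parcs U"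
  shows "oriented_graph U"
proof -
  have "finite (parcs U)" using assms(1,2) by (rule_tac finite_subset[OF _ finite_cartesian_product]) auto
  moreover have "fst e \<noteq> snd e" if "e \<in> parcs U" for e
    using assms(3)[of "fst e" "snd e"] that by (cases e) auto
  ultimately have "pair_digraph U" using assms by unfold_locales auto
  then show ?thesis using assms(3) by (auto simp: oriented_graph_def)
qed

lemma oriented_subgraph:
  assumes "oriented_graph G" "pverts U \<subseteq> pverts G" "parcs U \<subseteq> parcs G" "parcs U \<subseteq> pverts U \<times> pverts U"
  shows "oriented_graph U"
  using oriented_graphD[OF assms(1)] assms by (intro oriented_graphI) (auto intro: finite_subset)

lemma uadj_verts: "oriented_graph U \<Longrightarrow> (a, b) \<in> uadj U \<Longrightarrow> a \<in> pverts U \<and> b \<in> pverts U \<and> a \<noteq> b"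
  using oriented_graphD(4) by fastforce

lemma reach_verts:
  assumes "oriented_graph U" "x \<in> pverts U" "(x, y) \<in> (uadj U)\<^sup>*" shows "y \<in> pverts U"
  using assms(3,2) by (induction) (use uadj_verts[OF assms(1)] in auto)

lemma reach_upath:
  assumes U: "oriented_graph U" and "x \<in> pverts U" and r: "(x, y) \<in> (uadj U)\<^sup>*"
  shows "\<exists>p. uwalk U p \<and> distinct p \<and> hd p = x \<and> last p = y"
proof -
  have "\<exists>p. uwalk U p \<and> hd p = x \<and> last p = y" using r
  proof (induction rule: converse_rtrancl_induct)
    case base
    then show ?case using reach_verts[OF assms] by (intro exI[of _ "[y]"]) (auto simp: uwalk_iff)
  next
    case (step x z)
    then obtain p where p: "uwalk U p" "hd p = z" "last p = y" by auto
    have "uwalk U (x # p)" using p(1,2) step.hyps(1) uadj_verts[OF U step.hyps(1)] by (auto simp: uwalk_iff)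
    then show ?case using p by (intro exI[of _ "x # p"]) (auto simp: uwalk_iff)
  qed
  then show ?thesis using vwalk_imp_ex_vpath by (metis vpathE)
qed

text \<open>Arcs never leave \<open>pverts U\<close>, so reachability relative to the vertex set is
  the plain closure of \<open>uadj U\<close>.\<close>

lemma connected_iff:
  assumes "oriented_graph U"
  shows "Digraph_Component.connected (with_proj U) \<longleftrightarrow>
    pverts U \<noteq> {} \<and> (\<forall>x\<in>pverts U. \<forall>y\<in>pverts U. (x, y) \<in> (uadj U)\<^sup>*)"
proof -
  have "(x, y) \<in> rtrancl_on (pverts U) (uadj U) \<longleftrightarrow> (x, y) \<in> (uadj U)\<^sup>*"
    if "x \<in> pverts U" "y \<in> pverts U" for x y
    using rtrancl_on_rtranclI[of x y "pverts U" "uadj U"]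
      rtrancl_consistent_rtrancl_on[of x y "uadj U" "pverts U"] that uadj_verts[OF assms] by blast
  then show ?thesis
    by (auto simp: Digraph_Component.connected_def strongly_connected_def reachable_def
        parcs_mk_symmetric_uadj)
qed

section \<open>Connected components as reachability classes\<close>

lemma oriented_graph_wf: "oriented_graph H \<Longrightarrow> wf_digraph (with_proj H)"
  using oriented_graphD(3) wf_digraph_wp_iff by blast

lemma induced_subgraph_pairs:
  assumes H: "oriented_graph H"
  shows "induced_subgraph (with_proj U) (with_proj H) \<longleftrightarrow>
    pverts U \<subseteq> pverts H \<and> parcs U = {e \<in> parcs H. fst e \<in> pverts U \<and> snd e \<in> pverts U}"
proof -
  have "wf_digraph (with_proj U)" if "parcs U = {e \<in> parcs H. fst e \<in> pverts U \<and> snd e \<in> pverts U}"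
    using that by unfold_locales auto
  then show ?thesis
    using oriented_graph_wf[OF H] by (auto simp: induced_subgraph_def subgraph_def)
qed

text \<open>The concrete form of the component of \<open>x\<close>; \<open>wccs\<close> itself is
  defined by maximality, which is awkward to compute with.\<close>

definition ucomp :: "'a pair_pre_digraph \<Rightarrow> 'a \<Rightarrow> 'a pair_pre_digraph" where
  "ucomp H x = \<lparr>pverts = {y. (x, y) \<in> (uadj H)\<^sup>*},
     parcs = {e \<in> parcs H. (x, fst e) \<in> (uadj H)\<^sup>* \<and> (x, snd e) \<in> (uadj H)\<^sup>*}\<rparr>"

lemma induced_oriented:
  assumes "oriented_graph H" "pverts U \<subseteq> pverts H"
    "parcs U = {e \<in> parcs H. fst e \<in> pverts U \<and> snd e \<in> pverts U}"
  shows "oriented_graph U"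
  by (rule oriented_subgraph[OF assms(1,2)]) (use assms(3) in auto)

lemma uadj_rtrancl_mono: "parcs U \<subseteq> parcs H \<Longrightarrow> (x, y) \<in> (uadj U)\<^sup>* \<Longrightarrow> (x, y) \<in> (uadj H)\<^sup>*"
  by (rule subsetD[OF rtrancl_mono]) auto

lemma ucomp:
  assumes H: "oriented_graph H" and x: "x \<in> pverts H"
  shows "induced_subgraph (with_proj (ucomp H x)) (with_proj H)"
    and "oriented_graph (ucomp H x)" and "Digraph_Component.connected (with_proj (ucomp H x))"
proof -
  let ?U = "ucomp H x"
  have sub: "pverts ?U \<subseteq> pverts H" using reach_verts[OF H x] by (auto simp: ucomp_def)
  have arcs: "parcs ?U = {e \<in> parcs H. fst e \<in> pverts ?U \<and> snd e \<in> pverts ?U}" by (simp add: ucomp_def)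
  show "induced_subgraph (with_proj ?U) (with_proj H)" using sub arcs induced_subgraph_pairs[OF H] by blast
  show U: "oriented_graph ?U" by (rule induced_oriented[OF H sub arcs])
  have reach: "(x, y) \<in> (uadj ?U)\<^sup>*" if "(x, y) \<in> (uadj H)\<^sup>*" for y
    using that
  proof induction
    case (step y z)
    have "(x, z) \<in> (uadj H)\<^sup>*" using rtrancl_into_rtrancl[OF step.hyps] .
    then have "(y, z) \<in> uadj ?U" using step.hyps by (auto simp: ucomp_def)
    then show ?case by (rule rtrancl_into_rtrancl[OF step.IH])
  qed simp
  have "(y, z) \<in> (uadj ?U)\<^sup>*" if "y \<in> pverts ?U" "z \<in> pverts ?U" for y z
    using reach[of y] reach[of z] that uadj_sym[of x y ?U] by (auto simp: ucomp_def intro: rtrancl_trans)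
  moreover have "x \<in> pverts ?U" by (simp add: ucomp_def)
  ultimately show "Digraph_Component.connected (with_proj ?U)" unfolding connected_iff[OF U] by blast
qed

text \<open>A connected subgraph through \<open>x\<close> lies inside the class of \<open>x\<close>.
  Hence classes are maximal, and a maximal connected induced subgraph fills the class of any of its
  vertices.\<close>

lemma wccs_eq_ucomp:
  assumes H: "oriented_graph H"
  shows "wccs H = ucomp H ` pverts H"
proof (intro subset_antisym subsetI)
  fix U assume U: "U \<in> wccs H"
  then have ind: "induced_subgraph (with_proj U) (with_proj H)"
    and con: "Digraph_Component.connected (with_proj U)"
    and maxi: "\<And>U'. induced_subgraph (with_proj U') (with_proj H) \<Longrightarrow>
      Digraph_Component.connected (with_proj U') \<Longrightarrow> \<not> pverts U \<subset> pverts U'"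
    unfolding wccs_def by blast+
  have sub: "pverts U \<subseteq> pverts H" "parcs U = {e \<in> parcs H. fst e \<in> pverts U \<and> snd e \<in> pverts U}"
    using ind induced_subgraph_pairs[OF H] by blast+
  have orU: "oriented_graph U" by (rule induced_oriented[OF H sub])
  obtain x where x: "x \<in> pverts U" using con connected_iff[OF orU] by auto
  have xH: "x \<in> pverts H" using x sub by blast
  have "pverts U \<subseteq> pverts (ucomp H x)"
  proof
    fix y assume "y \<in> pverts U"
    then have "(x, y) \<in> (uadj U)\<^sup>*" using con x unfolding connected_iff[OF orU] by blast
    then show "y \<in> pverts (ucomp H x)"
      using uadj_rtrancl_mono[of U H x y] sub(2) by (auto simp: ucomp_def)
  qed
  then have eq: "pverts U = pverts (ucomp H x)"
    using maxi[OF ucomp(1)[OF H xH] ucomp(3)[OF H xH]] by blast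
  moreover have "parcs U = parcs (ucomp H x)" using sub(2) eq by (simp add: ucomp_def)
  ultimately have "U = ucomp H x" by simp
  then show "U \<in> ucomp H ` pverts H" using xH by blast
next
  fix U assume "U \<in> ucomp H ` pverts H"
  then obtain x where x: "x \<in> pverts H" "U = ucomp H x" by blast
  have "\<not> pverts U \<subset> pverts U'"
    if U': "induced_subgraph (with_proj U') (with_proj H)" "Digraph_Component.connected (with_proj U')" for U'
  proof
    assume ss: "pverts U \<subset> pverts U'"
    have sub: "pverts U' \<subseteq> pverts H" "parcs U' = {e \<in> parcs H. fst e \<in> pverts U' \<and> snd e \<in> pverts U'}"
      using U'(1) induced_subgraph_pairs[OF H] by blast+
    have orU: "oriented_graph U'" by (rule induced_oriented[OF H sub])
    have "x \<in> pverts U'" using ss x by (auto simp: ucomp_def)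
    then have "pverts U' \<subseteq> pverts U"
      using U'(2) uadj_rtrancl_mono[of U' H x] sub(2) x(2) unfolding connected_iff[OF orU]
      by (auto simp: ucomp_def)
    then show False using ss by blast
  qed
  then show "U \<in> wccs H" unfolding wccs_def using ucomp(1,3)[OF H x(1)] x(2) by blast
qed

lemma wccsD:
  assumes H: "oriented_graph H" and U: "U \<in> wccs H"
  shows "oriented_graph U" "Digraph_Component.connected (with_proj U)" "pverts U \<subseteq> pverts H"
    "parcs U \<subseteq> parcs H" "pverts U \<noteq> {}"
    "\<And>x y. x \<in> pverts U \<Longrightarrow> (x, y) \<in> uadj H \<Longrightarrow> (x, y) \<in> uadj U \<and> y \<in> pverts U"
proof -
  obtain x where x: "x \<in> pverts H" "U = ucomp H x" using U wccs_eq_ucomp[OF H] by blast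
  show "oriented_graph U" "Digraph_Component.connected (with_proj U)" using ucomp[OF H x(1)] x(2) by auto
  show "pverts U \<subseteq> pverts H" using reach_verts[OF H x(1)] x(2) by (auto simp: ucomp_def)
  show "parcs U \<subseteq> parcs H" "pverts U \<noteq> {}" using x(2) by (auto simp: ucomp_def)
  fix y z assume "y \<in> pverts U" "(y, z) \<in> uadj H"
  then have "(x, y) \<in> (uadj H)\<^sup>*" "(x, z) \<in> (uadj H)\<^sup>*" "(y, z) \<in> uadj H"
    using x by (auto simp: ucomp_def intro: rtrancl_into_rtrancl)
  then show "(y, z) \<in> uadj U \<and> z \<in> pverts U" using x(2) by (auto simp: ucomp_def)
qed

lemma wccs_reach:
  assumes H: "oriented_graph H" and U: "U \<in> wccs H" and x: "x \<in> pverts U"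
  shows "y \<in> pverts U \<longleftrightarrow> (x, y) \<in> (uadj H)\<^sup>*"
proof
  assume "y \<in> pverts U"
  then have "(x, y) \<in> (uadj U)\<^sup>*"
    using wccsD(2)[OF H U] x unfolding connected_iff[OF wccsD(1)[OF H U]] by blast
  then show "(x, y) \<in> (uadj H)\<^sup>*" using uadj_rtrancl_mono wccsD(4)[OF H U] by metis
next
  assume "(x, y) \<in> (uadj H)\<^sup>*"
  then show "y \<in> pverts U" by induction (use x wccsD(6)[OF H U] in auto)
qed

lemma wccs_disjoint:
  assumes H: "oriented_graph H" and "U \<in> wccs H" "U' \<in> wccs H" "x \<in> pverts U" "x \<in> pverts U'"
  shows "U = U'"
proof -
  have eq: "pverts U = pverts U'" using wccs_reach[OF H] assms(2-5) by blast
  moreover have "parcs U = parcs U'"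
    using assms(2,3) eq unfolding wccs_def induced_subgraph_pairs[OF H] by simp
  ultimately show ?thesis by simp
qed

lemma wccs_cover: "oriented_graph H \<Longrightarrow> x \<in> pverts H \<Longrightarrow> \<exists>U\<in>wccs H. x \<in> pverts U"
  by (rule bexI[of _ "ucomp H x"]) (auto simp: wccs_eq_ucomp, simp add: ucomp_def)

lemma wccs_arcs:
  assumes H: "oriented_graph H" shows "(\<Union>U\<in>wccs H. parcs U) = parcs H"
proof (intro subset_antisym subsetI)
  fix e assume e: "e \<in> parcs H"
  obtain U where U: "U \<in> wccs H" "fst e \<in> pverts U"
    using wccs_cover[OF H, of "fst e"] oriented_graphD(4)[OF H, of "fst e" "snd e"] e by auto
  have "(fst e, snd e) \<in> uadj U"
    using wccsD(6)[OF H U, of "snd e"] e by auto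
  moreover have "(snd e, fst e) \<notin> parcs U"
    using oriented_graphD(4)[OF H, of "fst e" "snd e"] e wccsD(4)[OF H U(1)] by auto
  ultimately show "e \<in> (\<Union>U\<in>wccs H. parcs U)" using U(1) by auto
qed (use wccsD(4)[OF H] in blast)

lemma wccs_verts: "oriented_graph H \<Longrightarrow> (\<Union>U\<in>wccs H. pverts U) = pverts H"
  using wccs_cover[of H] wccsD(3)[of H] by (auto simp: subset_iff)

lemma finite_wccs: "oriented_graph H \<Longrightarrow> finite (wccs H)"
  by (simp add: wccs_eq_ucomp oriented_graphD(1))

lemma component_of:
  assumes T: "oriented_graph T" and x: "x \<in> pverts T"
  shows "component_of T x \<in> wccs T" "x \<in> pverts (component_of T x)"
proof -
  have "\<exists>!K. K \<in> wccs T \<and> x \<in> pverts K" using wccs_cover[OF assms] wccs_disjoint[OF T] by blast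
  from theI'[OF this] show "component_of T x \<in> wccs T" "x \<in> pverts (component_of T x)"
    unfolding component_of_def by blast+
qed

section \<open>Cycles and the removal of an arc\<close>

lemma remove_arc_simps [simp]:
  "pverts (remove_arc U e) = pverts U" "parcs (remove_arc U e) = parcs U - {e}"
  by (simp_all add: remove_arc_def)

lemma oriented_remove_arc:
  assumes U: "oriented_graph U" shows "oriented_graph (remove_arc U e)"
  by (rule oriented_subgraph[OF U]) (use oriented_graphD(4)[OF U] in auto)

text \<open>Index form of a cycle walk: the closing vertex is stored at position \<open>k\<close>,
  and the vertices at positions below \<open>k\<close> are distinct.\<close>

lemma ucycle_walkD:
  assumes U: "oriented_graph U" and c: "ucycle_walk U c" and k: "k = length c - 1"
  shows "3 \<le> k" "length c = Suc k" "c ! k = c ! 0" "inj_on ((!) c) {..<k}"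
    "\<And>i. i < k \<Longrightarrow> (c ! i, c ! Suc i) \<in> uadj U" "set c \<subseteq> pverts U"
proof -
  have w: "uwalk U c" "hd c = last c" "distinct (tl c)" "3 \<le> k" using c k by (auto simp: ucycle_walk_def)
  show "3 \<le> k" by fact
  show len: "length c = Suc k" using k w(4) by auto
  have "c \<noteq> []" using w(4) k by auto
  then show ck: "c ! k = c ! 0" using w(2) k by (simp add: hd_conv_nth last_conv_nth)
  show "(c ! i, c ! Suc i) \<in> uadj U" if "i < k" for i
    using w(1) that len unfolding uwalk_iff set_vwalk_arcs by auto
  show "set c \<subseteq> pverts U" using w(1) by (simp add: uwalk_iff)
  have d: "c ! Suc i = c ! Suc j \<longleftrightarrow> i = j" if "i < k" "j < k" for i j
    using w(3) that len nth_eq_iff_index_eq[of "tl c" i j] by (simp add: nth_tl)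
  show "inj_on ((!) c) {..<k}"
  proof (rule inj_onI)
    fix i j assume ij: "i \<in> {..<k}" "j \<in> {..<k}" "c ! i = c ! j"
    \<comment> \<open>Distinctness is known for \<open>tl c\<close>, that is for positions 1 to
      \<open>k\<close>. The index of \<open>c ! i\<close> in \<open>tl c\<close> is
      \<open>m i\<close>, where position 0 is read as position \<open>k\<close>.\<close>
    define m where "m = (\<lambda>i. if i = 0 then k - 1 else i - 1)"
    have m: "c ! Suc (m i) = c ! i" "m i < k" if "i < k" for i
      using that ck w(4) by (auto simp: m_def)
    have "m i = m j" using d[of "m i" "m j"] m ij by simp
    then show "i = j" using ij by (auto simp: m_def split: if_splits)
  qed
qed

definition cycle_arc :: "'a pair_pre_digraph \<Rightarrow> 'a list \<Rightarrow> nat \<Rightarrow> 'a \<times> 'a" where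
  "cycle_arc U c i = (if (c ! i, c ! Suc i) \<in> parcs U then (c ! i, c ! Suc i) else (c ! Suc i, c ! i))"

text \<open>Two steps of the walk along the same arc would have to traverse it in opposite
  directions. They would then be consecutive and close a cycle of length 2, which
  \<open>k \<ge> 3\<close> excludes.\<close>

lemma cycle_arc_bij:
  assumes U: "oriented_graph U" and c: "ucycle_walk U c"
  shows "bij_betw (cycle_arc U c) {..<length c - 1} (walk_arc_set U c)"
proof (rule bij_betw_imageI)
  define k where "k = length c - 1"
  note D = ucycle_walkD[OF U c k_def]
  have inj: "c ! i = c ! j \<longleftrightarrow> i = j" if "i < k" "j < k" for i j
    using D(4) that by (auto simp: inj_on_def)
  have lt: "\<not> (i < j \<and> j < k \<and> cycle_arc U c i = cycle_arc U c j)" for i j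
  proof
    assume ij: "i < j \<and> j < k \<and> cycle_arc U c i = cycle_arc U c j"
    then have "c ! i \<noteq> c ! j" using inj[of i j] by simp
    then have "c ! i = c ! Suc j" "c ! Suc i = c ! j"
      using ij unfolding cycle_arc_def by (auto split: if_splits)
    then have j: "j = Suc i" using inj[of "Suc i" j] ij by simp
    show False
    proof (cases "Suc j < k")
      case True then show False using \<open>c ! i = c ! Suc j\<close> inj[of i "Suc j"] ij by simp
    next
      case False
      then have "Suc j = k" using ij by simp
      then have "c ! i = c ! 0" using \<open>c ! i = c ! Suc j\<close> D(3) by simp
      then have "i = 0" using inj[of i 0] ij by simp
      then show False using \<open>Suc j = k\<close> j D(1) by simp
    qed
  qed
  show "inj_on (cycle_arc U c) {..<length c - 1}"
    using lt by (intro linorder_inj_onI') (auto simp: k_def)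
  have "cycle_arc U c i \<in> walk_arc_set U c" if "i < k" for i
    using D(5)[OF that] D(2) that by (auto simp: cycle_arc_def walk_arc_set_def set_vwalk_arcs)
  moreover have "e \<in> cycle_arc U c ` {..<k}" if e_in: "e \<in> walk_arc_set U c" for e
  proof -
    obtain x y where e: "e = (x, y)" "(x, y) \<in> parcs U" and
      "(x, y) \<in> set (vwalk_arcs c) \<or> (y, x) \<in> set (vwalk_arcs c)"
      using e_in by (auto simp: walk_arc_set_def)
    then obtain i where i: "i < k" "(x, y) = (c ! i, c ! Suc i) \<or> (y, x) = (c ! i, c ! Suc i)"
      using D(2) unfolding set_vwalk_arcs by auto
    then have "cycle_arc U c i = e" using e oriented_graphD(4)[OF U e(2)] by (auto simp: cycle_arc_def)
    then show ?thesis using i(1) by auto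
  qed
  ultimately show "cycle_arc U c ` {..<length c - 1} = walk_arc_set U c" by (auto simp: k_def)
qed

lemma card_walk_arc_set:
  "oriented_graph U \<Longrightarrow> ucycle_walk U c \<Longrightarrow> card (walk_arc_set U c) = length c - 1"
  using bij_betw_same_card[OF cycle_arc_bij] by fastforce

text \<open>The rest of the cycle is a detour around \<open>e\<close>: onwards to position
  \<open>k\<close>, which is position 0, and up to \<open>i\<close>. With
  \<open>removed_reach_cycle\<close>, an arc lies on a cycle exactly if its ends stay connected
  without it.\<close>

lemma cycle_arc_removed:
  assumes U: "oriented_graph U" and C: "C \<in> ucycles U" and e: "e \<in> C"
  shows "(fst e, snd e) \<in> (uadj (remove_arc U e))\<^sup>*"
proof -
  obtain c where c: "ucycle_walk U c" "C = walk_arc_set U c" using C by (auto simp: ucycles_def)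
  define k where "k = length c - 1"
  note D = ucycle_walkD[OF U c(1) k_def]
  note bij = cycle_arc_bij[OF U c(1), folded k_def c(2)]
  obtain i where i: "i < k" "e = cycle_arc U c i" using bij e by (auto simp: bij_betw_def)
  let ?R = "uadj (remove_arc U e)"
  have step: "(c ! j, c ! Suc j) \<in> ?R" if "j < k" "j \<noteq> i" for j
  proof -
    have "cycle_arc U c j \<noteq> e" using bij that i by (auto simp: bij_betw_def inj_on_def)
    then show ?thesis using D(5)[OF that(1)] by (auto simp: cycle_arc_def split: if_splits)
  qed
  have up: "(c ! Suc i, c ! (Suc i + j)) \<in> ?R\<^sup>*" if "Suc i + j \<le> k" for j
    using that
  proof (induction j)
    case (Suc j)
    then show ?case using step[of "Suc i + j"] by (auto intro: rtrancl_into_rtrancl)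
  qed simp
  have down: "(c ! 0, c ! j) \<in> ?R\<^sup>*" if "j \<le> i" for j
    using that
  proof (induction j)
    case (Suc j)
    then show ?case using step[of j] i(1) by (auto intro: rtrancl_into_rtrancl)
  qed simp
  have "(c ! Suc i, c ! k) \<in> ?R\<^sup>*" using up[of "k - Suc i"] i(1) by simp
  then have "(c ! Suc i, c ! i) \<in> ?R\<^sup>*" using down[of i] D(3) by simp
  then show ?thesis using uadj_sym[of "c ! Suc i" "c ! i" "remove_arc U e"] i(2)
    by (auto simp: cycle_arc_def)
qed

text \<open>The path has at least three vertices because its ends differ and, without
  \<open>e\<close>, are not adjacent in an oriented graph. The cardinality later ties the parity of
  the cycle to the distance between the ends of \<open>e\<close>.\<close>

lemma path_closes_cycle:
  assumes U: "oriented_graph U" and e: "e \<in> parcs U"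
    and p: "uwalk (remove_arc U e) p" "distinct p" "hd p = fst e" "last p = snd e"
  shows "ucycle_walk U (snd e # p)" "e \<in> walk_arc_set U (snd e # p)"
    "card (walk_arc_set U (snd e # p)) = length p"
proof -
  let ?a = "fst e" and ?b = "snd e"
  have ab: "?a \<noteq> ?b" "(?b, ?a) \<notin> parcs U" "(?a, ?b) \<in> parcs U" "?b \<in> pverts U"
    using oriented_graphD(4)[OF U, of ?a ?b] e by auto
  have ne: "p \<noteq> []" using p(1) by (simp add: uwalk_iff)
  have pU: "uwalk U p" using p(1) by (rule uwalk_mono) auto
  have "length p \<ge> 3"
  proof (rule ccontr)
    assume "\<not> 3 \<le> length p"
    moreover have "length p \<noteq> 0" using ne by simp
    ultimately have "length p = 1 \<or> length p = 2" by linarith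
    then show False
    proof
      assume "length p = 1" then show False using p(3,4) ab(1) by (auto simp: length_Suc_conv)
    next
      assume "length p = 2"
      then have "p = [?a, ?b]" using p(3,4) by (auto simp: length_Suc_conv numeral_2_eq_2)
      then have "(?a, ?b) \<in> uadj (remove_arc U e)" using p(1) by (auto simp: uwalk_iff)
      then show False using ab by auto
    qed
  qed
  then show cw: "ucycle_walk U (?b # p)"
    unfolding ucycle_walk_def uwalk_iff using pU p ne ab by (auto simp: uwalk_iff)
  show "e \<in> walk_arc_set U (?b # p)" using ne p(3) e by (auto simp: walk_arc_set_def)
  show "card (walk_arc_set U (?b # p)) = length p" using card_walk_arc_set[OF U cw] by simp
qed

lemma removed_reach_cycle:
  assumes U: "oriented_graph U" and e: "e \<in> parcs U" and r: "(fst e, snd e) \<in> (uadj (remove_arc U e))\<^sup>*"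
  shows "\<exists>C\<in>ucycles U. e \<in> C"
proof -
  have "fst e \<in> pverts (remove_arc U e)" using oriented_graphD(4)[OF U, of "fst e" "snd e"] e by simp
  from reach_upath[OF oriented_remove_arc[OF U] this r]
  obtain p where p: "uwalk (remove_arc U e) p" "distinct p" "hd p = fst e" "last p = snd e" by blast
  show ?thesis using path_closes_cycle[OF U e p] unfolding ucycles_def by blast
qed

text \<open>Cycles are arc sets in the orientation of the ambient graph. An edge of \<open>U\<close>
  has no second orientation in the oriented \<open>U'\<close>, so both graphs give the same set;
  conversely each vertex of the walk is an end of an arc of \<open>U\<close>.\<close>

lemma ucycle_walk_subgraph:
  assumes U': "oriented_graph U'" and U: "oriented_graph U" and "parcs U \<subseteq> parcs U'" "pverts U \<subseteq> pverts U'"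
  shows "ucycle_walk U c \<longleftrightarrow> ucycle_walk U' c \<and> walk_arc_set U' c \<subseteq> parcs U"
    and "ucycle_walk U c \<Longrightarrow> walk_arc_set U' c = walk_arc_set U c"
proof -
  show eq: "walk_arc_set U' c = walk_arc_set U c" if "ucycle_walk U c"
  proof -
    have "set (vwalk_arcs c) \<subseteq> uadj U" using that by (simp add: ucycle_walk_def uwalk_iff)
    then show ?thesis
      using assms(3) oriented_graphD(4)[OF U'] by (auto simp: walk_arc_set_def)
  qed
  show "ucycle_walk U c \<longleftrightarrow> ucycle_walk U' c \<and> walk_arc_set U' c \<subseteq> parcs U"
  proof (intro iffI conjI)
    assume c: "ucycle_walk U c"
    then show "ucycle_walk U' c" using assms(3,4) uwalk_mono unfolding ucycle_walk_def by blast
    show "walk_arc_set U' c \<subseteq> parcs U" using eq[OF c] by (auto simp: walk_arc_set_def)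
  next
    assume c: "ucycle_walk U' c \<and> walk_arc_set U' c \<subseteq> parcs U"
    have arcs: "set (vwalk_arcs c) \<subseteq> uadj U"
      using c unfolding ucycle_walk_def uwalk_iff by (auto simp: walk_arc_set_def)
    define k where "k = length c - 1"
    note D = ucycle_walkD[OF U' conjunct1[OF c] k_def]
    have "c ! i \<in> pverts U" if "i < k" for i
      using arcs uadj_verts[OF U, of "c ! i" "c ! Suc i"] that D(2) by (auto simp: set_vwalk_arcs)
    then have "set c \<subseteq> pverts U"
      using D(1,2,3) by (auto simp: in_set_conv_nth less_Suc_eq)
    then show "ucycle_walk U c" using c arcs unfolding ucycle_walk_def uwalk_iff by blast
  qed
qed

lemma ucycles_subgraph:
  assumes "oriented_graph U'" "oriented_graph U" "parcs U \<subseteq> parcs U'" "pverts U \<subseteq> pverts U'"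
  shows "ucycles U = {C \<in> ucycles U'. C \<subseteq> parcs U}"
  unfolding ucycles_def using ucycle_walk_subgraph[OF assms] by blast

lemma ucycle_subset: "C \<in> ucycles U \<Longrightarrow> C \<subseteq> parcs U"
  by (auto simp: ucycles_def walk_arc_set_def)

text \<open>All vertices of a cycle are reachable from each other, so the component of one of its
  arcs contains the whole cycle.\<close>

lemma ucycle_component:
  assumes H: "oriented_graph H" and C: "C \<in> ucycles H" and K: "K \<in> wccs H" and "e \<in> C" "e \<in> parcs K"
  shows "C \<in> ucycles K"
proof -
  note KD = wccsD[OF H K]
  obtain c where c: "ucycle_walk H c" "C = walk_arc_set H c" using C by (auto simp: ucycles_def)
  have w: "uwalk H c" using c(1) by (simp add: ucycle_walk_def)
  have on_c: "fst f \<in> set c \<and> snd f \<in> set c" if "f \<in> C" for f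
    using that arcs_in_vwalk_arcs[of _ c] unfolding c(2) walk_arc_set_def by fastforce
  have "fst e \<in> pverts K" using oriented_graphD(4)[OF KD(1), of "fst e" "snd e"] assms(5) by simp
  moreover have "(hd c, fst e) \<in> (uadj H)\<^sup>*" using uwalk_reach[OF w] on_c assms(4) by blast
  ultimately have "hd c \<in> pverts K" using wccs_reach[OF H K] uadj_sym[of "hd c" "fst e" H] by blast
  then have in_K: "x \<in> pverts K" if "x \<in> set c" for x
    using wccs_reach[OF H K] uwalk_reach[OF w that] by blast
  have "C \<subseteq> parcs K"
  proof
    fix f assume f: "f \<in> C"
    then have "f \<in> parcs H" using ucycle_subset[OF C] by blast
    moreover have "(fst f, snd f) \<in> uadj K" using KD(6)[of "fst f" "snd f"] in_K on_c[OF f] \<open>f \<in> parcs H\<close> by simp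
    ultimately show "f \<in> parcs K"
      using oriented_graphD(4)[OF H, of "fst f" "snd f"] KD(4) by auto
  qed
  then show ?thesis using ucycles_subgraph[OF H KD(1) KD(4) KD(3)] C by blast
qed

text \<open>After the common initial part the paths leave \<open>x\<close> by different edges. The
  first edge \<open>f\<close> of \<open>p\<close> has a detour: along \<open>q'\<close> to the
  common end and back along the rest of \<open>p\<close>. Neither part returns to \<open>x\<close>,
  so both avoid \<open>f\<close>.\<close>

lemma two_paths_cycle:
  assumes U: "oriented_graph U"
  shows "uwalk U p \<Longrightarrow> distinct p \<Longrightarrow> uwalk U q \<Longrightarrow> distinct q \<Longrightarrow> hd p = hd q \<Longrightarrow> last p = last q \<Longrightarrow>
    p \<noteq> q \<Longrightarrow> ucycles U \<noteq> {}"
proof (induction p arbitrary: q)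
  case (Cons x p)
  obtain q' where q: "q = x # q'" using Cons.prems(3,5) by (cases q) (auto simp: uwalk_iff)
  show ?case
  proof (cases "p = [] \<or> q' = []")
    case True
    then show ?thesis using Cons.prems q by (auto split: if_splits)
  next
    case False
    then have w: "uwalk U p" "uwalk U q'" "(x, hd p) \<in> uadj U" "(x, hd q') \<in> uadj U"
      using Cons.prems(1,3) q by (auto simp: uwalk_iff)
    have last: "last p = last q'" using Cons.prems(6) False q by simp
    have x: "x \<notin> set p" "x \<notin> set q'" using Cons.prems(2,4) q by auto
    show ?thesis
    proof (cases "hd p = hd q'")
      case True
      then show ?thesis using Cons.IH[OF w(1) _ w(2)] Cons.prems(2,4,7) last q by auto
    next
      case False
      define f where "f = (if (x, hd p) \<in> parcs U then (x, hd p) else (hd p, x))"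
      have f: "f \<in> parcs U" using w(3) by (auto simp: f_def)
      let ?R = "remove_arc U f"
      have avoid: "set (vwalk_arcs r) \<subseteq> uadj ?R" if "uwalk U r" "x \<notin> set r" for r
        using that arcs_in_vwalk_arcs[of _ r] unfolding uwalk_iff f_def by (fastforce split: if_splits)
      have "uwalk ?R p" "uwalk ?R q'" using w(1,2) avoid x by (auto simp: uwalk_iff)
      moreover have "(x, hd q') \<in> uadj ?R"
        using w(4) False oriented_graphD(4)[OF U] by (auto simp: f_def)
      ultimately have "(hd p, last p) \<in> (uadj ?R)\<^sup>*" "(x, last q') \<in> (uadj ?R)\<^sup>*"
        using uwalk_reach[where U = ?R and p = p and y = "last p"]
          uwalk_reach[where U = ?R and p = q' and y = "last q'"]
        by (auto simp: uwalk_iff intro: converse_rtrancl_into_rtrancl)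
      then have "(x, hd p) \<in> (uadj ?R)\<^sup>*" using last uadj_sym[of "hd p" "last p" ?R] rtrancl_trans by fastforce
      then have "(fst f, snd f) \<in> (uadj ?R)\<^sup>*" using uadj_sym[of x "hd p" ?R] by (auto simp: f_def)
      then show ?thesis using removed_reach_cycle[OF U f] by blast
    qed
  qed
qed (simp add: uwalk_iff)

section \<open>Spanning forests and the number of arcs\<close>

text \<open>A spanning forest with root set \<open>S\<close>: \<open>q x\<close> is the parent of
  \<open>x\<close> and \<open>f x\<close> the arc joining them. Of the rank \<open>d\<close> only
  the strict decrease towards the roots is recorded.\<close>

definition parent_map ::
  "'a pair_pre_digraph \<Rightarrow> 'a set \<Rightarrow> ('a \<Rightarrow> nat) \<Rightarrow> ('a \<Rightarrow> 'a) \<Rightarrow> ('a \<Rightarrow> 'a \<times> 'a) \<Rightarrow> bool" where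
  "parent_map U S d q f \<longleftrightarrow> (\<forall>x\<in>pverts U - S. f x \<in> parcs U \<and> q x \<in> pverts U \<and> d (q x) < d x \<and>
     (f x = (x, q x) \<or> f x = (q x, x)))"

text \<open>Breadth-first search: \<open>d\<close> is the distance to \<open>S\<close>, and the
  parent is the next vertex on a shortest walk to \<open>S\<close>.\<close>

lemma parent_map_exists:
  assumes U: "oriented_graph U" and con: "Digraph_Component.connected (with_proj U)"
    and S: "S \<subseteq> pverts U" "S \<noteq> {}"
  obtains d q f where "parent_map U S d q f"
proof -
  let ?R = "uadj U"
  let ?P = "\<lambda>x n. \<exists>s\<in>S. (x, s) \<in> ?R ^^ n"
  define d where "d x = (LEAST n. ?P x n)" for x
  have "\<exists>z. z \<in> pverts U \<and> d z < d x \<and> (x, z) \<in> ?R" if x: "x \<in> pverts U - S" for x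
  proof -
    obtain s where "s \<in> S" using S(2) by blast
    then have "(x, s) \<in> ?R\<^sup>*" using con x S(1) unfolding connected_iff[OF U] by blast
    then obtain n where "?P x n" using \<open>s \<in> S\<close> by (auto simp: rtrancl_power)
    then have "?P x (d x)" unfolding d_def by (rule LeastI)
    then obtain t where t: "t \<in> S" "(x, t) \<in> ?R ^^ d x" by blast
    have "d x \<noteq> 0" using t x by (intro notI) auto
    then obtain m where m: "d x = Suc m" by (cases "d x") auto
    obtain z where z: "(x, z) \<in> ?R" "(z, t) \<in> ?R ^^ m" using t(2) unfolding m by (meson relpow_Suc_D2)
    then have "d z \<le> m" unfolding d_def using t(1) by (intro Least_le) blast
    then show ?thesis using z(1) m uadj_verts[OF U z(1)] by auto
  qed
  then obtain q where q: "\<And>x. x \<in> pverts U - S \<Longrightarrow> q x \<in> pverts U \<and> d (q x) < d x \<and> (x, q x) \<in> ?R"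
    by metis
  show thesis
    by (rule that[of d q "\<lambda>x. if (x, q x) \<in> parcs U then (x, q x) else (q x, x)"])
      (use q in \<open>auto simp: parent_map_def\<close>)
qed

text \<open>Two vertices with the same arc would be each other's parents, against the decrease of
  \<open>d\<close>.\<close>

lemma parent_map_inj:
  assumes "parent_map U S d q f" shows "inj_on f (pverts U - S)"
proof (rule inj_onI)
  fix x y assume xy: "x \<in> pverts U - S" "y \<in> pverts U - S" "f x = f y"
  show "x = y"
  proof (rule ccontr)
    assume "x \<noteq> y"
    then have "q x = y" "q y = x" using assms xy unfolding parent_map_def by (metis prod.inject)+
    moreover have "d (q x) < d x" "d (q y) < d y" using assms xy by (auto simp: parent_map_def)
    ultimately show False by simp
  qed
qed

lemma parent_map_reach:
  assumes P: "parent_map U S d q f"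
  shows "x \<in> pverts U \<Longrightarrow> \<exists>s\<in>S. (x, s) \<in> (f ` (pverts U - S) \<union> (f ` (pverts U - S))\<inverse>)\<^sup>*"
proof (induction "d x" arbitrary: x rule: less_induct)
  case less
  let ?F = "f ` (pverts U - S)"
  show ?case
  proof (cases "x \<in> S")
    case False
    then have x: "x \<in> pverts U - S" using less.prems by simp
    then have q: "q x \<in> pverts U" "d (q x) < d x" "f x = (x, q x) \<or> f x = (q x, x)"
      using P by (auto simp: parent_map_def)
    from less.hyps[OF q(2,1)] obtain s where s: "s \<in> S" "(q x, s) \<in> (?F \<union> ?F\<inverse>)\<^sup>*" by blast
    have "f x \<in> ?F" using x by blast
    then have "(x, q x) \<in> ?F \<union> ?F\<inverse>" using q(3) by auto
    then show ?thesis using s converse_rtrancl_into_rtrancl by metis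
  qed auto
qed

text \<open>A spanning tree with a single root gives every other vertex an arc of its own.\<close>

lemma connected_card_le:
  assumes U: "oriented_graph U" and con: "Digraph_Component.connected (with_proj U)"
  shows "card (pverts U) \<le> card (parcs U) + 1"
proof -
  obtain r where r: "r \<in> pverts U" using con unfolding connected_iff[OF U] by blast
  obtain d q f where P: "parent_map U {r} d q f" using parent_map_exists[OF U con, of "{r}"] r by auto
  have "card (pverts U - {r}) \<le> card (parcs U)"
    by (rule card_inj_on_le[OF parent_map_inj[OF P]])
      (use P oriented_graphD(2)[OF U] in \<open>auto simp: parent_map_def\<close>)
  then show ?thesis using r oriented_graphD(1)[OF U] by (simp add: card_Diff_singleton)
qed

text \<open>An arc outside the spanning tree would have its ends joined by the tree and so close a
  cycle.\<close>

lemma acyclic_card: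
  assumes U: "oriented_graph U" and con: "Digraph_Component.connected (with_proj U)" and "ucycles U = {}"
  shows "card (pverts U) = card (parcs U) + 1"
proof -
  obtain r where r: "r \<in> pverts U" using con unfolding connected_iff[OF U] by blast
  obtain d q f where P: "parent_map U {r} d q f" using parent_map_exists[OF U con, of "{r}"] r by auto
  let ?F = "f ` (pverts U - {r})"
  have "e \<in> ?F" if e: "e \<in> parcs U" for e
  proof (rule ccontr)
    assume "e \<notin> ?F"
    then have sub: "?F \<subseteq> parcs (remove_arc U e)" using P by (auto simp: parent_map_def)
    have reach: "(x, r) \<in> (uadj (remove_arc U e))\<^sup>*" if "x \<in> pverts U" for x
    proof -
      have "(x, r) \<in> (?F \<union> ?F\<inverse>)\<^sup>*" using parent_map_reach[OF P that] by simp
      then show ?thesis by (rule subsetD[OF rtrancl_mono, rotated]) (use sub in blast)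
    qed
    have ends: "fst e \<in> pverts U" "snd e \<in> pverts U"
      using oriented_graphD(4)[OF U, of "fst e" "snd e"] e by simp_all
    have "(fst e, snd e) \<in> (uadj (remove_arc U e))\<^sup>*"
      by (rule rtrancl_trans[OF reach[OF ends(1)] uadj_sym[OF reach[OF ends(2)]]])
    then show False using removed_reach_cycle[OF U e] assms(3) by blast
  qed
  then have "card (parcs U) \<le> card ?F"
    using oriented_graphD(1)[OF U] by (intro card_mono) auto
  also have "card ?F \<le> card (pverts U - {r})" using oriented_graphD(1)[OF U] by (intro card_image_le) auto
  finally have "card (parcs U) + 1 \<le> card (pverts U)"
    using r oriented_graphD(1)[OF U] card_Diff1_less[of "pverts U" r] by simp
  then show ?thesis using connected_card_le[OF U con] by simp
qed

lemma connected_remove_arc: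
  assumes U: "oriented_graph U" and con: "Digraph_Component.connected (with_proj U)"
    and C: "C \<in> ucycles U" "e \<in> C"
  shows "Digraph_Component.connected (with_proj (remove_arc U e))"
proof -
  have r: "(fst e, snd e) \<in> (uadj (remove_arc U e))\<^sup>*" by (rule cycle_arc_removed[OF U C])
  have arc: "(x, y) \<in> (uadj (remove_arc U e))\<^sup>*" if "(x, y) \<in> uadj U" for x y
  proof (cases "(x, y) = e \<or> (y, x) = e")
    case True then show ?thesis using r uadj_sym[OF r] by auto
  next
    case False then show ?thesis using that by auto
  qed
  have "(x, y) \<in> (uadj (remove_arc U e))\<^sup>*" if "(x, y) \<in> (uadj U)\<^sup>*" for x y
    using that
  proof induction
    case (step y z)
    show ?case by (rule rtrancl_trans[OF step.IH arc[OF step.hyps(2)]])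
  qed simp
  then show ?thesis using con unfolding connected_iff[OF U] connected_iff[OF oriented_remove_arc[OF U]] by simp
qed

lemma card_remove_arc:
  "oriented_graph U \<Longrightarrow> e \<in> parcs U \<Longrightarrow> card (parcs U) = Suc (card (parcs (remove_arc U e)))"
  using oriented_graphD(2)[of U] card.remove[of "parcs U" e] by simp

text \<open>Removing an arc of the only cycle leaves a tree, which gives the count. Conversely a
  connected graph without cycles has one arc too few, so a cycle exists.\<close>

theorem unicyclic_iff_card:
  assumes U: "oriented_graph U" and con: "Digraph_Component.connected (with_proj U)"
  shows "unicyclic U \<longleftrightarrow> card (pverts U) = card (parcs U)"
proof
  assume "unicyclic U"
  then obtain C where C: "C \<in> ucycles U" "\<And>C'. C' \<in> ucycles U \<Longrightarrow> C' = C" by (auto simp: unicyclic_def)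
  obtain c where c: "ucycle_walk U c" "C = walk_arc_set U c" using C(1) by (auto simp: ucycles_def)
  have "card C \<noteq> 0" using card_walk_arc_set[OF U c(1)] c by (auto simp: ucycle_walk_def)
  then obtain e where e: "e \<in> C" by (metis all_not_in_conv card.empty)
  let ?R = "remove_arc U e"
  have R: "oriented_graph ?R" by (rule oriented_remove_arc[OF U])
  have "ucycles ?R = {}" using ucycles_subgraph[OF U R] C(2) e by auto
  then have "card (pverts ?R) = card (parcs ?R) + 1"
    using acyclic_card[OF R connected_remove_arc[OF U con C(1) e]] by simp
  then show "card (pverts U) = card (parcs U)"
    using card_remove_arc[OF U, of e] ucycle_subset[OF C(1)] e by auto
next
  assume card: "card (pverts U) = card (parcs U)"
  have ex: "ucycles U \<noteq> {}" using acyclic_card[OF U con] card by auto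
  \<comment> \<open>If \<open>e\<close> lies on \<open>C'\<close> but not on \<open>C\<close>, then
    \<open>e\<close> and afterwards an arc of \<open>C\<close> can be removed without losing
    connectedness. This leaves fewer arcs than \<open>connected_card_le\<close> allows.\<close>
  have sub: "C' \<subseteq> C" if C: "C \<in> ucycles U" and C': "C' \<in> ucycles U" for C C'
  proof
    fix e assume e: "e \<in> C'"
    show "e \<in> C"
    proof (rule ccontr)
      assume eC: "e \<notin> C"
      let ?R = "remove_arc U e"
      have R: "oriented_graph ?R" by (rule oriented_remove_arc[OF U])
      have conR: "Digraph_Component.connected (with_proj ?R)" by (rule connected_remove_arc[OF U con C' e])
      have CR: "C \<in> ucycles ?R" using ucycles_subgraph[OF U R] C eC ucycle_subset[OF C] by auto
      obtain c where c: "ucycle_walk U c" "C = walk_arc_set U c" using C by (auto simp: ucycles_def)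
      have "card C \<noteq> 0" using card_walk_arc_set[OF U c(1)] c by (auto simp: ucycle_walk_def)
      then obtain e' where e': "e' \<in> C" by (metis all_not_in_conv card.empty)
      let ?R' = "remove_arc ?R e'"
      have "card (pverts ?R') \<le> card (parcs ?R') + 1"
        by (rule connected_card_le[OF oriented_remove_arc[OF R] connected_remove_arc[OF R conR CR e']])
      moreover have "card (parcs U) = Suc (card (parcs ?R))" "card (parcs ?R) = Suc (card (parcs ?R'))"
        using card_remove_arc[OF U, of e] card_remove_arc[OF R, of e'] ucycle_subset[OF C'] e
          ucycle_subset[OF CR] e' by blast+
      ultimately show False using card by simp
    qed
  qed
  have "\<exists>!C. C \<in> ucycles U"
  proof (rule ex_ex1I)
    show "\<exists>C. C \<in> ucycles U" using ex by blast
    show "C = C'" if "C \<in> ucycles U" "C' \<in> ucycles U" for C C' using sub that by blast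
  qed
  then show "unicyclic U" using con by (simp add: unicyclic_def)
qed

lemma the_cycle_in: "unicyclic U \<Longrightarrow> the_cycle U \<in> ucycles U"
  unfolding unicyclic_def the_cycle_def by (rule theI') blast

lemma the_cycle_eq: "unicyclic U \<Longrightarrow> C \<in> ucycles U \<Longrightarrow> the_cycle U = C"
  unfolding unicyclic_def the_cycle_def by (rule the1_equality) simp_all

section \<open>Determinants of incidence matrices\<close>

text \<open>The conjugate of a principal root is principal unless the root is a non-zero imaginary
  number \<open>\<i> * t\<close>. In that case \<open>z\<close> is -t^2, a negative real.\<close>

lemma csqrt_cnj:
  assumes "z \<notin> \<real>\<^sup>-" shows "csqrt (cnj z) = cnj (csqrt z)"
proof -
  have "csqrt ((cnj (csqrt z))\<^sup>2) = cnj (csqrt z)"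
  proof (rule csqrt_square)
    have "Im (csqrt z) = 0" if 0: "Re (csqrt z) = 0"
    proof (rule ccontr)
      define t where "t = Im (csqrt z)"
      assume "Im (csqrt z) \<noteq> 0"
      then have "(of_real (- t\<^sup>2) :: complex) \<in> \<real>\<^sup>-" by (intro imageI) (simp add: t_def)
      moreover have "csqrt z = \<i> * of_real t" using 0 by (simp add: complex_eq_iff t_def)
      then have "z = of_real (- t\<^sup>2)" using power2_csqrt[of z] by (simp add: power_mult_distrib)
      ultimately show False using assms by simp
    qed
    then show "0 < Re (cnj (csqrt z)) \<or> Re (cnj (csqrt z)) = 0 \<and> 0 \<le> Im (cnj (csqrt z))"
      using csqrt_principal[of z] by auto
  qed
  moreover have "(cnj (csqrt z))\<^sup>2 = cnj z"
    by (metis complex_cnj_power power2_csqrt)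
  ultimately show ?thesis by simp
qed

lemma Re_eq_cmod_iff: "Re z = cmod z \<longleftrightarrow> z = of_real (cmod z)"
proof
  assume "Re z = cmod z"
  then have "Im z = 0" using cmod_power2[of z] by simp
  then show "z = of_real (cmod z)" using \<open>Re z = cmod z\<close> by (simp add: complex_eq_iff)
next
  assume "z = of_real (cmod z)"
  then have "Re z = Re (of_real (cmod z))" by (rule arg_cong)
  then show "Re z = cmod z" by simp
qed

definition incidence :: "('a \<times> 'a \<Rightarrow> complex) \<Rightarrow> 'a \<Rightarrow> 'a \<times> 'a \<Rightarrow> complex" where
  "incidence w x e =
    (if x = fst e then csqrt (w e) else if x = snd e then csqrt (cnj (w e)) else 0)"

lemma signless_incidence_eq:
  "signless_incidence n es w = mat n (length es) (\<lambda>(i, j). incidence w i (es ! j))"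
  by (simp add: signless_incidence_def incidence_def)

text \<open>The equation of the column \<open>e\<close> in \<open>y N = 0\<close>, for a row vector
  \<open>y\<close>.\<close>

definition balanced :: "('a \<times> 'a \<Rightarrow> complex) \<Rightarrow> ('a \<Rightarrow> complex) \<Rightarrow> 'a \<times> 'a \<Rightarrow> bool" where
  "balanced w y e \<longleftrightarrow> y (fst e) * csqrt (w e) + y (snd e) * csqrt (cnj (w e)) = 0"

lemma sum_incidence:
  assumes "finite V" "fst e \<in> V" "snd e \<in> V" "fst e \<noteq> snd e"
  shows "(\<Sum>x\<in>V. y x * incidence w x e) = y (fst e) * csqrt (w e) + y (snd e) * csqrt (cnj (w e))"
proof -
  have "(\<Sum>x\<in>V. y x * incidence w x e) = (\<Sum>x\<in>{fst e, snd e}. y x * incidence w x e)"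
    by (rule sum.mono_neutral_right) (use assms in \<open>auto simp: incidence_def\<close>)
  then show ?thesis using assms(4) by (simp add: incidence_def)
qed

locale weighted_oriented_graph =
  fixes G :: "'a pair_pre_digraph" and w :: "'a \<times> 'a \<Rightarrow> complex"
  assumes G: "oriented_graph G"
    and weights: "\<And>e. e \<in> parcs G \<Longrightarrow> w e \<noteq> 0 \<and> w e \<notin> \<real>\<^sup>-"
begin

abbreviation adj :: "'a \<Rightarrow> 'a \<Rightarrow> complex" where "adj x y \<equiv> adj_entry G w (x, y)"

lemma adj_nz: "(x, y) \<in> uadj G \<Longrightarrow> adj x y \<noteq> 0"
  using weights by (auto simp: adj_entry_def)

lemma adj_cnj: "adj y x = cnj (adj x y)"
  using oriented_graphD(4)[OF G] by (auto simp: adj_entry_def)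

lemma adj_not_neg: "(x, y) \<in> uadj G \<Longrightarrow> adj x y \<notin> \<real>\<^sup>-"
proof
  assume "(x, y) \<in> uadj G" "adj x y \<in> \<real>\<^sup>-"
  show False
  proof (cases "(x, y) \<in> parcs G")
    case True
    then show False using weights[OF True] \<open>adj x y \<in> \<real>\<^sup>-\<close> by (simp add: adj_entry_def)
  next
    case False
    then have yx: "(y, x) \<in> parcs G" using \<open>(x, y) \<in> uadj G\<close> by simp
    have "cnj (adj x y) \<in> \<real>\<^sup>-" using \<open>adj x y \<in> \<real>\<^sup>-\<close> by auto
    then show False using weights[OF yx] yx adj_cnj[where x = x and y = y] by (simp add: adj_entry_def)
  qed
qed

lemma csqrt_adj: "(x, y) \<in> uadj G \<Longrightarrow> csqrt (adj y x) = cnj (csqrt (adj x y))"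
  using csqrt_cnj[OF adj_not_neg, of x y] adj_cnj[where x = x and y = y] by simp

lemma incidence_adj:
  assumes "e \<in> parcs G" "e = (x, y) \<or> e = (y, x)"
  shows "incidence w x e = csqrt (adj x y)" "cmod (incidence w x e) = sqrt (cmod (w e))"
proof -
  have a: "(fst e, snd e) \<in> parcs G" using assms by auto
  show "incidence w x e = csqrt (adj x y)"
    using assms oriented_graphD(4)[OF G a] by (auto simp: incidence_def adj_entry_def)
  show "cmod (incidence w x e) = sqrt (cmod (w e))"
    using assms oriented_graphD(4)[OF G a] by (auto simp: incidence_def)
qed

text \<open>With \<open>s\<close> the root, the adjacency entry is s^2 and its modulus is s times
  its conjugate, so the phase is s divided by its conjugate.\<close>

lemma sgn_adj:
  assumes "(x, y) \<in> uadj G"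
  shows "sgn (adj x y) * cnj (csqrt (adj x y)) = csqrt (adj x y)"
proof -
  let ?s = "csqrt (adj x y)"
  have "?s \<noteq> 0" using adj_nz[OF assms] by simp
  have "sgn (adj x y) = sgn ?s * sgn ?s" by (metis power2_csqrt power2_eq_square sgn_mult)
  moreover have "sgn s * cnj s = of_real (cmod s)" if "s \<noteq> 0" for s :: complex
    using that by (simp add: sgn_eq complex_norm_square[symmetric] power2_eq_square)
  ultimately have "sgn (adj x y) * cnj ?s = sgn ?s * of_real (cmod ?s)"
    using \<open>?s \<noteq> 0\<close> by (metis mult.assoc)
  also have "sgn s * of_real (cmod s) = s" if "s \<noteq> 0" for s :: complex using that by (simp add: sgn_eq)
  finally show ?thesis using \<open>?s \<noteq> 0\<close> .
qed

lemma balanced_step: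
  assumes e: "e \<in> parcs G" "e = (x, y) \<or> e = (y, x)" and bal: "balanced w z e"
  shows "z y = - z x * sgn (adj x y)"
proof -
  have a: "(x, y) \<in> uadj G" using e by auto
  let ?s = "csqrt (adj x y)"
  have nz: "?s \<noteq> 0" using adj_nz[OF a] by simp
  have ne: "fst e \<noteq> snd e" using oriented_graphD(4)[OF G, of "fst e" "snd e"] e by simp
  \<comment> \<open>Expressed through \<open>adj\<close>, the equation is the same for both
    orientations of \<open>e\<close>.\<close>
  have "z x * ?s + z y * cnj ?s = 0"
    using e(2)
  proof
    assume "e = (x, y)"
    then have "incidence w x e = csqrt (w e)" "incidence w y e = csqrt (cnj (w e))"
      using ne by (auto simp: incidence_def)
    then show ?thesis using bal incidence_adj(1)[OF e] incidence_adj(1)[of e y x] e csqrt_adj[OF a] \<open>e = (x, y)\<close>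
      by (simp add: balanced_def)
  next
    assume "e = (y, x)"
    then have "incidence w y e = csqrt (w e)" "incidence w x e = csqrt (cnj (w e))"
      using ne by (auto simp: incidence_def)
    then show ?thesis using bal incidence_adj(1)[OF e] incidence_adj(1)[of e y x] e csqrt_adj[OF a] \<open>e = (y, x)\<close>
      by (simp add: balanced_def add.commute)
  qed
  then have "(z x * sgn (adj x y) + z y) * cnj ?s = 0"
    using sgn_adj[OF a] by (simp add: algebra_simps)
  then show ?thesis using nz by (simp add: eq_neg_iff_add_eq_0 add.commute)
qed

lemma walk_wt_Cons: "p \<noteq> [] \<Longrightarrow> walk_wt G w (x # p) = adj x (hd p) * walk_wt G w p"
  by (simp add: walk_wt_def)

lemma walk_wt_single [simp]: "walk_wt G w [x] = 1" by (simp add: walk_wt_def)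

lemma walk_wt_nz: "set (vwalk_arcs p) \<subseteq> uadj G \<Longrightarrow> walk_wt G w p \<noteq> 0"
  using adj_nz by (auto simp: walk_wt_def prod_list_zero_iff)

lemma balanced_walk:
  assumes sub: "parcs U \<subseteq> parcs G" and bal: "\<And>e. e \<in> parcs U \<Longrightarrow> balanced w z e"
  shows "uwalk U p \<Longrightarrow> z (last p) = (- 1) ^ (length p - 1) * z (hd p) * sgn (walk_wt G w p)"
proof (induction p)
  case (Cons x p)
  show ?case
  proof (cases p)
    case (Cons y p')
    then have ne: "p \<noteq> []" and a: "(x, y) \<in> uadj U" and p: "uwalk U p"
      using Cons.prems by (auto simp: uwalk_iff)
    obtain e where e: "e \<in> parcs U" "e = (x, y) \<or> e = (y, x)" using a by auto
    have "z y = - z x * sgn (adj x y)" using balanced_step[OF _ e(2) bal[OF e(1)]] e(1) sub by blast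
    then show ?thesis using Cons.IH[OF p] ne Cons by (simp add: walk_wt_Cons sgn_mult)
  qed simp
qed (simp add: uwalk_iff)

lemma cycle_wt_walk:
  assumes "C \<in> ucycles G"
  obtains c where "ucycle_walk G c" "walk_arc_set G c = C" "cycle_wt G w C = walk_wt G w c"
proof -
  have "\<exists>c. ucycle_walk G c \<and> walk_arc_set G c = C" using assms by (auto simp: ucycles_def)
  from someI_ex[OF this] show thesis using that by (auto simp: cycle_wt_def)
qed

lemma cycle_wt_nz: "C \<in> ucycles G \<Longrightarrow> cycle_wt G w C \<noteq> 0"
  by (metis cycle_wt_walk ucycle_walk_def uwalk_iff walk_wt_nz)

definition good_cycle :: "('a \<times> 'a) set \<Rightarrow> bool" where
  "good_cycle C \<longleftrightarrow> (even (card C) \<longrightarrow> cycle_wt G w C \<notin> \<real>\<^sup>+) \<and> (odd (card C) \<longrightarrow> cycle_wt G w C \<notin> \<real>\<^sup>-)"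

text \<open>Both half-axes merge into one excluded equation, the one under which a trip round
  \<open>C\<close> returns a balanced vector to its initial value.\<close>

lemma good_cycle_iff:
  assumes "C \<in> ucycles G"
  shows "good_cycle C \<longleftrightarrow> cycle_wt G w C \<noteq> (- 1) ^ card C * of_real (cmod (cycle_wt G w C))"
proof -
  let ?z = "cycle_wt G w C"
  have nz: "cmod ?z > 0" using cycle_wt_nz[OF assms] by simp
  have "?z \<in> \<real>\<^sup>+ \<longleftrightarrow> ?z = of_real (cmod ?z)"
    using nz by (auto intro!: image_eqI[of _ _ "cmod ?z"])
  moreover have "?z \<in> \<real>\<^sup>- \<longleftrightarrow> ?z = - of_real (cmod ?z)"
    using nz by (auto intro!: image_eqI[of _ _ "- cmod ?z"])
  ultimately show ?thesis by (cases "even (card C)") (auto simp: good_cycle_def)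
qed

lemma alpha_nonneg: "alpha G w C \<ge> 0"
  using abs_Re_le_cmod[of "cycle_wt G w C"] by (auto simp: alpha_def)

text \<open>A modulus equals plus or minus the real part only on the corresponding half-axis. This
  is why sums over all spanning subgraphs can be cut down to the family.\<close>

lemma alpha_0_iff:
  assumes "C \<in> ucycles G" shows "alpha G w C = 0 \<longleftrightarrow> \<not> good_cycle C"
proof -
  let ?z = "cycle_wt G w C"
  have "Re ?z = cmod ?z \<longleftrightarrow> ?z = of_real (cmod ?z)" by (rule Re_eq_cmod_iff)
  moreover have "- Re ?z = cmod ?z \<longleftrightarrow> ?z = - of_real (cmod ?z)"
  proof -
    have "- ?z = of_real (cmod ?z) \<longleftrightarrow> ?z = - of_real (cmod ?z)" by (metis minus_minus)
    then show ?thesis using Re_eq_cmod_iff[of "- ?z"] by simp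
  qed
  ultimately show ?thesis using good_cycle_iff[OF assms]
    by (auto simp: alpha_def)
qed

lemma balanced_good_cycle:
  assumes U: "oriented_graph U" and con: "Digraph_Component.connected (with_proj U)"
    and sub: "parcs U \<subseteq> parcs G" "pverts U \<subseteq> pverts G"
    and C: "C \<in> ucycles U" "good_cycle C"
    and bal: "\<And>e. e \<in> parcs U \<Longrightarrow> balanced w z e" and x: "x \<in> pverts U"
  shows "z x = 0"
proof -
  have CG: "C \<in> ucycles G" "C \<subseteq> parcs U" using ucycles_subgraph[OF G U sub] C(1) by auto
  obtain c where c: "ucycle_walk G c" "walk_arc_set G c = C" "cycle_wt G w C = walk_wt G w c"
    using cycle_wt_walk[OF CG(1)] .
  have cU: "ucycle_walk U c" using ucycle_walk_subgraph(1)[OF G U sub] c CG(2) by blast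
  then have wc: "uwalk U c" "hd c = last c" by (auto simp: ucycle_walk_def)
  have "card C = length c - 1" using card_walk_arc_set[OF G c(1)] c(2) by simp
  then have "z (hd c) = (- 1) ^ card C * z (hd c) * sgn (cycle_wt G w C)"
    using balanced_walk[OF sub(1) bal wc(1)] wc(2) c(3) by simp
  then have "z (hd c) = 0 \<or> (- 1) ^ card C * sgn (cycle_wt G w C) = 1"
    by (metis (no_types, lifting) mult.commute mult.left_commute mult_cancel_left1)
  moreover have "(- 1) ^ card C * sgn (cycle_wt G w C) \<noteq> 1"
  proof
    assume "(- 1) ^ card C * sgn (cycle_wt G w C) = 1"
    then have "(- 1) ^ card C * ((- 1) ^ card C * sgn (cycle_wt G w C)) = (- 1) ^ card C" by simp
    then have "sgn (cycle_wt G w C) = (- 1) ^ card C" by (simp only: left_minus_one_mult_self)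
    then have "cycle_wt G w C = (- 1) ^ card C * of_real (cmod (cycle_wt G w C))"
      using cycle_wt_nz[OF CG(1)] by (simp add: sgn_eq field_simps)
    then show False using good_cycle_iff[OF CG(1)] C(2) by blast
  qed
  ultimately have 0: "z (hd c) = 0" by blast
  have "hd c \<in> pverts U" using uwalk_hd_last[OF wc(1)] by simp
  then have "(hd c, x) \<in> (uadj U)\<^sup>*" using con x unfolding connected_iff[OF U] by blast
  from reach_upath[OF U \<open>hd c \<in> pverts U\<close> this]
  obtain p where "uwalk U p" "hd p = hd c" "last p = x" by blast
  then show ?thesis using balanced_walk[OF sub(1) bal, of p] 0 by simp
qed

end

section \<open>Determinants of cycles, components and spanning subgraphs\<close>

context weighted_oriented_graph
begin

lemma incidence_0: "x \<noteq> fst e \<Longrightarrow> x \<noteq> snd e \<Longrightarrow> incidence w x e = 0"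
  by (simp add: incidence_def)

text \<open>Column \<open>i\<close> has the root \<open>p i\<close> at \<open>c ! i\<close> and its
  conjugate at the next vertex. With \<open>P\<close> the product of the roots, the squared modulus
  is 4 (Im P)^2 for even \<open>k\<close> and 4 (Re P)^2 for odd \<open>k\<close>; both are
  rewritten through P^2, the weight of the cycle.\<close>

lemma cycle_det:
  assumes c: "ucycle_walk G c" and k: "k = length c - 1"
  shows "(cmod (det_on (incidence w) (map ((!) c) [0..<k]) (map (cycle_arc G c) [0..<k])))\<^sup>2 =
    2 * (cmod (walk_wt G w c) - (- 1) ^ k * Re (walk_wt G w c))"
proof -
  note D = ucycle_walkD[OF G c k]
  define p where "p i = csqrt (adj (c ! i) (c ! Suc i))" for i
  have arc: "cycle_arc G c i \<in> parcs G"
    "cycle_arc G c i = (c ! i, c ! Suc i) \<or> cycle_arc G c i = (c ! Suc i, c ! i)" if "i < k" for i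
    using D(5)[OF that] by (auto simp: cycle_arc_def)
  have nxt: "c ! (Suc j mod k) = c ! Suc j" if "j < k" for j
    using that D(3) by (cases "Suc j = k") auto
  have entry: "incidence w (c ! i) (cycle_arc G c j) =
      (if i = j then p j else if i = Suc j mod k then cnj (p j) else 0)" if ij: "i < k" "j < k" for i j
  proof -
    have lt: "Suc j mod k < k" using ij by simp
    have a: "(c ! j, c ! Suc j) \<in> uadj G" using D(5) ij by simp
    have "incidence w (c ! i) (cycle_arc G c j) = p j" if "i = j"
      unfolding p_def that by (rule incidence_adj(1)[OF arc[OF ij(2)]])
    moreover have "incidence w (c ! i) (cycle_arc G c j) = cnj (p j)" if "i = Suc j mod k"
      using incidence_adj(1)[of "cycle_arc G c j" "c ! Suc j" "c ! j"] arc[OF ij(2)]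
        csqrt_adj[OF a] nxt[OF ij(2)] that by (auto simp: p_def)
    moreover have "incidence w (c ! i) (cycle_arc G c j) = 0" if "i \<noteq> j" "i \<noteq> Suc j mod k"
    proof (rule incidence_0)
      have "c ! i \<noteq> c ! j" "c ! i \<noteq> c ! Suc j"
        using that ij lt D(4) nxt[OF ij(2)] by (auto simp: inj_on_def)
      then show "c ! i \<noteq> fst (cycle_arc G c j)" "c ! i \<noteq> snd (cycle_arc G c j)"
        using arc(2)[OF ij(2)] by auto
    qed
    ultimately show ?thesis by simp
  qed
  have "det_on (incidence w) (map ((!) c) [0..<k]) (map (cycle_arc G c) [0..<k]) =
      det (mat k k (\<lambda>(i, j). if i = j then p j else if i = Suc j mod k then cnj (p j) else 0))"
    unfolding det_on_def by (intro arg_cong[of _ _ det] eq_matI) (simp_all add: entry)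
  also have "\<dots> = (\<Prod>i<k. p i) + (- 1) ^ (k - 1) * (\<Prod>i<k. cnj (p i))"
    using det_cyclic_bidiagonal[of k p "\<lambda>i. cnj (p i)"] D(1) by simp
  finally have det: "det_on (incidence w) (map ((!) c) [0..<k]) (map (cycle_arc G c) [0..<k]) =
    (\<Prod>i<k. p i) + (- 1) ^ (k - 1) * cnj (\<Prod>i<k. p i)" by (simp add: cnj_prod)
  define P where "P = (\<Prod>i<k. p i)"
  have "vwalk_arcs c = map (\<lambda>i. (c ! i, c ! Suc i)) [0..<k]"
    using D(2) by (intro nth_equalityI) (auto simp: vwalk_arcs_conv_zip nth_tl)
  then have "walk_wt G w c = (\<Prod>i<k. adj (c ! i) (c ! Suc i))"
    using prod.distinct_set_conv_list[of "[0..<k]" "\<lambda>i. adj (c ! i) (c ! Suc i)"]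
    by (simp add: walk_wt_def atLeast0LessThan comp_def)
  also have "\<dots> = P\<^sup>2" by (simp add: P_def p_def prod_power_distrib)
  finally have wt: "walk_wt G w c = P\<^sup>2" .
  have "(cmod (P + (- 1) ^ (k - 1) * cnj P))\<^sup>2 = 2 * (cmod (P\<^sup>2) - (- 1) ^ k * Re (P\<^sup>2))"
  proof -
    have e: "even (k - 1) \<longleftrightarrow> odd k" using D(1) by auto
    have "(cmod P)\<^sup>2 = (Re P)\<^sup>2 + (Im P)\<^sup>2" by (rule cmod_power2)
    then have r: "cmod (P\<^sup>2) = (Re P)\<^sup>2 + (Im P)\<^sup>2" "Re (P\<^sup>2) = (Re P)\<^sup>2 - (Im P)\<^sup>2"
      by (simp_all add: norm_mult power2_eq_square)
    show ?thesis
    proof (cases "even k")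
      case True
      then have "(- 1) ^ (k - 1) * cnj P = - cnj P" using e by simp
      then show ?thesis using True r cmod_power2[of "P + - cnj P"] by (simp add: power2_eq_square)
    next
      case False
      then have "(- 1) ^ (k - 1) * cnj P = cnj P" using e by simp
      then show ?thesis using False r cmod_power2[of "P + cnj P"] by (simp add: power2_eq_square)
    qed
  qed
  then show ?thesis using det wt by (simp add: P_def)
qed

text \<open>Every vertex off the cycle owns the arc to its parent, which pairs the remaining rows
  with the remaining columns. The diagonal entries of that block have modulus
  \<open>sqrt (cmod (w e))\<close>, so the square produces the product of the weights.\<close>

lemma unicyclic_absdet:
  assumes U: "oriented_graph U" and uni: "unicyclic U"
    and sub: "parcs U \<subseteq> parcs G" "pverts U \<subseteq> pverts G"
  shows "(absdet (incidence w) (pverts U) (parcs U))\<^sup>2 =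
    2 * cmod (\<Prod>e\<in>parcs U - the_cycle U. w e) * alpha G w (the_cycle U)"
proof -
  have con: "Digraph_Component.connected (with_proj U)" using uni by (simp add: unicyclic_def)
  have card: "card (pverts U) = card (parcs U)" using unicyclic_iff_card[OF U con] uni by simp
  let ?C = "the_cycle U"
  have C: "?C \<in> ucycles U" by (rule the_cycle_in[OF uni])
  then have CG: "?C \<in> ucycles G" "?C \<subseteq> parcs U" using ucycles_subgraph[OF G U sub] by auto
  obtain c where c: "ucycle_walk G c" "walk_arc_set G c = ?C" "cycle_wt G w ?C = walk_wt G w c"
    using cycle_wt_walk[OF CG(1)] .
  have cU: "ucycle_walk U c" using ucycle_walk_subgraph(1)[OF G U sub] c CG(2) by blast
  define k where "k = length c - 1"
  note D = ucycle_walkD[OF U cU k_def]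
  have k: "card ?C = k" using card_walk_arc_set[OF G c(1)] c(2) k_def by simp
  let ?vs1 = "map ((!) c) [0..<k]" and ?es1 = "map (cycle_arc G c) [0..<k]"
  define S where "S = (!) c ` {0..<k}"
  have es1: "distinct ?es1" "set ?es1 = ?C"
    using cycle_arc_bij[OF G c(1)] c(2)
    by (auto simp: bij_betw_def distinct_map atLeast0LessThan k_def)
  have vs1: "distinct ?vs1" "set ?vs1 = S"
    using D(4) by (auto simp: distinct_map atLeast0LessThan S_def)
  have S: "S \<subseteq> pverts U" "S \<noteq> {}" using D(1,2,6) by (auto simp: S_def)
  have cardS: "card S = k" using distinct_card[OF vs1(1)] vs1(2) by simp
  have C_ends: "fst e \<in> S \<and> snd e \<in> S" if e: "e \<in> ?C" for e
  proof -
    have "e \<in> cycle_arc G c ` {0..<k}" using e es1(2) by simp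
    then obtain i where i: "i < k" "e = cycle_arc G c i" by auto
    have "c ! Suc i \<in> S"
      using i(1) D(1,3) by (cases "Suc i = k") (auto simp: S_def)
    then show ?thesis using i by (auto simp: cycle_arc_def S_def)
  qed
  obtain d q f where P: "parent_map U S d q f" using parent_map_exists[OF U con S] .
  have Pf: "f x \<in> parcs U" "q x \<in> pverts U" "d (q x) < d x" "f x = (x, q x) \<or> f x = (q x, x)"
    if "x \<in> pverts U - S" for x using P that by (auto simp: parent_map_def)
  note inj = parent_map_inj[OF P]
  have finV: "finite (pverts U)" "finite (parcs U)" using oriented_graphD[OF U] by auto
  have f_notin: "f x \<notin> ?C" if "x \<in> pverts U - S" for x
    using C_ends[of "f x"] Pf(4)[OF that] that by auto
  \<comment> \<open>Surjectivity by counting: \<open>U\<close> has as many vertices as arcs, and the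
    cycle takes \<open>k\<close> of each.\<close>
  have fE: "f ` (pverts U - S) = parcs U - ?C"
  proof (rule card_subset_eq)
    show "finite (parcs U - ?C)" using finV by simp
    show "f ` (pverts U - S) \<subseteq> parcs U - ?C" using Pf(1) f_notin by auto
    show "card (f ` (pverts U - S)) = card (parcs U - ?C)"
      using card_image[OF inj] card_Diff_subset[of S "pverts U"] card_Diff_subset[of ?C "parcs U"]
        finV S(1) CG(2) cardS k card by (simp add: finite_subset)
  qed
  \<comment> \<open>Sorted by \<open>d\<close>, a parent precedes its children. So a later vertex is
    neither \<open>xs ! j\<close> nor its parent, which are the two ends of
    \<open>f (xs ! j)\<close>.\<close>
  define xs where "xs = sort_key d (SOME l. distinct l \<and> set l = pverts U - S)"
  have "\<exists>l. distinct l \<and> set l = pverts U - S" using finite_distinct_list[of "pverts U - S"] finV by auto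
  from someI_ex[OF this] have xs: "distinct xs" "set xs = pverts U - S" "sorted (map d xs)"
    by (auto simp: xs_def)
  have lens: "length ?vs1 = length ?es1" "length xs = length (map f xs)" by simp_all
  have es2: "distinct (map f xs)" "set (map f xs) = parcs U - ?C"
    using xs inj fE by (auto simp: distinct_map)
  have tri: "det_on (incidence w) xs (map f xs) = (\<Prod>i<length xs. incidence w (xs ! i) (map f xs ! i))"
  proof (rule det_on_triangular)
    fix i j assume ij: "j < i" "i < length xs"
    then have xj: "xs ! j \<in> pverts U - S" using xs(2) nth_mem[of j xs] by simp
    have "d (xs ! j) \<le> d (xs ! i)" using sorted_nth_mono[OF xs(3), of j i] ij by simp
    then have "xs ! i \<noteq> q (xs ! j)" using Pf(3)[OF xj] by auto
    moreover have "xs ! i \<noteq> xs ! j" using xs(1) ij by (simp add: nth_eq_iff_index_eq)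
    ultimately have "incidence w (xs ! i) (f (xs ! j)) = 0"
      using Pf(4)[OF xj] by (intro incidence_0) auto
    then show "incidence w (xs ! i) (map f xs ! j) = 0" using ij by simp
  qed simp
  have "(cmod (det_on (incidence w) xs (map f xs)))\<^sup>2 = (\<Prod>i<length xs. cmod (w (f (xs ! i))))"
    unfolding tri prod_norm[symmetric] prod_power_distrib
  proof (intro prod.cong refl)
    fix i assume i: "i \<in> {..<length xs}"
    then have x: "xs ! i \<in> pverts U - S" using xs(2) nth_mem[of i xs] by simp
    show "(cmod (incidence w (xs ! i) (map f xs ! i)))\<^sup>2 = cmod (w (f (xs ! i)))"
      using incidence_adj(2)[of "f (xs ! i)" "xs ! i" "q (xs ! i)"] Pf(1,4)[OF x] sub(1) i by auto
  qed
  also have "\<dots> = (\<Prod>e\<in>parcs U - ?C. cmod (w e))"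
    using prod.distinct_set_conv_list[OF es2(1), of "\<lambda>e. cmod (w e)"] es2(2)
    by (simp add: prod.list_conv_set_nth atLeast0LessThan comp_def)
  finally have tree: "(cmod (det_on (incidence w) xs (map f xs)))\<^sup>2 = cmod (\<Prod>e\<in>parcs U - ?C. w e)"
    by (simp add: prod_norm)
  have "absdet (incidence w) (pverts U) (parcs U) =
      absdet (incidence w) (set (?vs1 @ xs)) (set (?es1 @ map f xs))"
    using vs1 es1 es2 xs S CG(2) by (simp add: Un_absorb1)
  also have "\<dots> = cmod (det_on (incidence w) (?vs1 @ xs) (?es1 @ map f xs))"
    using vs1 es1 es2 xs by (intro absdet_eq) auto
  also have "det_on (incidence w) (?vs1 @ xs) (?es1 @ map f xs) =
      det_on (incidence w) ?vs1 ?es1 * det_on (incidence w) xs (map f xs)"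
  proof (rule det_on_append[OF lens])
    fix x e assume "x \<in> set xs" "e \<in> set ?es1"
    then have "x \<notin> S" "e \<in> ?C" using xs(2) es1(2) by auto
    then show "incidence w x e = 0" using C_ends[of e] by (intro incidence_0) auto
  qed
  finally have "(absdet (incidence w) (pverts U) (parcs U))\<^sup>2 =
    2 * (cmod (walk_wt G w c) - (- 1) ^ k * Re (walk_wt G w c)) * cmod (\<Prod>e\<in>parcs U - ?C. w e)"
    using cycle_det[OF c(1) k_def] tree by (simp add: norm_mult power_mult_distrib)
  moreover have "alpha G w ?C = cmod (walk_wt G w c) - (- 1) ^ k * Re (walk_wt G w c)"
    using c(3) k by (auto simp: alpha_def)
  ultimately show ?thesis by simp
qed

abbreviation component_weight :: "'a pair_pre_digraph \<Rightarrow> real" where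
  "component_weight U \<equiv> 2 * cmod (\<Prod>e\<in>parcs U - the_cycle U. w e) * alpha G w (the_cycle U)"

lemma component_weight_pos:
  assumes U: "oriented_graph U" and uni: "unicyclic U" and good: "good_cycle (the_cycle U)"
    and sub: "parcs U \<subseteq> parcs G" "pverts U \<subseteq> pverts G"
  shows "component_weight U > 0"
proof -
  have "the_cycle U \<in> ucycles G" using ucycles_subgraph[OF G U sub] the_cycle_in[OF uni] by auto
  then have "alpha G w (the_cycle U) > 0"
    using alpha_0_iff good alpha_nonneg[of "the_cycle U"] by (metis less_eq_real_def)
  moreover have "(\<Prod>e\<in>parcs U - the_cycle U. w e) \<noteq> 0"
    using weights sub(1) oriented_graphD(2)[OF U] by (auto simp: prod_zero_iff)
  ultimately show ?thesis by simp
qed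

lemma unicyclic_family_iff:
  "H \<in> unicyclic_family G w \<longleftrightarrow> spanning (with_proj H) (with_proj G) \<and> card (parcs H) = card (pverts G) \<and>
     (\<forall>U\<in>wccs H. unicyclic U \<and> good_cycle (the_cycle U))"
  by (auto simp: unicyclic_family_def good_cycle_def)

lemma spanning_pairs:
  "spanning (with_proj H) (with_proj G) \<longleftrightarrow> pverts H = pverts G \<and> parcs H \<subseteq> parcs G"
proof -
  have "wf_digraph (with_proj H)" if "pverts H = pverts G" "parcs H \<subseteq> parcs G"
  proof
    fix e assume "e \<in> arcs (with_proj H)"
    then have "(fst e, snd e) \<in> parcs G" using that by auto
    then show "tail (with_proj H) e \<in> verts (with_proj H)" "head (with_proj H) e \<in> verts (with_proj H)"
      using oriented_graphD(4)[OF G, of "fst e" "snd e"] that(1) by simp_all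
  qed
  then show ?thesis using oriented_graph_wf[OF G] by (auto simp: spanning_def subgraph_def)
qed

text \<open>If all components have as many arcs as vertices, the determinant factors over them.
  Otherwise one component \<open>U\<close> violates this, and the pigeonhole applies to the rows of
  \<open>U\<close> or, because the totals agree, to the rows outside \<open>U\<close>.\<close>

lemma spanning_absdet:
  assumes H: "pverts H = pverts G" "parcs H \<subseteq> parcs G" and card: "card (parcs H) = card (pverts G)"
  shows "(absdet (incidence w) (pverts G) (parcs H))\<^sup>2 =
      (if H \<in> unicyclic_family G w then \<Prod>U\<in>wccs H. component_weight U else 0)"
    and "H \<in> unicyclic_family G w \<Longrightarrow> (\<Prod>U\<in>wccs H. component_weight U) > 0"
proof -
  have orH: "oriented_graph H"
    by (rule oriented_subgraph[OF G]) (use H oriented_graphD(4)[OF G] in auto)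
  note W = wccsD[OF orH]
  have fin: "finite (parcs H)" "finite (pverts G)" using oriented_graphD[OF orH] H by auto
  have subG: "parcs U \<subseteq> parcs G" "pverts U \<subseteq> pverts G" if "U \<in> wccs H" for U
    using W(3,4)[OF that] H by auto
  have spH: "spanning (with_proj H) (with_proj G)" using H spanning_pairs by simp
  show "(\<Prod>U\<in>wccs H. component_weight U) > 0" if "H \<in> unicyclic_family G w"
    using that component_weight_pos W(1) subG unfolding unicyclic_family_iff by (intro prod_pos) blast
  have ends: "fst e \<in> pverts U \<and> snd e \<in> pverts U" if "U \<in> wccs H" "e \<in> parcs U" for U e
    using oriented_graphD(4)[OF W(1)[OF that(1)], of "fst e" "snd e"] that(2) by simp
  have inside: "e \<in> parcs U" if U: "U \<in> wccs H" and e: "e \<in> parcs H" and "fst e \<in> pverts U \<or> snd e \<in> pverts U" for U e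
  proof -
    obtain U' where U': "U' \<in> wccs H" "e \<in> parcs U'" using wccs_arcs[OF orH] e by blast
    then have "U' = U" using ends[OF U'] wccs_disjoint[OF orH U'(1) U] that(3) by blast
    then show ?thesis using U' by simp
  qed
  show "(absdet (incidence w) (pverts G) (parcs H))\<^sup>2 =
      (if H \<in> unicyclic_family G w then \<Prod>U\<in>wccs H. component_weight U else 0)"
  proof (cases "\<forall>U\<in>wccs H. card (pverts U) = card (parcs U)")
    case True
    then have uni: "unicyclic U" if "U \<in> wccs H" for U
      using unicyclic_iff_card[OF W(1,2)[OF that]] that by blast
    have "absdet (incidence w) (\<Union>U\<in>wccs H. pverts U) (\<Union>U\<in>wccs H. parcs U) =
        (\<Prod>U\<in>wccs H. absdet (incidence w) (pverts U) (parcs U))"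
    proof (rule absdet_UN[OF finite_wccs[OF orH]])
      fix U assume "U \<in> wccs H"
      then show "finite (pverts U) \<and> finite (parcs U) \<and> card (pverts U) = card (parcs U)"
        using True oriented_graphD(1,2)[OF W(1)] by blast
    next
      fix U U' assume U: "U \<in> wccs H" "U' \<in> wccs H" "U \<noteq> U'"
      then show "pverts U \<inter> pverts U' = {} \<and> parcs U \<inter> parcs U' = {}"
        using wccs_disjoint[OF orH U(1,2)] ends[OF U(1)] ends[OF U(2)] by blast
      fix x e assume "x \<in> pverts U" "e \<in> parcs U'"
      then show "incidence w x e = 0"
        using wccs_disjoint[OF orH U(1,2)] ends[OF U(2)] U(3) by (intro incidence_0) blast+
    qed
    then have "(absdet (incidence w) (pverts G) (parcs H))\<^sup>2 = (\<Prod>U\<in>wccs H. component_weight U)"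
      using unicyclic_absdet[OF W(1) uni subG] wccs_verts[OF orH] wccs_arcs[OF orH] H
      by (simp add: prod_power_distrib)
    \<comment> \<open>All components are unicyclic here, so only the condition on a cycle weight can
      fail, and then \<open>alpha\<close> of that cycle is 0.\<close>
    moreover have "(\<Prod>U\<in>wccs H. component_weight U) = 0" if bad: "H \<notin> unicyclic_family G w"
    proof -
      obtain U where U: "U \<in> wccs H" "\<not> good_cycle (the_cycle U)"
        using bad uni spH card unfolding unicyclic_family_iff by blast
      have "the_cycle U \<in> ucycles G"
        using ucycles_subgraph[OF G W(1)[OF U(1)] subG[OF U(1)]] the_cycle_in[OF uni[OF U(1)]] by auto
      then have "component_weight U = 0" using alpha_0_iff U(2) by simp
      then show ?thesis using U(1) finite_wccs[OF orH] by (intro prod_zero) auto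
    qed
    ultimately show ?thesis by simp
  next
    case False
    then obtain U where U: "U \<in> wccs H" "card (pverts U) \<noteq> card (parcs U)" by blast
    obtain vs es where l: "distinct vs" "set vs = pverts G" "distinct es" "set es = parcs H"
      using finite_distinct_list fin by metis
    have len: "length vs = length es" using l card by (metis distinct_card)
    have "det_on (incidence w) vs es = 0"
    proof (cases "card (parcs U) < card (pverts U)")
      case True
      have "parcs U \<inter> set es = parcs U" using W(4)[OF U(1)] l by auto
      with True show ?thesis
        by (intro det_on_pigeonhole[OF len l(1,3), of "pverts U" "parcs U"] incidence_0)
          (use l U(1) subG inside in auto)
    next
      \<comment> \<open>A surplus of arcs in \<open>U\<close> is a surplus of vertices outside
        \<open>U\<close>, and those vertices only meet arcs outside \<open>U\<close>.\<close>
      case False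
      have fU: "finite (pverts U)" "finite (parcs U)" using oriented_graphD(1,2)[OF W(1)[OF U(1)]] by auto
      have lt: "card (pverts U) < card (parcs U)" using False U(2) by simp
      have "card (parcs H - parcs U) = card (parcs H) - card (parcs U)"
        using W(4)[OF U(1)] fU by (intro card_Diff_subset) auto
      moreover have "card (pverts G - pverts U) = card (pverts G) - card (pverts U)"
        using subG[OF U(1)] fU by (intro card_Diff_subset) auto
      moreover have "card (parcs U) \<le> card (parcs H)" using W(4)[OF U(1)] fin by (intro card_mono) auto
      ultimately have "card ((parcs H - parcs U) \<inter> set es) < card (pverts G - pverts U)"
        using lt card l by (simp add: Int_absorb2)
      then show ?thesis
        by (intro det_on_pigeonhole[OF len l(1,3), of "pverts G - pverts U" "parcs H - parcs U"] incidence_0)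
          (use l U(1) ends in auto)
    qed
    then have "absdet (incidence w) (pverts G) (parcs H) = 0"
      using absdet_eq[OF l(1,3) len, of "incidence w"] l by simp
    moreover have "H \<notin> unicyclic_family G w"
      using U unicyclic_iff_card[OF W(1,2)[OF U(1)]] unfolding unicyclic_family_iff by blast
    ultimately show ?thesis by simp
  qed
qed

end

section \<open>Entries of the inverses\<close>

lemma length_vwalk_to_vpath: "length (vwalk_to_vpath p) \<le> length p"
proof (induction p rule: vwalk_to_vpath.induct)
  case (2 x xs)
  then show ?case
    using length_dropWhile_le[of "\<lambda>y. y \<noteq> x" xs] by (cases "x \<in> set xs") auto
qed simp

text \<open>Needed because the closed formula measures from \<open>j\<close> to \<open>u\<close>,
  while on a cycle component the values are propagated from \<open>u\<close> to
  \<open>j\<close>.\<close>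

lemma udist_sym: "udist T x y = udist T y x"
proof -
  have imp: "\<exists>p. uwalk T p \<and> hd p = y \<and> last p = x \<and> vwalk_length p = k"
    if ex: "\<exists>p. uwalk T p \<and> hd p = x \<and> last p = y \<and> vwalk_length p = k" for x y k
  proof -
    obtain p where "uwalk T p" "hd p = x" "last p = y" "vwalk_length p = k" using ex by blast
    then show ?thesis by (intro exI[of _ "rev p"]) (auto simp: uwalk_rev hd_rev last_rev)
  qed
  have "(\<lambda>k. \<exists>p. uwalk T p \<and> hd p = x \<and> last p = y \<and> vwalk_length p = k) =
      (\<lambda>k. \<exists>p. uwalk T p \<and> hd p = y \<and> last p = x \<and> vwalk_length p = k)"
    by (rule ext, rule iffI) (rule imp, assumption)+
  then show ?thesis unfolding udist_def by presburger
qed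

lemma uwalk_component:
  assumes T: "oriented_graph T" and K: "K \<in> wccs T" and p: "uwalk T p" "hd p \<in> pverts K"
  shows "uwalk K p"
proof -
  have sub: "set p \<subseteq> pverts K" using uwalk_reach[OF p(1)] wccs_reach[OF T K p(2)] by blast
  have "set (vwalk_arcs p) \<subseteq> uadj K"
  proof
    fix a assume a: "a \<in> set (vwalk_arcs p)"
    then have "fst a \<in> pverts K" "(fst a, snd a) \<in> uadj T"
      using sub arcs_in_vwalk_arcs[OF a] p(1) by (auto simp: uwalk_iff subset_iff)
    then show "a \<in> uadj K" using wccsD(6)[OF T K] by (metis prod.collapse)
  qed
  then show ?thesis using sub p(1) by (simp add: uwalk_iff)
qed

text \<open>Without cycles two paths with the same ends coincide, so the description
  \<open>the_path\<close> is proper. A shortest walk shortened to a path is that same path, hence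
  its length is the distance.\<close>

lemma the_path_acyclic:
  assumes T: "oriented_graph T" and K: "K \<in> wccs T" and acyc: "ucycles K = {}"
    and xy: "x \<in> pverts K" "y \<in> pverts K"
  defines "p \<equiv> the_path T x y"
  shows "uwalk T p" "distinct p" "hd p = x" "last p = y" "length p = Suc (udist T x y)"
proof -
  let ?P = "\<lambda>p. vpath p (with_proj (mk_symmetric (with_proj T))) \<and> hd p = x \<and> last p = y"
  note KD = wccsD[OF T K]
  have "(x, y) \<in> (uadj K)\<^sup>*" using KD(2) xy unfolding connected_iff[OF KD(1)] by blast
  from reach_upath[OF KD(1) xy(1) this]
  obtain q where "uwalk K q" "distinct q" "hd q = x" "last q = y" by blast
  then have ex: "\<exists>q. ?P q" using uwalk_mono[OF _ KD(3,4)] by (auto simp: vpath_def)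
  have uniq: "q = r" if "?P q" "?P r" for q r
    using two_paths_cycle[OF KD(1), of q r] uwalk_component[OF T K, of q] uwalk_component[OF T K, of r]
      that xy(1) acyc by (auto simp: vpath_def)
  have p: "?P p" unfolding p_def the_path_def by (rule theI') (use ex uniq in blast)
  then show w: "uwalk T p" "distinct p" "hd p = x" "last p = y" by (auto simp: vpath_def)
  let ?W = "\<lambda>k. \<exists>q. uwalk T q \<and> hd q = x \<and> last q = y \<and> vwalk_length q = k"
  have W: "?W (length p - 1)" using w by auto
  have "?W (udist T x y)" unfolding udist_def by (rule LeastI[of ?W, OF W])
  then obtain q where q: "uwalk T q" "hd q = x" "last q = y" "length q - 1 = udist T x y" by auto
  have "?P (vwalk_to_vpath q)"
    using vwalk_to_vpath_vpath[OF q(1)] q(2,3) by (simp add: vwalk_to_vpath_hd vwalk_to_vpath_last)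
  then have "vwalk_to_vpath q = p" using uniq p by blast
  then have "length p - 1 \<le> udist T x y" using length_vwalk_to_vpath[of q] q(4) by auto
  moreover have "udist T x y \<le> length p - 1" unfolding udist_def by (rule Least_le[of ?W, OF W])
  moreover have "length p > 0" using w(1) by (auto simp: uwalk_iff)
  ultimately show "length p = Suc (udist T x y)" by simp
qed

lemma connected_wccs_self:
  assumes T: "oriented_graph T" and con: "Digraph_Component.connected (with_proj T)"
  shows "T \<in> wccs T"
proof -
  have "parcs T = {e \<in> parcs T. fst e \<in> pverts T \<and> snd e \<in> pverts T}"
    using oriented_graphD(4)[OF T] by auto
  then show ?thesis unfolding wccs_def induced_subgraph_pairs[OF T] using con by blast
qed

lemma minus_one_power_swap:
  fixes a b c :: complex
  assumes "b = (- 1) ^ k * a * c" "c \<noteq> 0" shows "a = (- 1) ^ k * b * (1 / c)"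
  using assms by (cases "even k") auto

context weighted_oriented_graph
begin

lemma balanced_the_path:
  assumes T: "oriented_graph T" and sub: "parcs T \<subseteq> parcs G" and K: "K \<in> wccs T" "ucycles K = {}"
    and xy: "x \<in> pverts K" "y \<in> pverts K"
    and bal: "\<And>e. e \<in> parcs T \<Longrightarrow> balanced w z e"
  shows "z y = (- 1) ^ udist T x y * z x * sgn (walk_wt G w (the_path T x y))"
    and "walk_wt G w (the_path T x y) \<noteq> 0"
proof -
  note p = the_path_acyclic[OF T K xy]
  show "z y = (- 1) ^ udist T x y * z x * sgn (walk_wt G w (the_path T x y))"
    using balanced_walk[OF sub bal p(1)] p(3-5) by simp
  show "walk_wt G w (the_path T x y) \<noteq> 0"
    using p(1) sub by (intro walk_wt_nz) (auto simp: uwalk_iff)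
qed

text \<open>Here \<open>z\<close> plays the part of row \<open>e\<close> of the inverse. After
  removing \<open>e\<close>, a component with a good cycle forces \<open>z\<close> to be 0 on it; on
  a tree component \<open>z\<close> is determined by its value at an end of \<open>e\<close>, which
  \<open>unit\<close> supplies.\<close>

lemma balanced_explicit_entry:
  assumes H: "H \<in> unicyclic_family G w" and U: "U \<in> wccs H" and e: "e \<in> parcs U"
    and bal: "\<And>e'. e' \<in> parcs H \<Longrightarrow> e' \<noteq> e \<Longrightarrow> balanced w z e'"
    and unit: "z (fst e) * csqrt (w e) + z (snd e) * csqrt (cnj (w e)) = 1"
    and j: "j \<in> pverts G"
  shows "z j = explicit_entry G w U e j"
proof -
  have "spanning (with_proj H) (with_proj G)" using H by (simp add: unicyclic_family_def)
  then have HG: "pverts H = pverts G" "parcs H \<subseteq> parcs G"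
    by (auto simp: spanning_def subgraph_def)
  have comp: "unicyclic U \<and> good_cycle (the_cycle U)" if "U \<in> wccs H" for U
    using H that by (auto simp: unicyclic_family_def good_cycle_def)
  have orH: "oriented_graph H"
    by (rule oriented_subgraph[OF G]) (use HG oriented_graphD(4)[OF G] in auto)
  note W = wccsD[OF orH]
  have subG: "parcs U \<subseteq> parcs G" "pverts U \<subseteq> pverts G" if "U \<in> wccs H" for U
    using W(3,4)[OF that] HG by auto
  define u v where "u = fst e" and "v = snd e"
  define T where "T = remove_arc U e"
  define C where "C = the_cycle U"
  define \<epsilon> :: complex where "\<epsilon> = (if even (card C) then 1 else - 1)"
  define s where "s = csqrt (w e)"
  define wt where "wt x y = walk_wt G w (the_path T x y)" for x y
  have orU: "oriented_graph U" and conU: "Digraph_Component.connected (with_proj U)" by (rule W(1,2)[OF U])+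
  have orT: "oriented_graph T" unfolding T_def by (rule oriented_remove_arc[OF orU])
  have T: "pverts T = pverts U" "parcs T = parcs U - {e}" by (simp_all add: T_def)
  have TG: "parcs T \<subseteq> parcs G" "pverts T \<subseteq> pverts G" using T subG[OF U] by auto
  have balT: "balanced w z e'" if "e' \<in> parcs T" for e' using that bal[of e'] T(2) W(4)[OF U] by blast
  have uni: "unicyclic U" and good: "good_cycle C" using comp[OF U] by (auto simp: C_def)
  have C: "C \<in> ucycles U" unfolding C_def by (rule the_cycle_in[OF uni])
  have Cuniq: "C' = C" if "C' \<in> ucycles U" for C' using the_cycle_eq[OF uni that] by (simp add: C_def)
  have uv: "u \<in> pverts U" "v \<in> pverts U" "(u, v) \<in> uadj G" "adj u v = w e"
    using oriented_graphD(4)[OF orU, of u v] e subG(1)[OF U]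
    by (cases e; auto simp: u_def v_def adj_entry_def)+
  have nz: "s \<noteq> 0" "w e \<noteq> 0" using weights[of e] e subG(1)[OF U] by (auto simp: s_def)
  have s: "csqrt (cnj (w e)) = cnj s"
    using csqrt_adj[OF uv(3)] adj_cnj[where x = u and y = v] uv(4) by (simp add: s_def)
  have sgn_s: "sgn (w e) * cnj s = s" using sgn_adj[OF uv(3)] uv(4) by (simp add: s_def)
  have unit': "z u * s + z v * cnj s = 1" using unit s by (simp add: u_def v_def s_def)
  have cyc_sub: "ucycles K \<subseteq> ucycles U" if "K \<in> wccs T" for K
  proof -
    have "parcs K \<subseteq> parcs U" "pverts K \<subseteq> pverts U" using wccsD(3,4)[OF orT that] T by auto
    then show ?thesis using ucycles_subgraph[OF orU wccsD(1)[OF orT that]] by blast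
  qed
  have bal_0: "z x = 0" if K: "K \<in> wccs T" "C \<in> ucycles K" and x: "x \<in> pverts K" for K x
  proof (rule balanced_good_cycle[OF wccsD(1,2)[OF orT K(1)] _ _ K(2) good _ x])
    show "parcs K \<subseteq> parcs G" "pverts K \<subseteq> pverts G" using wccsD(3,4)[OF orT K(1)] TG by auto
    show "balanced w z e'" if "e' \<in> parcs K" for e' using balT[of e'] wccsD(4)[OF orT K(1)] that by blast
  qed
  show ?thesis
  proof (cases "j \<in> pverts U")
    case False
    obtain U' where U': "U' \<in> wccs H" "j \<in> pverts U'" using wccs_cover[OF orH, of j] j HG(1) by auto
    have eU': "e \<notin> parcs U'"
      using wccs_disjoint[OF orH U U'(1)] False U'(2) e oriented_graphD(4)[OF W(1)[OF U'(1)], of u v] uv(1)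
      by (auto simp: u_def v_def)
    have "z j = 0"
    proof (rule balanced_good_cycle[OF W(1,2)[OF U'(1)] subG[OF U'(1)] _ _ _ U'(2)])
      show "the_cycle U' \<in> ucycles U'" "good_cycle (the_cycle U')"
        using comp[OF U'(1)] the_cycle_in by auto
      show "balanced w z e'" if "e' \<in> parcs U'" for e' using that bal W(4)[OF U'(1)] eU' by blast
    qed
    then show ?thesis using False by (simp add: explicit_entry_def Let_def)
  next
    case jU: True
    show ?thesis
    proof (cases "e \<in> C")
      case True
      have conT: "Digraph_Component.connected (with_proj T)"
        unfolding T_def by (rule connected_remove_arc[OF orU conU C True])
      have TT: "T \<in> wccs T" by (rule connected_wccs_self[OF orT conT])
      have acyc: "ucycles T = {}" using cyc_sub[OF TT] Cuniq True ucycle_subset[of _ T] T(2) by blast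
      have verts: "u \<in> pverts T" "v \<in> pverts T" "j \<in> pverts T" using uv jU T by auto
      have zj: "z j = (- 1) ^ udist T u j * z u * sgn (wt u j)"
        unfolding wt_def by (rule balanced_the_path(1)[OF orT TG(1) TT acyc verts(1,3) balT])
      have zv: "z v = (- 1) ^ udist T u v * z u * sgn (wt u v)"
        unfolding wt_def by (rule balanced_the_path(1)[OF orT TG(1) TT acyc verts(1,2) balT])
      note p = the_path_acyclic[OF orT TT acyc verts(1,2)]
      have cyc: "ucycle_walk U (v # the_path T u v)"
        "card (walk_arc_set U (v # the_path T u v)) = length (the_path T u v)"
        using path_closes_cycle(1,3)[OF orU e, of "the_path T u v"] p(1-4)
        by (simp_all add: T_def u_def v_def)
      have "walk_arc_set U (v # the_path T u v) = C" using Cuniq cyc(1) by (auto simp: ucycles_def)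
      then have "card C = Suc (udist T u v)" using cyc(2) p(5) by simp
      \<comment> \<open>The cycle consists of \<open>e\<close> and the path from \<open>u\<close> to
        \<open>v\<close>, so it has one arc more than their distance.\<close>
      then have eps: "(- 1) ^ udist T u v = - \<epsilon>" by (simp add: \<epsilon>_def)
      have "z u * (s - \<epsilon> * sgn (wt u v) * cnj s) = 1"
        using unit' zv eps by (simp add: algebra_simps)
      \<comment> \<open>Replacing \<open>s\<close> by \<open>sgn (w e) * cnj s\<close> lets the
        conjugate root be factored out, as in the stated denominator.\<close>
      then have "z u * (cnj s * (sgn (w e) - \<epsilon> * sgn (wt u v))) = 1"
        using sgn_s by (simp add: algebra_simps)
      then have zu: "z u = 1 / (cnj s * (sgn (w e) - \<epsilon> * sgn (wt u v)))"
        by (metis mult_zero_right nonzero_eq_divide_eq zero_neq_one)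
      have "z j = (- 1) ^ udist T j u * (sgn (wt u j) / (cnj s * (sgn (w e) - \<epsilon> * sgn (wt u v))))"
        using zj zu udist_sym[of T u j] by simp
      moreover have "explicit_entry G w U e j =
          (- 1) ^ udist T j u * (sgn (wt u j) / (cnj s * (sgn (w e) - \<epsilon> * sgn (wt u v))))"
        using jU True s unfolding explicit_entry_def Let_def
        by (simp add: u_def v_def T_def C_def \<epsilon>_def wt_def sgn_eq)
      ultimately show ?thesis by simp
    next
      case False
      define K where "K = component_of T j"
      have jT: "j \<in> pverts T" using jU T by simp
      have K: "K \<in> wccs T" "j \<in> pverts K" unfolding K_def by (rule component_of[OF orT jT])+
      have CT: "C \<in> ucycles T"
        using ucycles_subgraph[OF orU orT] T C False ucycle_subset[OF C] by auto
      show ?thesis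
      proof (cases "unicyclic K")
        case True
        then have "the_cycle K \<in> ucycles K" by (rule the_cycle_in)
        then have "C \<in> ucycles K" using cyc_sub[OF K(1)] Cuniq by auto
        then have "z j = 0" using bal_0[OF K(1) _ K(2)] by blast
        then show ?thesis using jU False True
          by (simp add: explicit_entry_def Let_def K_def T_def C_def)
      next
        case nuni: False
        \<comment> \<open>A cycle of \<open>K\<close> could only be \<open>C\<close>, and then the
          connected \<open>K\<close> would be unicyclic.\<close>
        have acyc: "ucycles K = {}"
        proof (rule ccontr)
          assume "ucycles K \<noteq> {}"
          then obtain C' where "C' \<in> ucycles K" by blast
          moreover have "C'' = C" if "C'' \<in> ucycles K" for C'' using that cyc_sub[OF K(1)] Cuniq by blast
          ultimately have "\<exists>!C. C \<in> ucycles K" by blast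
          then show False using nuni wccsD(2)[OF orT K(1)] by (simp add: unicyclic_def)
        qed
        obtain c where c: "ucycle_walk U c" "C = walk_arc_set U c" using C by (auto simp: ucycles_def)
        have "card C \<noteq> 0" using card_walk_arc_set[OF orU c(1)] c by (auto simp: ucycle_walk_def)
        then obtain e0 where e0: "e0 \<in> C" by (metis all_not_in_conv card.empty)
        then have "e0 \<in> parcs T" using ucycle_subset[OF CT] by blast
        \<comment> \<open>\<open>K'\<close> is the part that keeps the cycle, so \<open>z\<close>
          vanishes on it.\<close>
        then obtain K' where K': "K' \<in> wccs T" "e0 \<in> parcs K'" using wccs_arcs[OF orT] by blast
        have CK': "C \<in> ucycles K'" by (rule ucycle_component[OF orT CT K'(1) e0 K'(2)])
        have KK': "K \<noteq> K'" using CK' acyc by blast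
        \<comment> \<open>Since \<open>U\<close> is connected, each component left by removing
          \<open>e\<close> contains an end of \<open>e\<close>. So \<open>K\<close> and
          \<open>K'\<close> take one end each, and \<open>z\<close> is 0 at the end in
          \<open>K'\<close>.\<close>
        have touches: "u \<in> pverts L \<or> v \<in> pverts L" if L: "L \<in> wccs T" for L
        proof (rule ccontr)
          assume no: "\<not> (u \<in> pverts L \<or> v \<in> pverts L)"
          obtain x where x: "x \<in> pverts L" using wccsD(5)[OF orT L] by blast
          then have "x \<in> pverts U" using wccsD(3)[OF orT L] T by auto
          then have "(x, u) \<in> (uadj U)\<^sup>*" using conU uv(1) unfolding connected_iff[OF orU] by blast
          then have "u \<in> pverts L"
          proof induction
            case (step a b)
            then have "(a, b) \<noteq> e" "(b, a) \<noteq> e" using no by (auto simp: u_def v_def)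
            then have "(a, b) \<in> uadj T" using step.hyps(2) T(2) by auto
            then show ?case using wccsD(6)[OF orT L step.IH] by blast
          qed (rule x)
          then show False using no by blast
        qed
        \<comment> \<open>The formula for a tree uses the path from \<open>j\<close>, so the
          propagation starts at \<open>j\<close> and is then solved for \<open>z j\<close>; this
          puts the phase in the denominator.\<close>
        have path: "z j = (- 1) ^ udist T j x * z x * (1 / sgn (wt j x))" if x: "x \<in> pverts K" for x
        proof (rule minus_one_power_swap)
          show "z x = (- 1) ^ udist T j x * z j * sgn (wt j x)"
            unfolding wt_def by (rule balanced_the_path(1)[OF orT TG(1) K(1) acyc K(2) x balT])
          show "sgn (wt j x) \<noteq> 0"
            using balanced_the_path(2)[OF orT TG(1) K(1) acyc K(2) x balT] by (simp add: wt_def sgn_zero_iff)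
        qed
        show ?thesis
        proof (cases "u \<in> pverts K")
          case True
          then have "u \<notin> pverts K'" using wccs_disjoint[OF orT K(1) K'(1)] KK' by blast
          then have "z v = 0" using touches[OF K'(1)] bal_0[OF K'(1) CK'] by blast
          then have "z u = 1 / s" using unit' nz(1) by (simp add: field_simps)
          then have "z j = (- 1) ^ udist T j u * (1 / s) * (1 / sgn (wt j u))" using path[OF True] by simp
          moreover have "explicit_entry G w U e j = (- 1) ^ udist T j u * (1 / s) * (1 / sgn (wt j u))"
            using jU False nuni True unfolding explicit_entry_def Let_def
            by (simp add: u_def T_def C_def wt_def sgn_eq K_def s_def)
          ultimately show ?thesis by simp
        next
          case uK: False
          then have vK: "v \<in> pverts K" using touches[OF K(1)] by blast
          then have "v \<notin> pverts K'" using wccs_disjoint[OF orT K(1) K'(1)] KK' by blast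
          then have "z u = 0" using touches[OF K'(1)] bal_0[OF K'(1) CK'] by blast
          then have "z v = 1 / cnj s" using unit' nz(1) by (simp add: field_simps)
          then have "z j = (- 1) ^ udist T j v * (1 / cnj s) * (1 / sgn (wt j v))" using path[OF vK] by simp
          moreover have "explicit_entry G w U e j = (- 1) ^ udist T j v * (1 / cnj s) * (1 / sgn (wt j v))"
            using jU False nuni uK s unfolding explicit_entry_def Let_def
            by (simp add: u_def v_def T_def C_def wt_def sgn_eq K_def)
          ultimately show ?thesis by simp
        qed
      qed
    qed
  qed
qed

end

section \<open>Submatrices and spanning subgraphs\<close>

text \<open>If the Gram matrix kills \<open>v\<close>, then \<open>u\<close>, the row vector v^* A,
  has squared norm v^* A A^* v = 0. Hence the conjugate of \<open>v\<close> lies in the left kernel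
  of \<open>A\<close>.\<close>

lemma det_gram_nonzero:
  fixes A :: "complex mat"
  assumes A: "A \<in> carrier_mat n m"
    and ker: "\<And>y. (\<And>j. j < m \<Longrightarrow> (\<Sum>i<n. y i * A $$ (i, j)) = 0) \<Longrightarrow> (\<And>i. i < n \<Longrightarrow> y i = 0)"
  shows "det (A * mat_adjoint A) \<noteq> 0"
proof
  let ?M = "A * mat_adjoint A"
  have adj: "mat_adjoint A \<in> carrier_mat m n" using A by (auto simp: mat_adjoint_dim intro: carrier_matI)
  have M: "?M \<in> carrier_mat n n" using A adj by auto
  assume "det ?M = 0"
  then obtain v where v: "v \<in> carrier_vec n" "v \<noteq> 0\<^sub>v n" "?M *\<^sub>v v = 0\<^sub>v n"
    using det_0_iff_vec_prod_zero_field[OF M] by blast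
  define u where "u j = (\<Sum>i<n. cnj (v $ i) * A $$ (i, j))" for j
  have "(\<Sum>j<m. A $$ (i, j) * cnj (u j)) = 0" if i: "i < n" for i
  proof -
    have "(\<Sum>j<m. A $$ (i, j) * cnj (u j)) = (\<Sum>j<m. \<Sum>k<n. A $$ (i, j) * mat_adjoint A $$ (j, k) * v $ k)"
      using A by (auto simp: u_def cnj_sum sum_distrib_left mat_adjoint_index ac_simps intro!: sum.cong)
    also have "\<dots> = (\<Sum>k<n. (\<Sum>j<m. A $$ (i, j) * mat_adjoint A $$ (j, k)) * v $ k)"
      by (subst sum.swap) (simp add: sum_distrib_right)
    also have "\<dots> = (\<Sum>k<n. ?M $$ (i, k) * v $ k)"
      by (intro sum.cong refl) (use index_mult_mat_sum[OF A adj i] in auto)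
    also have "\<dots> = (?M *\<^sub>v v) $ i"
      using M v(1) i by (simp add: scalar_prod_def atLeast0LessThan del: index_mult_mat)
    finally show ?thesis using v(3) i by simp
  qed
  then have "0 = (\<Sum>i<n. cnj (v $ i) * (\<Sum>j<m. A $$ (i, j) * cnj (u j)))" by simp
  also have "\<dots> = (\<Sum>j<m. u j * cnj (u j))"
  proof -
    have "(\<Sum>i<n. cnj (v $ i) * (\<Sum>j<m. A $$ (i, j) * cnj (u j))) =
        (\<Sum>j<m. \<Sum>i<n. cnj (v $ i) * A $$ (i, j) * cnj (u j))"
      by (subst sum.swap) (simp add: sum_distrib_left mult.assoc)
    also have "\<dots> = (\<Sum>j<m. u j * cnj (u j))"
      by (intro sum.cong refl) (subst (2) u_def, simp add: sum_distrib_right)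
    finally show ?thesis .
  qed
  also have "\<dots> = of_real (\<Sum>j<m. (cmod (u j))\<^sup>2)"
    by (simp add: complex_norm_square del: of_real_power)
  finally have "(\<Sum>j<m. (cmod (u j))\<^sup>2) = 0" by (metis of_real_eq_0_iff)
  then have "u j = 0" if "j < m" for j using that by (simp add: sum_nonneg_eq_0_iff)
  then have "(\<Sum>i<n. cnj (v $ i) * A $$ (i, j)) = 0" if "j < m" for j using that by (simp only: u_def)
  from ker[of "\<lambda>i. cnj (v $ i)", OF this] have "v $ i = 0" if "i < n" for i using that by simp
  then have "v = 0\<^sub>v n" using v(1) by (intro eq_vecI) auto
  then show False using v(2) by simp
qed

locale enumerated_graph = weighted_oriented_graph G w
  for G :: "nat pair_pre_digraph" and w :: "nat \<times> nat \<Rightarrow> complex" +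
  fixes es :: "(nat \<times> nat) list" and n :: nat
  assumes verts: "pverts G = {..<n}" and dist: "distinct es" and arcs: "set es = parcs G"
begin

abbreviation N where "N \<equiv> signless_incidence n es w"

definition arcs_graph :: "nat set \<Rightarrow> nat pair_pre_digraph" where
  "arcs_graph J = \<lparr>pverts = {..<n}, parcs = (!) es ` J\<rparr>"

lemma N_carrier: "N \<in> carrier_mat n (length es)" by (simp add: signless_incidence_def)

lemma arc_ends: "e \<in> parcs G \<Longrightarrow> fst e < n \<and> snd e < n \<and> fst e \<noteq> snd e"
  using oriented_graphD(4)[OF G, of "fst e" "snd e"] verts by simp

lemma sub_incidence_kernel:
  assumes "e \<in> parcs G" "(\<Sum>x<n. y x * incidence w x e) = 0" shows "balanced w y e"
  using assms arc_ends[OF assms(1)] sum_incidence[of "{..<n}" e y w] by (simp add: balanced_def)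

text \<open>A row vector in the left kernel of \<open>N\<close> is balanced at every arc of
  \<open>G\<close>, so a single good cycle makes it vanish everywhere.\<close>

lemma det_gram_N:
  assumes con: "Digraph_Component.connected (with_proj G)" and C: "C \<in> ucycles G" "good_cycle C"
  shows "det (N * mat_adjoint N) \<noteq> 0"
proof (rule det_gram_nonzero[OF N_carrier])
  fix y i assume y: "\<And>j. j < length es \<Longrightarrow> (\<Sum>i<n. y i * N $$ (i, j)) = 0" and i: "i < n"
  have "balanced w y e" if e: "e \<in> parcs G" for e
  proof (rule sub_incidence_kernel[OF e])
    obtain j where j: "j < length es" "es ! j = e" using e arcs by (metis in_set_conv_nth)
    show "(\<Sum>x<n. y x * incidence w x e) = 0"
      using y[OF j(1)] j by (simp add: signless_incidence_eq)
  qed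
  then show "y i = 0" using balanced_good_cycle[OF G con _ _ C, of y i] i verts by simp
qed

text \<open>This turns the Cauchy-Binet sums over column sets into sums over spanning
  subgraphs.\<close>

lemma arcs_graph_bij:
  "bij_betw arcs_graph {J. J \<subseteq> {..<length es} \<and> card J = n}
     {H. spanning (with_proj H) (with_proj G) \<and> card (parcs H) = card (pverts G)}"
proof (rule bij_betw_imageI)
  have inj: "inj_on ((!) es) {..<length es}" using dist by (auto simp: inj_on_def nth_eq_iff_index_eq)
  show "inj_on arcs_graph {J. J \<subseteq> {..<length es} \<and> card J = n}"
    using inj by (auto simp: inj_on_def arcs_graph_def inj_on_image_eq_iff[of "(!) es" "{..<length es}"]) 
  show "arcs_graph ` {J. J \<subseteq> {..<length es} \<and> card J = n} =
      {H. spanning (with_proj H) (with_proj G) \<and> card (parcs H) = card (pverts G)}"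
  proof (intro subset_antisym subsetI)
    fix H assume "H \<in> arcs_graph ` {J. J \<subseteq> {..<length es} \<and> card J = n}"
    then obtain J where J: "J \<subseteq> {..<length es}" "card J = n" "H = arcs_graph J" by blast
    have "card ((!) es ` J) = n" using card_image[OF inj_on_subset[OF inj J(1)]] J(2) by simp
    moreover have "(!) es ` J \<subseteq> parcs G" unfolding arcs[symmetric] using J(1) by (auto intro!: nth_mem)
    ultimately show "H \<in> {H. spanning (with_proj H) (with_proj G) \<and> card (parcs H) = card (pverts G)}"
      using J(3) verts by (simp add: arcs_graph_def spanning_pairs)
  next
    fix H assume "H \<in> {H. spanning (with_proj H) (with_proj G) \<and> card (parcs H) = card (pverts G)}"
    then have H: "pverts H = {..<n}" "parcs H \<subseteq> set es" "card (parcs H) = n"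
      using verts arcs by (auto simp: spanning_pairs)
    define J where "J = {i. i < length es \<and> es ! i \<in> parcs H}"
    have J: "J \<subseteq> {..<length es}" by (auto simp: J_def)
    have img: "(!) es ` J = parcs H"
    proof (intro subset_antisym subsetI)
      fix e assume e: "e \<in> parcs H"
      then obtain i where "i < length es" "es ! i = e" using H(2) by (metis in_set_conv_nth subsetD)
      then show "e \<in> (!) es ` J" using e by (intro image_eqI[of _ _ i]) (auto simp: J_def)
    qed (auto simp: J_def)
    then have "card J = n" using card_image[OF inj_on_subset[OF inj J]] H(3) by simp
    moreover have "H = arcs_graph J" using H(1) img by (simp add: arcs_graph_def)
    ultimately show "H \<in> arcs_graph ` {J. J \<subseteq> {..<length es} \<and> card J = n}" using J by blast
  qed
qed

text \<open>The row number in \<open>sub_mp_entry\<close> counts the chosen arcs before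
  \<open>es ! i\<close>. It agrees with the row number that \<open>mp_inverse_Cauchy_Binet\<close>
  uses for the column set \<open>J\<close>.\<close>

lemma sub_arcs_arcs_graph:
  assumes J: "J \<subseteq> {..<length es}"
  shows "sub_arcs es (arcs_graph J) = nths es J"
    and "i \<in> J \<Longrightarrow> length (sub_arcs (take i es) (arcs_graph J)) = card {a\<in>J. a < i}"
proof -
  have mem: "es ! k \<in> (!) es ` J \<longleftrightarrow> k \<in> J" if "k < length es" for k
    using that J dist by (auto simp: nth_eq_iff_index_eq subset_iff)
  have "sub_arcs es (arcs_graph J) = nths es {k. k < length es \<and> es ! k \<in> (!) es ` J}"
    unfolding sub_arcs_def arcs_graph_def by (simp add: filter_eq_nths)
  also have "{k. k < length es \<and> es ! k \<in> (!) es ` J} = J" using mem J by auto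
  finally show "sub_arcs es (arcs_graph J) = nths es J" .
  assume i: "i \<in> J"
  then have il: "i < length es" using J by auto
  have "length (sub_arcs (take i es) (arcs_graph J)) = card {k. k < i \<and> es ! k \<in> (!) es ` J}"
    using il by (simp add: sub_arcs_def arcs_graph_def length_filter_conv_card)
      (metis (no_types, lifting) nth_take)
  also have "{k. k < i \<and> es ! k \<in> (!) es ` J} = {a\<in>J. a < i}"
  proof (rule Set.set_eqI)
    show "k \<in> {k. k < i \<and> es ! k \<in> (!) es ` J} \<longleftrightarrow> k \<in> {a\<in>J. a < i}" for k
      using mem[of k] il by (cases "k < i") simp_all
  qed
  finally show "length (sub_arcs (take i es) (arcs_graph J)) = card {a\<in>J. a < i}" .
qed

lemma pick_cols_N:
  assumes J: "J \<subseteq> {..<length es}" "card J = n"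
  shows "pick_cols N J = signless_incidence n (sub_arcs es (arcs_graph J)) w"
    and "(cmod (det (pick_cols N J)))\<^sup>2 = (absdet (incidence w) (pverts G) (parcs (arcs_graph J)))\<^sup>2"
proof -
  have Jset: "{i. i < length es \<and> i \<in> J} = J" using J by auto
  have len: "length (nths es J) = n" using J Jset by (simp add: length_nths)
  have nth: "nths es J ! j = es ! pick J j" if "j < n" for j
    using nth_nths[of j es J] that Jset J(2) by simp
  have lt: "pick J j < length es" if "j < n" for j
    using pick_in_set_le[of j J] that J by auto
  show eq: "pick_cols N J = signless_incidence n (sub_arcs es (arcs_graph J)) w"
    unfolding sub_arcs_arcs_graph(1)[OF J(1)] signless_incidence_eq pick_cols_def
    by (intro eq_matI) (use len nth lt in auto)
  have "set (nths es J) = (!) es ` J" using J(1) by (auto simp: set_nths)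
  moreover have "distinct (nths es J)" using dist by (rule distinct_nthsI)
  moreover have "set [0..<n] = pverts G" using verts by (simp add: atLeast0LessThan)
  ultimately have "absdet (incidence w) (pverts G) (parcs (arcs_graph J)) =
      cmod (det_on (incidence w) [0..<n] (nths es J))"
    using absdet_eq[of "[0..<n]" "nths es J" "incidence w"] len by (simp add: arcs_graph_def)
  also have "det_on (incidence w) [0..<n] (nths es J) = det (pick_cols N J)"
    unfolding eq unfolding sub_arcs_arcs_graph(1)[OF J(1)] signless_incidence_eq det_on_def
    by (intro arg_cong[of _ _ det] eq_matI) (use len in auto)
  finally show "(cmod (det (pick_cols N J)))\<^sup>2 = (absdet (incidence w) (pverts G) (parcs (arcs_graph J)))\<^sup>2"
    by simp
qed

lemma det_pick_cols_N:
  assumes J: "J \<subseteq> {..<length es}" "card J = n"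
  shows "(cmod (det (pick_cols N J)))\<^sup>2 =
    (if arcs_graph J \<in> unicyclic_family G w then \<Prod>U\<in>wccs (arcs_graph J). component_weight U else 0)"
    and "det (pick_cols N J) \<noteq> 0 \<longleftrightarrow> arcs_graph J \<in> unicyclic_family G w"
proof -
  have "arcs_graph J \<in> {H. spanning (with_proj H) (with_proj G) \<and> card (parcs H) = card (pverts G)}"
    using arcs_graph_bij J unfolding bij_betw_def by blast
  then have H: "pverts (arcs_graph J) = pverts G" "parcs (arcs_graph J) \<subseteq> parcs G"
      "card (parcs (arcs_graph J)) = card (pverts G)"
    by (auto simp: spanning_pairs)
  show sq: "(cmod (det (pick_cols N J)))\<^sup>2 =
    (if arcs_graph J \<in> unicyclic_family G w then \<Prod>U\<in>wccs (arcs_graph J). component_weight U else 0)"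
    using pick_cols_N(2)[OF J] spanning_absdet(1)[OF H] by simp
  then show "det (pick_cols N J) \<noteq> 0 \<longleftrightarrow> arcs_graph J \<in> unicyclic_family G w"
    using spanning_absdet(2)[OF H] by (auto split: if_splits)
qed

lemma vol2_N:
  assumes det: "det (N * mat_adjoint N) \<noteq> 0"
  shows "vol2 N = (\<Sum>H\<in>unicyclic_family G w. \<Prod>U\<in>wccs H. component_weight U)"
proof -
  let ?JJ = "{J. J \<subseteq> {..<length es} \<and> card J = n}"
  let ?HH = "{H. spanning (with_proj H) (with_proj G) \<and> card (parcs H) = card (pverts G)}"
  let ?g = "\<lambda>H. if H \<in> unicyclic_family G w then \<Prod>U\<in>wccs H. component_weight U else 0"
  have "finite ?JJ" by (rule finite_subset[of _ "Pow {..<length es}"]) auto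
  then have fin: "finite ?HH" using arcs_graph_bij bij_betw_finite by blast
  have "vol2 N = (\<Sum>J\<in>?JJ. ?g (arcs_graph J))"
    unfolding full_row_rank(2)[OF N_carrier det]
    by (rule sum.cong) (use det_pick_cols_N(1) in auto)
  also have "\<dots> = (\<Sum>H\<in>?HH. ?g H)" by (rule sum.reindex_bij_betw[OF arcs_graph_bij])
  also have "\<dots> = (\<Sum>H\<in>unicyclic_family G w. \<Prod>U\<in>wccs H. component_weight U)"
    by (rule sum.mono_neutral_cong_right[OF fin]) (auto simp: unicyclic_family_iff)
  finally show ?thesis .
qed

lemma mp_inverse_N:
  assumes det: "det (N * mat_adjoint N) \<noteq> 0" and i: "i < length es" and j: "j < n"
  shows "mp_inverse N $$ (i, j) = 1 / of_real (vol2 N) *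
    (\<Sum>H\<in>{H\<in>unicyclic_family G w. es ! i \<in> parcs H}.
      sub_mp_entry n es w H i j * of_real (\<Prod>U\<in>wccs H. component_weight U))"
proof -
  let ?JJ = "{J. J \<subseteq> {..<length es} \<and> card J = n \<and> i \<in> J \<and> det (pick_cols N J) \<noteq> 0}"
  let ?HH = "{H\<in>unicyclic_family G w. es ! i \<in> parcs H}"
  have det_eq: "det (N * mat_adjoint N) = of_real (vol2 N)"
    unfolding full_row_rank(2)[OF N_carrier det] by (rule det_gram_Cauchy_Binet[OF N_carrier])
  have bij: "bij_betw arcs_graph ?JJ ?HH"
  proof (rule bij_betw_imageI)
    show "inj_on arcs_graph ?JJ"
      by (rule inj_on_subset[OF bij_betw_imp_inj_on[OF arcs_graph_bij]]) blast
    have mem: "es ! i \<in> parcs (arcs_graph J) \<longleftrightarrow> i \<in> J" if "J \<subseteq> {..<length es}" for J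
      using that i dist by (auto simp: arcs_graph_def nth_eq_iff_index_eq subset_iff)
    show "arcs_graph ` ?JJ = ?HH"
    proof (intro subset_antisym subsetI)
      fix H assume "H \<in> ?HH"
      then have H: "H \<in> unicyclic_family G w" "es ! i \<in> parcs H" by auto
      then have "H \<in> arcs_graph ` {J. J \<subseteq> {..<length es} \<and> card J = n}"
        using arcs_graph_bij by (simp add: bij_betw_def unicyclic_family_iff)
      then obtain J where "J \<subseteq> {..<length es}" "card J = n" "H = arcs_graph J" by blast
      then show "H \<in> arcs_graph ` ?JJ" using H mem det_pick_cols_N(2) by blast
    qed (use mem det_pick_cols_N(2) in blast)
  qed
  have sum1: "(\<Sum>J\<in>?JJ. mp_inverse (pick_cols N J) $$ (card {a\<in>J. a < i}, j) * of_real ((cmod (det (pick_cols N J)))\<^sup>2)) =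
    (\<Sum>J\<in>?JJ. sub_mp_entry n es w (arcs_graph J) i j * of_real (\<Prod>U\<in>wccs (arcs_graph J). component_weight U))"
  proof (rule sum.cong[OF refl])
    fix J assume "J \<in> ?JJ"
    then have J: "J \<subseteq> {..<length es}" "card J = n" "i \<in> J" "det (pick_cols N J) \<noteq> 0" by auto
    then show "mp_inverse (pick_cols N J) $$ (card {a\<in>J. a < i}, j) * of_real ((cmod (det (pick_cols N J)))\<^sup>2) =
      sub_mp_entry n es w (arcs_graph J) i j * of_real (\<Prod>U\<in>wccs (arcs_graph J). component_weight U)"
      unfolding sub_mp_entry_def sub_arcs_arcs_graph(2)[OF J(1,3)] pick_cols_N(1)[OF J(1,2), symmetric]
        det_pick_cols_N(1)[OF J(1,2)]
      using det_pick_cols_N(2)[OF J(1,2)] by simp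
  qed
  have sum2: "(\<Sum>J\<in>?JJ. sub_mp_entry n es w (arcs_graph J) i j * of_real (\<Prod>U\<in>wccs (arcs_graph J). component_weight U))
    = (\<Sum>H\<in>?HH. sub_mp_entry n es w H i j * of_real (\<Prod>U\<in>wccs H. component_weight U))"
    by (rule sum.reindex_bij_betw[OF bij])
  show ?thesis
    unfolding mp_inverse_Cauchy_Binet[OF N_carrier det i j] det_eq sum1 sum2 ..
qed

text \<open>Row \<open>e\<close> of \<open>N\<^sub>H\<^sup>+ = N\<^sub>H\<^sup>-\<^sup>1\<close> is the unique \<open>y\<close> with \<open>y N\<^sub>H\<close> equal to the unit row at \<open>e\<close>.\<close>
lemma sub_mp_entry_row:
  assumes H: "H \<in> unicyclic_family G w" and i: "i < length es" "es ! i \<in> parcs H"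
  defines "y \<equiv> sub_mp_entry n es w H i"
  shows "e \<in> parcs H \<Longrightarrow> e \<noteq> es ! i \<Longrightarrow> balanced w y e"
    and "y (fst (es ! i)) * csqrt (w (es ! i)) + y (snd (es ! i)) * csqrt (cnj (w (es ! i))) = 1"
proof -
  have "H \<in> arcs_graph ` {J. J \<subseteq> {..<length es} \<and> card J = n}"
    using arcs_graph_bij H by (simp add: bij_betw_def unicyclic_family_iff)
  then obtain J where J: "J \<subseteq> {..<length es}" "card J = n" "H = arcs_graph J" by blast
  have iJ: "i \<in> J" using i J dist by (auto simp: arcs_graph_def nth_eq_iff_index_eq subset_iff)
  let ?B = "pick_cols N J" and ?k = "card {a\<in>J. a < i}"
  have B: "?B \<in> carrier_mat n n" by (simp add: pick_cols_def signless_incidence_def)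
  have det: "det ?B \<noteq> 0" using det_pick_cols_N(2)[OF J(1,2)] H J(3) by simp
  note Y = mp_inverse_square[OF B det]
  have y: "y x = mp_inverse ?B $$ (?k, x)" for x
    unfolding y_def sub_mp_entry_def J(3) sub_arcs_arcs_graph(2)[OF J(1) iJ] pick_cols_N(1)[OF J(1,2)] ..
  have fJ: "finite J" using J(1) by (auto intro: finite_subset)
  have k: "?k < n" using J(2) iJ fJ by (auto intro!: psubset_card_mono)
  have pk: "pick J ?k = i" using pick_card_in_set[OF iJ] .
  have sum: "(\<Sum>x<n. y x * incidence w x (es ! pick J c)) = (if ?k = c then 1 else 0)" if c: "c < n" for c
  proof -
    have "pick J c < length es" using pick_in_set_le[of c J] c J(1,2) by auto
    then have "(\<Sum>x<n. y x * incidence w x (es ! pick J c)) = (\<Sum>x<n. mp_inverse ?B $$ (?k, x) * ?B $$ (x, c))"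
      using c by (intro sum.cong refl) (simp add: y pick_cols_def signless_incidence_eq)
    also have "\<dots> = (mp_inverse ?B * ?B) $$ (?k, c)"
      by (rule index_mult_mat_sum[symmetric, OF Y(1) B k c])
    finally show ?thesis using Y(2) k c by simp
  qed
  have iG: "es ! i \<in> parcs G" using nth_mem[OF i(1)] arcs by simp
  show "y (fst (es ! i)) * csqrt (w (es ! i)) + y (snd (es ! i)) * csqrt (cnj (w (es ! i))) = 1"
    using sum[OF k] pk sum_incidence[of "{..<n}" "es ! i" y w] arc_ends[OF iG] by simp
  assume e: "e \<in> parcs H" "e \<noteq> es ! i"
  then obtain l where l: "l \<in> J" "e = es ! l" using J(3) by (auto simp: arcs_graph_def)
  let ?c = "card {a\<in>J. a < l}"
  have c: "?c < n" "pick J ?c = l"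
    using J(2) l fJ pick_card_in_set[OF l(1)] by (auto intro!: psubset_card_mono)
  \<comment> \<open>Different arcs occupy different columns, so the unit row for
    \<open>es ! i\<close> is 0 in the column of \<open>e\<close>.\<close>
  have "?k \<noteq> ?c"
  proof
    assume "?k = ?c"
    then have "i = l" using pk c(2) by metis
    then show False using e(2) l(2) by simp
  qed
  moreover have "e \<in> parcs G" using nth_mem[of l es] l J(1) arcs by auto
  ultimately show "balanced w y e" using sum[OF c(1)] c(2) l(2) by (intro sub_incidence_kernel) auto
qed

end

theorem theorem4p9:
  fixes G :: "nat pair_pre_digraph"
    and es :: "(nat \<times> nat) list"
    and w :: "nat \<times> nat \<Rightarrow> complex"
    and N :: "complex mat"
    and n m :: nat
  assumes "oriented_graph G"
    and "Digraph_Component.connected (with_proj G)"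
    and "n \<ge> 2" and "pverts G = {..<n}"
    and "m \<ge> 1" and "length es = m" and "distinct es" and "set es = parcs G"
    and "\<And>e. e \<in> parcs G \<Longrightarrow> w e \<noteq> 0 \<and> w e \<notin> \<real>\<^sup>-"
    and "N = signless_incidence n es w"
    and "ucycles G \<noteq> {}"
    and "\<exists>C \<in> ucycles G. (odd (card C) \<and> cycle_wt G w C \<notin> \<real>\<^sup>-) \<or>
                          (even (card C) \<and> cycle_wt G w C \<notin> \<real>\<^sup>+)"
  shows "vec_space.rank n N = n \<and>
         (\<forall>i < m. \<forall>j < n. mp_inverse N $$ (i, j) =
           1 / complex_of_real (vol2 N) *
           (\<Sum>H \<in> {H \<in> unicyclic_family G w. es ! i \<in> parcs H}.
              sub_mp_entry n es w H i j *
              complex_of_real (\<Prod>U \<in> wccs H.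
                2 * cmod (\<Prod>e \<in> parcs U - the_cycle U. w e) * alpha G w (the_cycle U)))) \<and>
         vol2 N =
           (\<Sum>H \<in> unicyclic_family G w. \<Prod>U \<in> wccs H.
              2 * cmod (\<Prod>e \<in> parcs U - the_cycle U. w e) * alpha G w (the_cycle U)) \<and>
         (\<forall>H \<in> unicyclic_family G w. \<forall>U \<in> wccs H. \<forall>i < m. \<forall>j < n.
           es ! i \<in> parcs U \<longrightarrow> sub_mp_entry n es w H i j = explicit_entry G w U (es ! i) j)"
proof -
  interpret enumerated_graph G w es n
    by unfold_locales (use assms in auto)
  obtain C where C: "C \<in> ucycles G" "good_cycle C"
    using assms(12) by (auto simp: good_cycle_def)
  have N: "N = signless_incidence n es w" by fact
  have det: "det (N * mat_adjoint N) \<noteq> 0" unfolding N by (rule det_gram_N[OF assms(2) C])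
  have "sub_mp_entry n es w H i j = explicit_entry G w U (es ! i) j"
    if H: "H \<in> unicyclic_family G w" and U: "U \<in> wccs H" and i: "i < m" and j: "j < n"
      and e: "es ! i \<in> parcs U" for H U i j
  proof -
    have "oriented_graph H"
      by (rule oriented_subgraph[OF G])
        (use H oriented_graphD(4)[OF G] in \<open>auto simp: unicyclic_family_iff spanning_pairs\<close>)
    then have eH: "es ! i \<in> parcs H" using wccsD(4)[OF _ U] e by blast
    have il: "i < length es" using i assms(6) by simp
    \<comment> \<open>The row of the inverse is balanced at all arcs of \<open>H\<close> other than
      \<open>es ! i\<close> and gives 1 there, and these equations determine it.\<close>
    show ?thesis
      by (rule balanced_explicit_entry[OF H U e sub_mp_entry_row(1)[OF H il eH] sub_mp_entry_row(2)[OF H il eH]])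
        (use j verts in simp_all)
  qed
  then show ?thesis
    using full_row_rank(1)[OF N_carrier] mp_inverse_N vol2_N det assms(6) unfolding N by simp
qed

end
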